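(* Let $k_2=0$. Let $k_1>0$, or $k_1=0$ and $F<0$. Then there exists $\varepsilon=\varepsilon(F)>0$ such that for all $|m_1l_1-m_3l_3|<\varepsilon$ both the full system $$A_{11}\ddot\varphi_1+A_{12}\ddot\varphi_2=r_1,\qquad A_{12}\ddot\varphi_1+A_{22}\ddot\varphi_2=r_2$$ and the reduced system $$\dot\varphi_1=v_1,\qquad \dot v_1=\left(r_1-\frac{A_{12}}{A_{22}}r_2\right)\left(A_{11}-\frac{A_{12}^2}{A_{22}}\right)^{-1},\qquad \dot v_2=\left(r_2-\frac{A_{12}}{A_{11}}r_1\right)\left(A_{22}-\frac{A_{12}^2}{A_{11}}\right)^{-1}$$ are integrable, in the following sense: there is a nonempty open set $W$ of the three-dimensional space with coordinates $(\varphi_1,v_1,v_2)$, filled by periodic trajectories of the reduced system, such that (1) the reduced system has two functionally independent smooth first integrals in $W$; (2) in the region $\{(\varphi_1,v_1,v_2)\in W\}$ of its four-dimensional phase space with coordinates $(\varphi_1,\varphi_2,v_1,v_2)$, the full system is integrable in the sense of the Jacobi theorem and is integrable in a broad sense.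
   Context: These are the equations of the Ziegler pendulum (a planar double pendulum with point masses $m_1,m_2,m_3>0$, rod lengths $l_1,l_2,l_3>0$, a follower force of constant magnitude, with signed value $F$, stiffness $k_1$ of the spring between the rods) with zero stiffness $k_2=0$ of the spring at the pivot; $v_1=\dot\varphi_1$, $v_2=\dot\varphi_2$. Here $$A_{11}=m_1l_1^2+m_3l_3^2,$$ $$A_{12}=m_1l_1^2+m_3l_3^2+(m_1l_1-m_3l_3)l_2\cos\varphi_1,$$ $$A_{22}=(m_1+m_2+m_3)l_2^2+m_1l_1^2+m_3l_3^2+2(m_1l_1-m_3l_3)l_2\cos\varphi_1,$$ $$r_1=-k_1\varphi_1-(m_1l_1-m_3l_3)l_2v_2^2\sin\varphi_1,$$ $$r_2=-Fl_2\sin\varphi_1+(m_1l_1-m_3l_3)l_2v_1(v_1+2v_2)\sin\varphi_1.$$ The full system is integrable in the sense of the Jacobi theorem (in a region) if it has there two functionally independent smooth first integrals and a smooth invariant measure. It is integrable in a broad sense if it has there two functionally independent smooth first integrals and a two-dimensional Lie algebra of symmetries which preserves the first integrals; here this Lie algebra is defined by two commuting vector fields, the vector field of the system itself and $\partial/\partial\varphi_2$. *)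

theory Defs
  imports "HOL-Analysis.Analysis"
begin

section \<open>Smooth maps and autonomous systems on open sets\<close>

primrec differentiable_upto ::
    "nat \<Rightarrow> 'a::real_normed_vector set \<Rightarrow> ('a \<Rightarrow> 'b::real_normed_vector) \<Rightarrow> bool" where
  "differentiable_upto 0 U f \<longleftrightarrow> continuous_on U f"
| "differentiable_upto (Suc n) U f \<longleftrightarrow>
     (\<forall>x\<in>U. f differentiable (at x)) \<and>
     (\<forall>h. differentiable_upto n U (\<lambda>x. frechet_derivative f (at x) h))"

text \<open>\<open>C\<^sup>\<infinity>\<close> on an open set, by iterating directional derivatives.\<close>

definition smooth_on ::
    "'a::real_normed_vector set \<Rightarrow> ('a \<Rightarrow> 'b::real_normed_vector) \<Rightarrow> bool" where
  "smooth_on U f \<longleftrightarrow> (\<forall>n. differentiable_upto n U f)"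

definition trajectory ::
    "('a::real_normed_vector \<Rightarrow> 'a) \<Rightarrow> 'a set \<Rightarrow> real set \<Rightarrow> (real \<Rightarrow> 'a) \<Rightarrow> bool" where
  "trajectory X U J x \<longleftrightarrow>
     (\<forall>t\<in>J. x t \<in> U \<and> (x has_vector_derivative X (x t)) (at t within J))"

definition filled_by_periodic_trajectories ::
    "('a::real_normed_vector \<Rightarrow> 'a) \<Rightarrow> 'a set \<Rightarrow> bool" where
  "filled_by_periodic_trajectories X U \<longleftrightarrow>
     (\<forall>z\<in>U. \<exists>x T. trajectory X U UNIV x \<and> x 0 = z \<and>
        T > 0 \<and> (\<forall>t. x (t + T) = x t) \<and> \<not> x constant_on UNIV)"

definition first_integral ::
    "('a::real_normed_vector \<Rightarrow> 'a) \<Rightarrow> 'a set \<Rightarrow> ('a \<Rightarrow> real) \<Rightarrow> bool" where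
  "first_integral X U f \<longleftrightarrow>
     smooth_on U f \<and>
     (\<forall>J x. is_interval J \<longrightarrow> trajectory X U J x \<longrightarrow> (\<lambda>t. f (x t)) constant_on J)"

text \<open>Independence is required in the strong sense: the differentials are linearly independent
  at every point of \<open>U\<close>.\<close>

definition functionally_independent ::
    "'a::real_normed_vector set \<Rightarrow> ('a \<Rightarrow> real) \<Rightarrow> ('a \<Rightarrow> real) \<Rightarrow> bool" where
  "functionally_independent U f g \<longleftrightarrow>
     (\<forall>z\<in>U. \<forall>a b.
        (\<forall>h. a * frechet_derivative f (at z) h + b * frechet_derivative g (at z) h = 0)
        \<longrightarrow> a = 0 \<and> b = 0)"

definition two_independent_first_integrals ::
    "('a::real_normed_vector \<Rightarrow> 'a) \<Rightarrow> 'a set \<Rightarrow> bool" where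
  "two_independent_first_integrals X U \<longleftrightarrow>
     (\<exists>f g. first_integral X U f \<and> first_integral X U g \<and> functionally_independent U f g)"

text \<open>The measure with density \<open>\<rho>\<close> on \<open>U\<close>; values of \<open>\<rho>\<close> outside \<open>U\<close> are irrelevant.\<close>

definition measure_with_density :: "'a::euclidean_space set \<Rightarrow> ('a \<Rightarrow> real) \<Rightarrow> 'a measure" where
  "measure_with_density U \<rho> = density lborel (\<lambda>z. ennreal (\<rho> z) * indicator U z)"

text \<open>The flow need not be complete in \<open>U\<close>: invariance is tested on those Borel sets \<open>A\<close> whose
  points can be transported within \<open>U\<close> during the whole time interval \<open>[0, T]\<close>; there
  \<open>\<gamma> z\<close> is the trajectory starting at \<open>z\<close>.\<close>

definition smooth_invariant_measure ::
    "('a::euclidean_space \<Rightarrow> 'a) \<Rightarrow> 'a set \<Rightarrow> ('a \<Rightarrow> real) \<Rightarrow> bool" where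
  "smooth_invariant_measure X U \<rho> \<longleftrightarrow>
     smooth_on U \<rho> \<and> (\<forall>z\<in>U. \<rho> z > 0) \<and>
     (\<forall>A T \<gamma>. A \<in> sets borel \<longrightarrow> A \<subseteq> U \<longrightarrow> T \<ge> 0 \<longrightarrow>
        (\<forall>z\<in>A. trajectory X U {0..T} (\<gamma> z) \<and> \<gamma> z 0 = z) \<longrightarrow>
        emeasure (measure_with_density U \<rho>) ((\<lambda>z. \<gamma> z T) ` A)
          = emeasure (measure_with_density U \<rho>) A)"

text \<open>The number of integrals is the one for a four-dimensional phase space.\<close>

definition Jacobi_integrable :: "(real^4 \<Rightarrow> real^4) \<Rightarrow> (real^4) set \<Rightarrow> bool" where
  "Jacobi_integrable X U \<longleftrightarrow>
     two_independent_first_integrals X U \<and> (\<exists>\<rho>. smooth_invariant_measure X U \<rho>)"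

definition lie_bracket ::
    "('a::real_normed_vector \<Rightarrow> 'a) \<Rightarrow> ('a \<Rightarrow> 'a) \<Rightarrow> 'a \<Rightarrow> 'a" where
  "lie_bracket X Y z = frechet_derivative Y (at z) (X z) - frechet_derivative X (at z) (Y z)"

definition preserves ::
    "('a::real_normed_vector \<Rightarrow> 'a) \<Rightarrow> 'a set \<Rightarrow> ('a \<Rightarrow> real) \<Rightarrow> bool" where
  "preserves Y U f \<longleftrightarrow> (\<forall>z\<in>U. frechet_derivative f (at z) (Y z) = 0)"

text \<open>The symmetry algebra is spanned by the vector field \<open>X\<close> of the system and by \<open>Y\<close>; the two
  fields are required to be linearly independent at every point.\<close>

definition broadly_integrable ::
    "(real^4 \<Rightarrow> real^4) \<Rightarrow> (real^4 \<Rightarrow> real^4) \<Rightarrow> (real^4) set \<Rightarrow> bool" where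
  "broadly_integrable X Y U \<longleftrightarrow>
     smooth_on U X \<and> smooth_on U Y \<and>
     (\<forall>z\<in>U. lie_bracket X Y z = 0) \<and>
     (\<forall>z\<in>U. \<forall>a b. a *\<^sub>R X z + b *\<^sub>R Y z = 0 \<longrightarrow> a = 0 \<and> b = 0) \<and>
     (\<exists>f g. first_integral X U f \<and> first_integral X U g \<and> functionally_independent U f g \<and>
        preserves X U f \<and> preserves X U g \<and> preserves Y U f \<and> preserves Y U g)"


section \<open>The Ziegler pendulum without spring at the pivot\<close>

record pendulum =
  m1 :: real  m2 :: real  m3 :: real
  l1 :: real  l2 :: real  l3 :: real
  k1 :: real

definition positive_masses_and_lengths :: "pendulum \<Rightarrow> bool" where
  "positive_masses_and_lengths p \<longleftrightarrow>
     m1 p > 0 \<and> m2 p > 0 \<and> m3 p > 0 \<and> l1 p > 0 \<and> l2 p > 0 \<and> l3 p > 0"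

definition A11 :: "pendulum \<Rightarrow> real" where
  "A11 p = m1 p * (l1 p)\<^sup>2 + m3 p * (l3 p)\<^sup>2"

definition A12 :: "pendulum \<Rightarrow> real \<Rightarrow> real" where
  "A12 p \<phi>1 = m1 p * (l1 p)\<^sup>2 + m3 p * (l3 p)\<^sup>2 + (m1 p * l1 p - m3 p * l3 p) * l2 p * cos \<phi>1"

definition A22 :: "pendulum \<Rightarrow> real \<Rightarrow> real" where
  "A22 p \<phi>1 = (m1 p + m2 p + m3 p) * (l2 p)\<^sup>2 + m1 p * (l1 p)\<^sup>2 + m3 p * (l3 p)\<^sup>2
     + 2 * (m1 p * l1 p - m3 p * l3 p) * l2 p * cos \<phi>1"

definition r1 :: "pendulum \<Rightarrow> real \<Rightarrow> real \<Rightarrow> real \<Rightarrow> real" where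
  "r1 p \<phi>1 v1 v2 = - k1 p * \<phi>1 - (m1 p * l1 p - m3 p * l3 p) * l2 p * v2\<^sup>2 * sin \<phi>1"

definition r2 :: "pendulum \<Rightarrow> real \<Rightarrow> real \<Rightarrow> real \<Rightarrow> real \<Rightarrow> real" where
  "r2 p F \<phi>1 v1 v2 = - F * l2 p * sin \<phi>1
     + (m1 p * l1 p - m3 p * l3 p) * l2 p * v1 * (v1 + 2 * v2) * sin \<phi>1"

text \<open>Reduced phase space: coordinates \<open>(\<phi>1, v1, v2)\<close>.\<close>

definition dv1 :: "pendulum \<Rightarrow> real \<Rightarrow> real \<Rightarrow> real \<Rightarrow> real \<Rightarrow> real" where
  "dv1 p F \<phi>1 v1 v2 =
     (r1 p \<phi>1 v1 v2 - A12 p \<phi>1 / A22 p \<phi>1 * r2 p F \<phi>1 v1 v2)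
       * inverse (A11 p - (A12 p \<phi>1)\<^sup>2 / A22 p \<phi>1)"

definition dv2 :: "pendulum \<Rightarrow> real \<Rightarrow> real \<Rightarrow> real \<Rightarrow> real \<Rightarrow> real" where
  "dv2 p F \<phi>1 v1 v2 =
     (r2 p F \<phi>1 v1 v2 - A12 p \<phi>1 / A11 p * r1 p \<phi>1 v1 v2)
       * inverse (A22 p \<phi>1 - (A12 p \<phi>1)\<^sup>2 / A11 p)"

definition reduced_system :: "pendulum \<Rightarrow> real \<Rightarrow> real^3 \<Rightarrow> real^3" where
  "reduced_system p F z = vector
     [z$2, dv1 p F (z$1) (z$2) (z$3), dv2 p F (z$1) (z$2) (z$3)]"

text \<open>Full phase space: coordinates \<open>(\<phi>1, \<phi>2, v1, v2)\<close>. The accelerations are those determined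
  by the second-order equations; \<open>accelerations_unique\<close> below shows that they are well defined.\<close>

definition accelerations :: "pendulum \<Rightarrow> real \<Rightarrow> real \<Rightarrow> real \<Rightarrow> real \<Rightarrow> real \<times> real" where
  "accelerations p F \<phi>1 v1 v2 = (THE (a1, a2).
     A11 p * a1 + A12 p \<phi>1 * a2 = r1 p \<phi>1 v1 v2 \<and>
     A12 p \<phi>1 * a1 + A22 p \<phi>1 * a2 = r2 p F \<phi>1 v1 v2)"

definition full_system :: "pendulum \<Rightarrow> real \<Rightarrow> real^4 \<Rightarrow> real^4" where
  "full_system p F z = vector
     [z$3, z$4, fst (accelerations p F (z$1) (z$3) (z$4)),
                snd (accelerations p F (z$1) (z$3) (z$4))]"

definition d_phi2 :: "real^4 \<Rightarrow> real^4" where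
  "d_phi2 z = axis 2 1"

definition full_region :: "(real^3) set \<Rightarrow> (real^4) set" where
  "full_region W = {z. vector [z$1, z$3, z$4] \<in> W}"

lemma A_det_pos:
  assumes "positive_masses_and_lengths p"
  shows "A11 p > 0" "A22 p \<phi>1 > 0" "A11 p * A22 p \<phi>1 - (A12 p \<phi>1)\<^sup>2 > 0"
proof -
  have pos: "m1 p > 0" "m2 p > 0" "m3 p > 0" "l1 p > 0" "l2 p > 0" "l3 p > 0"
    using assms by (auto simp: positive_masses_and_lengths_def)
  show a: "A11 p > 0" using pos by (simp add: A11_def add_pos_pos)
  let ?d = "m1 p * l1 p - m3 p * l3 p"
  have id: "A11 p * A22 p \<phi>1 - (A12 p \<phi>1)\<^sup>2
      = (l2 p)\<^sup>2 * ((m1 p + m2 p + m3 p) * A11 p - ?d\<^sup>2 * (cos \<phi>1)\<^sup>2)"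
    by (simp add: A11_def A12_def A22_def power2_eq_square algebra_simps)
  have "?d\<^sup>2 * (cos \<phi>1)\<^sup>2 \<le> ?d\<^sup>2 * 1"
    by (intro mult_left_mono) (simp_all add: abs_square_le_1)
  also have "?d\<^sup>2 < (m1 p + m2 p + m3 p) * A11 p"
  proof -
    have "(m1 p + m2 p + m3 p) * A11 p - ?d\<^sup>2 = m2 p * A11 p + m1 p * m3 p * (l1 p + l3 p)\<^sup>2"
      by (simp add: A11_def power2_eq_square algebra_simps)
    also have "\<dots> > 0" using pos a by (simp add: add_pos_nonneg)
    finally show ?thesis by simp
  qed
  finally have "(m1 p + m2 p + m3 p) * A11 p - ?d\<^sup>2 * (cos \<phi>1)\<^sup>2 > 0" by simp
  then show det: "A11 p * A22 p \<phi>1 - (A12 p \<phi>1)\<^sup>2 > 0" unfolding id using pos by simp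
  then have "A11 p * A22 p \<phi>1 > 0" using zero_le_power2[of "A12 p \<phi>1"] by linarith
  then show "A22 p \<phi>1 > 0" using a by (simp add: zero_less_mult_iff)
qed

lemma accelerations_unique:
  assumes "positive_masses_and_lengths p"
  shows "A11 p * a1 + A12 p \<phi>1 * a2 = r1 p \<phi>1 v1 v2 \<and>
         A12 p \<phi>1 * a1 + A22 p \<phi>1 * a2 = r2 p F \<phi>1 v1 v2
         \<longleftrightarrow> a1 = dv1 p F \<phi>1 v1 v2 \<and> a2 = dv2 p F \<phi>1 v1 v2"
proof -
  note pos = A_det_pos(1)[OF assms] A_det_pos(2,3)[OF assms, of \<phi>1]
  define a b c u w where abc: "a = A11 p" "b = A12 p \<phi>1" "c = A22 p \<phi>1"
    "u = r1 p \<phi>1 v1 v2" "w = r2 p F \<phi>1 v1 v2"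
  define D where "D = a * c - b\<^sup>2"
  have D: "D > 0" "a > 0" "c > 0" using pos by (auto simp: abc D_def)
  have "a - b\<^sup>2 / c = D / c" "c - b\<^sup>2 / a = D / a"
    using D by (auto simp: D_def field_simps)
  then have dv: "dv1 p F \<phi>1 v1 v2 = (c * u - b * w) / D" "dv2 p F \<phi>1 v1 v2 = (a * w - b * u) / D"
    using D by (auto simp: dv1_def dv2_def abc[symmetric] field_simps)
  have "a * a1 + b * a2 = u \<and> b * a1 + c * a2 = w
      \<longleftrightarrow> D * a1 = c * u - b * w \<and> D * a2 = a * w - b * u" (is "?L \<longleftrightarrow> ?R")
  proof
    assume ?L
    then have u: "u = a * a1 + b * a2" and w: "w = b * a1 + c * a2" by auto
    show ?R unfolding u w D_def by (simp add: power2_eq_square algebra_simps)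
  next
    assume R: ?R
    have "D * (a * a1 + b * a2) = a * (D * a1) + b * (D * a2)" by (simp add: algebra_simps)
    also have "\<dots> = a * (c * u - b * w) + b * (a * w - b * u)" using R by simp
    also have "\<dots> = D * u" by (simp add: D_def power2_eq_square algebra_simps)
    finally have 1: "a * a1 + b * a2 = u" using D by simp
    have "D * (b * a1 + c * a2) = b * (D * a1) + c * (D * a2)" by (simp add: algebra_simps)
    also have "\<dots> = b * (c * u - b * w) + c * (a * w - b * u)" using R by simp
    also have "\<dots> = D * w" by (simp add: D_def power2_eq_square algebra_simps)
    finally have 2: "b * a1 + c * a2 = w" using D by simp
    from 1 2 show ?L ..
  qed
  then show ?thesis using D by (simp add: dv abc[symmetric] eq_divide_eq mult.commute)
qed

lemma accelerations_eq:
  assumes "positive_masses_and_lengths p"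
  shows "accelerations p F \<phi>1 v1 v2 = (dv1 p F \<phi>1 v1 v2, dv2 p F \<phi>1 v1 v2)"
  unfolding accelerations_def accelerations_unique[OF assms]
  by (rule the_equality) auto

lemma full_system_nth:
  assumes "positive_masses_and_lengths p"
  shows "full_system p F z $ 1 = z$3"
    and "full_system p F z $ 2 = z$4"
    and "full_system p F z $ 3 = dv1 p F (z$1) (z$3) (z$4)"
    and "full_system p F z $ 4 = dv2 p F (z$1) (z$3) (z$4)"
  by (simp_all add: full_system_def vector_def accelerations_eq[OF assms])

end

theory Submission
  imports Defs
begin

text \<open>
Let \<open>P = A\<^sub>1\<^sub>2 v\<^sub>1 + A\<^sub>2\<^sub>2 v\<^sub>2\<close> be the momentum conjugate to \<open>\<phi>\<^sub>2\<close> and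
\<open>y = sqrt (det A / A\<^sub>2\<^sub>2) v\<^sub>1\<close>. In the coordinates \<open>(\<phi>\<^sub>1, y, P)\<close> and up to a positive
change of time the reduced system is \<open>\<phi>\<^sub>1' = y\<close>, \<open>y' = Y (\<phi>\<^sub>1, P)\<close>, \<open>P' = Z (\<phi>\<^sub>1)\<close>,
where \<open>Y\<close> and \<open>Z\<close> are odd in \<open>\<phi>\<^sub>1\<close>. So the system is reversible: the reflection
\<open>\<phi>\<^sub>1 \<mapsto> - \<phi>\<^sub>1\<close> turns trajectories into trajectories run backwards. With
\<open>k\<^sub>1 = 0\<close> the same holds for the reflection at \<open>\<phi>\<^sub>1 = \<pi>\<close>.

In polar coordinates \<open>(\<theta>, r)\<close> of the plane of \<open>(\<phi>\<^sub>1, y)\<close> around a centre of reflection, and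
wherever the angle \<open>\<theta>\<close> increases along trajectories, the system becomes an equation for
\<open>w = (r, P)\<close> with \<open>\<theta>\<close> as independent variable, whose right-hand side is odd and
\<open>2\<pi>\<close>-periodic in \<open>\<theta>\<close>. Its solutions are even, hence take equal values at \<open>- \<pi>\<close> and
\<open>\<pi>\<close>, hence are periodic. This fills a tube \<open>W\<close> with periodic trajectories, and the two
components of the initial value \<open>w\<close> at \<open>\<theta> = 0\<close>, as functions of the point of the tube, are
independent integrals (\<open>reversible_ODE\<close>, \<open>polar_pendulum\<close>).

The angle must increase and the solutions must stay in a box during half a turn. For
\<open>k\<^sub>1 > 0\<close> this holds for oscillations around \<open>0\<close> of large amplitude, where the spring dominates
(\<open>large_oscillations\<close>). For \<open>k\<^sub>1 = 0\<close> it holds for small oscillations around an elliptic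
equilibrium at \<open>0\<close> or \<open>\<pi>\<close>, possibly rotating with a large \<open>P\<close> (\<open>small_oscillations\<close>).
A perturbation argument from \<open>m\<^sub>1 l\<^sub>1 = m\<^sub>3 l\<^sub>3\<close> would not do: for fixed \<open>F\<close>, rescaling the
lengths, \<open>k\<^sub>1\<close> and time makes \<open>m\<^sub>1 l\<^sub>1 - m\<^sub>3 l\<^sub>3\<close> arbitrarily small without changing the system
otherwise.

Since the generalized forces depend on the angles only, the volume in angles and momenta is
preserved; hence \<open>det A\<close> is an invariant density in the coordinates
\<open>(\<phi>\<^sub>1, \<phi>\<^sub>2, v\<^sub>1, v\<^sub>2)\<close> (\<open>divergence_free\<close>, \<open>Liouville\<close>).

Both the integrals and Liouville's theorem rest on the smoothness of a flow in time and initial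
point (\<open>smooth_flow\<close>), which is derived from Picard's theorem: differences of trajectories, and
differences of differentials of the flow, solve linear equations whose coefficients depend
continuously on both initial points.
\<close>

section \<open>Calculus of smooth maps\<close>

lemma differentiable_upto_cong:
  assumes "open U" "\<And>x. x \<in> U \<Longrightarrow> f x = g x" "differentiable_upto n U f"
  shows "differentiable_upto n U g"
  using assms(2,3)
proof (induction n arbitrary: f g)
  case 0
  then show ?case by (simp cong: continuous_on_cong)
next
  case (Suc n)
  have d: "f differentiable (at x)" if "x \<in> U" for x using Suc.prems(2) that by simp
  have "g differentiable (at x)" if "x \<in> U" for x
    using d[OF that] has_derivative_transform_within_open[where f=f and g=g, OF _ \<open>open U\<close> that Suc.prems(1)]
    unfolding differentiable_def by blast
  moreover have "differentiable_upto n U (\<lambda>x. frechet_derivative g (at x) h)" for h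
  proof (rule Suc.IH)
    show "differentiable_upto n U (\<lambda>x. frechet_derivative f (at x) h)" using Suc.prems(2) by simp
    show "frechet_derivative f (at x) h = frechet_derivative g (at x) h" if "x \<in> U" for x
      using frechet_derivative_transform_within_open[OF d[OF that] \<open>open U\<close> that Suc.prems(1)] by simp
  qed
  ultimately show ?case by simp
qed

text \<open>Derivatives are unique, so any formula that is a derivative can stand for
  \<open>frechet_derivative\<close>.\<close>

lemma differentiable_upto_SucI:
  assumes "open U" "\<And>x. x \<in> U \<Longrightarrow> (f has_derivative f' x) (at x)"
    and "\<And>h. differentiable_upto n U (\<lambda>x. f' x h)"
  shows "differentiable_upto (Suc n) U f"
proof -
  have eq: "f' x = frechet_derivative f (at x)" if "x \<in> U" for x
    using assms(2)[OF that] by (rule frechet_derivative_at)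
  have "differentiable_upto n U (\<lambda>x. frechet_derivative f (at x) h)" for h
    by (rule differentiable_upto_cong[OF assms(1) _ assms(3)[of h]]) (simp only: eq)
  then show ?thesis using assms(2) by (auto simp: differentiable_def)
qed

lemma differentiable_upto_SucD:
  assumes "differentiable_upto (Suc n) U f"
  shows "x \<in> U \<Longrightarrow> (f has_derivative frechet_derivative f (at x)) (at x)"
    and "differentiable_upto n U (\<lambda>x. frechet_derivative f (at x) h)"
  using assms by (auto simp: frechet_derivative_works)

lemma differentiable_upto_Suc_imp: "differentiable_upto (Suc n) U f \<Longrightarrow> differentiable_upto n U f"
proof (induction n arbitrary: f)
  case 0
  then have "\<forall>x\<in>U. isCont f x" by (auto intro: differentiable_imp_continuous_within)
  then show ?case by (simp add: continuous_at_imp_continuous_on)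
next
  case (Suc n)
  have "differentiable_upto n U (\<lambda>x. frechet_derivative f (at x) h)" for h
    using Suc.prems unfolding differentiable_upto.simps(2)[of "Suc n"] by (intro Suc.IH) blast
  then show ?case
    using Suc.prems unfolding differentiable_upto.simps(2) by blast
qed

lemma differentiable_upto_imp_continuous: "differentiable_upto n U f \<Longrightarrow> continuous_on U f"
proof (induction n)
  case (Suc n)
  from differentiable_upto_Suc_imp[OF Suc.prems] show ?case by (rule Suc.IH)
qed simp

lemma differentiable_upto_subset:
  "differentiable_upto n U f \<Longrightarrow> V \<subseteq> U \<Longrightarrow> differentiable_upto n V f"
proof (induction n arbitrary: f)
  case 0
  then show ?case by (auto intro: continuous_on_subset)
next
  case (Suc n)
  have "differentiable_upto n V (\<lambda>x. frechet_derivative f (at x) h)" for h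
    using Suc.prems by (intro Suc.IH) simp_all
  with Suc.prems show ?case by auto
qed

lemma differentiable_upto_const: "open U \<Longrightarrow> differentiable_upto n U (\<lambda>x. c)"
proof (induction n arbitrary: c)
  case (Suc n)
  show ?case
    by (rule differentiable_upto_SucI[OF Suc.prems has_derivative_const]) (rule Suc.IH[OF Suc.prems])
qed simp

lemma differentiable_upto_bounded_linear:
  assumes "open U" "bounded_linear L"
  shows "differentiable_upto n U L"
proof (cases n)
  case 0
  then show ?thesis by (simp add: assms linear_continuous_on)
next
  case (Suc m)
  show ?thesis unfolding Suc
    by (rule differentiable_upto_SucI[OF assms(1)])
      (auto intro: bounded_linear_imp_has_derivative assms differentiable_upto_const)
qed

lemma differentiable_upto_add:
  assumes "open U" "differentiable_upto n U f" "differentiable_upto n U g"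
  shows "differentiable_upto n U (\<lambda>x. f x + g x)"
  using assms(2,3)
proof (induction n arbitrary: f g)
  case 0
  then show ?case by (simp add: continuous_on_add)
next
  case (Suc n)
  note f = differentiable_upto_SucD[OF Suc.prems(1)]
  note g = differentiable_upto_SucD[OF Suc.prems(2)]
  show ?case
    by (rule differentiable_upto_SucI[OF assms(1) has_derivative_add[OF f(1) g(1)]])
      (assumption, assumption, rule Suc.IH[OF f(2) g(2)])
qed

lemma differentiable_upto_bilinear:
  assumes "bounded_bilinear pr" "open U" "differentiable_upto n U f" "differentiable_upto n U g"
  shows "differentiable_upto n U (\<lambda>x. pr (f x) (g x))"
  using assms(3,4)
proof (induction n arbitrary: f g)
  case 0
  then show ?case using bounded_bilinear.continuous_on[OF assms(1)] by simp
next
  case (Suc n)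
  note f = differentiable_upto_SucD[OF Suc.prems(1)]
  note g = differentiable_upto_SucD[OF Suc.prems(2)]
  show ?case
  proof (rule differentiable_upto_SucI[OF assms(2)])
    show "((\<lambda>x. pr (f x) (g x)) has_derivative
        (\<lambda>h. pr (f x) (frechet_derivative g (at x) h) + pr (frechet_derivative f (at x) h) (g x))) (at x)"
      if "x \<in> U" for x
      by (rule bounded_bilinear.FDERIV[OF assms(1) f(1)[OF that] g(1)[OF that]])
    show "differentiable_upto n U (\<lambda>x. pr (f x) (frechet_derivative g (at x) h)
        + pr (frechet_derivative f (at x) h) (g x))" for h
      by (intro differentiable_upto_add assms(2) Suc.IH f(2) g(2)
          differentiable_upto_Suc_imp[OF Suc.prems(1)] differentiable_upto_Suc_imp[OF Suc.prems(2)])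
  qed
qed

lemmas differentiable_upto_scaleR = differentiable_upto_bilinear[OF bounded_bilinear_scaleR]
lemmas differentiable_upto_mult = differentiable_upto_bilinear[OF bounded_bilinear_mult]
lemmas differentiable_upto_inner = differentiable_upto_bilinear[OF bounded_bilinear_inner]

lemma differentiable_upto_sum:
  assumes "open U" "\<And>i. i \<in> I \<Longrightarrow> differentiable_upto n U (f i)"
  shows "differentiable_upto n U (\<lambda>x. \<Sum>i\<in>I. f i x)"
  using assms(2)
  by (induction I rule: infinite_finite_induct)
    (auto intro: differentiable_upto_add differentiable_upto_const assms(1))

lemma differentiable_upto_linear_compose:
  assumes "bounded_linear L" "open U" "differentiable_upto n U f"
  shows "differentiable_upto n U (\<lambda>x. L (f x))"
  using assms(3)
proof (induction n arbitrary: f)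
  case 0
  then show ?case by (simp add: bounded_linear.continuous_on[OF assms(1)])
next
  case (Suc n)
  note f = differentiable_upto_SucD[OF Suc.prems]
  show ?case
    by (rule differentiable_upto_SucI[OF assms(2) bounded_linear.has_derivative[OF assms(1) f(1)]])
      (assumption, rule Suc.IH[OF f(2)])
qed

lemma differentiable_upto_Pair:
  assumes "open U" "differentiable_upto n U f" "differentiable_upto n U g"
  shows "differentiable_upto n U (\<lambda>x. (f x, g x))"
  using assms(2,3)
proof (induction n arbitrary: f g)
  case 0
  then show ?case by (simp add: continuous_on_Pair)
next
  case (Suc n)
  note f = differentiable_upto_SucD[OF Suc.prems(1)]
  note g = differentiable_upto_SucD[OF Suc.prems(2)]
  show ?case
    by (rule differentiable_upto_SucI[OF assms(1) has_derivative_Pair[OF f(1) g(1)]])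
      (assumption, assumption, rule Suc.IH[OF f(2) g(2)])
qed

lemma linear_eq_sum_Basis:
  fixes L :: "'a::euclidean_space \<Rightarrow> 'b::real_normed_vector"
  assumes "linear L"
  shows "L k = (\<Sum>b\<in>Basis. (k \<bullet> b) *\<^sub>R L b)"
proof -
  have "L k = L (\<Sum>b\<in>Basis. (k \<bullet> b) *\<^sub>R b)" by (simp only: euclidean_representation)
  also have "\<dots> = (\<Sum>b\<in>Basis. (k \<bullet> b) *\<^sub>R L b)"
    by (simp only: linear_sum[OF assms] linear_cmul[OF assms])
  finally show ?thesis .
qed

text \<open>The definition of smoothness fixes the direction of differentiation. Expansion in a basis reduces
  directions that vary with the point, as they occur in the chain rule, to fixed ones.\<close>

lemma differentiable_upto_apply:
  fixes L :: "'x::real_normed_vector \<Rightarrow> 'a::euclidean_space \<Rightarrow> 'b::real_normed_vector"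
  assumes "open U" "\<And>x. x \<in> U \<Longrightarrow> linear (L x)"
    and "\<And>b. b \<in> Basis \<Longrightarrow> differentiable_upto n U (\<lambda>x. L x b)" "differentiable_upto n U k"
  shows "differentiable_upto n U (\<lambda>x. L x (k x))"
proof (rule differentiable_upto_cong[OF assms(1)])
  show "(\<Sum>b\<in>Basis. (k x \<bullet> b) *\<^sub>R L x b) = L x (k x)" if "x \<in> U" for x
    by (rule linear_eq_sum_Basis[OF assms(2)[OF that], symmetric])
  show "differentiable_upto n U (\<lambda>x. \<Sum>b\<in>Basis. (k x \<bullet> b) *\<^sub>R L x b)"
    by (intro differentiable_upto_sum differentiable_upto_scaleR differentiable_upto_inner
        differentiable_upto_const assms)
qed

lemma differentiable_upto_compose:
  fixes g :: "'b::euclidean_space \<Rightarrow> 'c::real_normed_vector"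
  assumes "open U" "differentiable_upto n U f" "differentiable_upto n V g" "f ` U \<subseteq> V"
  shows "differentiable_upto n U (\<lambda>x. g (f x))"
  using assms(2,3)
proof (induction n arbitrary: g)
  case 0
  then show ?case using assms(4) by (auto intro: continuous_on_compose2)
next
  case (Suc n)
  note f = differentiable_upto_SucD[OF Suc.prems(1)]
  note g = differentiable_upto_SucD[OF Suc.prems(2)]
  have fV: "f x \<in> V" if "x \<in> U" for x using that assms(4) by auto
  show ?case
  proof (rule differentiable_upto_SucI[OF assms(1)])
    show "((\<lambda>x. g (f x)) has_derivative
        (\<lambda>h. frechet_derivative g (at (f x)) (frechet_derivative f (at x) h))) (at x)" if "x \<in> U" for x
      by (rule has_derivative_compose[OF f(1)[OF that] g(1)[OF fV[OF that]]])
    show "differentiable_upto n U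
        (\<lambda>x. frechet_derivative g (at (f x)) (frechet_derivative f (at x) h))" for h
    proof (rule differentiable_upto_apply[OF assms(1)])
      show "linear (frechet_derivative g (at (f x)))" if "x \<in> U" for x
        using g(1)[OF fV[OF that]] by (rule has_derivative_linear)
      show "differentiable_upto n U (\<lambda>x. frechet_derivative g (at (f x)) b)" for b
        using differentiable_upto_Suc_imp[OF Suc.prems(1)] g(2) by (rule Suc.IH)
    qed (rule f(2))
  qed
qed

text \<open>The elementary functions are handled by their differential equations: a derivative of the
  composite is a polynomial in the composite itself and in a derivative of the inner function.\<close>

lemma differentiable_upto_sin_cos:
  fixes f :: "'a::real_normed_vector \<Rightarrow> real"
  assumes "open U" "differentiable_upto n U f"
  shows "differentiable_upto n U (\<lambda>x. sin (f x)) \<and> differentiable_upto n U (\<lambda>x. cos (f x))"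
  using assms(2)
proof (induction n)
  case 0
  then show ?case by (auto intro: continuous_intros)
next
  case (Suc n)
  note f = differentiable_upto_SucD[OF Suc.prems]
  have IH: "differentiable_upto n U (\<lambda>x. sin (f x))" "differentiable_upto n U (\<lambda>x. cos (f x))"
    using Suc.IH[OF differentiable_upto_Suc_imp[OF Suc.prems]] by auto
  have "differentiable_upto n U (\<lambda>x. -1 * sin (f x))"
    by (intro differentiable_upto_mult differentiable_upto_const assms(1) IH)
  then have m: "differentiable_upto n U (\<lambda>x. - sin (f x))" by simp
  show ?case
  proof
    show "differentiable_upto (Suc n) U (\<lambda>x. sin (f x))"
      by (rule differentiable_upto_SucI[OF assms(1) has_derivative_sin[OF f(1)]])
        (assumption, intro differentiable_upto_mult IH f(2) assms(1))
    show "differentiable_upto (Suc n) U (\<lambda>x. cos (f x))"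
      by (rule differentiable_upto_SucI[OF assms(1) has_derivative_cos[OF f(1)]])
        (assumption, intro differentiable_upto_mult m f(2) assms(1))
  qed
qed

lemma differentiable_upto_inverse:
  fixes f :: "'a::real_normed_vector \<Rightarrow> real"
  assumes "open U" "differentiable_upto n U f" "\<And>x. x \<in> U \<Longrightarrow> f x \<noteq> 0"
  shows "differentiable_upto n U (\<lambda>x. inverse (f x))"
  using assms(2)
proof (induction n)
  case 0
  then show ?case using assms(3) by (auto intro: continuous_intros)
next
  case (Suc n)
  note f = differentiable_upto_SucD[OF Suc.prems]
  note IH = Suc.IH[OF differentiable_upto_Suc_imp[OF Suc.prems]]
  have "((\<lambda>x. inverse (f x)) has_derivative
      (\<lambda>h. -1 * (inverse (f x) * frechet_derivative f (at x) h * inverse (f x)))) (at x)" if "x \<in> U" for x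
    using Deriv.has_derivative_inverse[OF assms(3)[OF that] f(1)[OF that]] by simp
  then show ?case
    by (rule differentiable_upto_SucI[OF assms(1)])
      (assumption, intro differentiable_upto_mult differentiable_upto_const assms(1) IH f(2))
qed

lemma differentiable_upto_sqrt:
  fixes f :: "'a::real_normed_vector \<Rightarrow> real"
  assumes "open U" "differentiable_upto n U f" "\<And>x. x \<in> U \<Longrightarrow> f x > 0"
  shows "differentiable_upto n U (\<lambda>x. sqrt (f x))"
  using assms(2)
proof (induction n)
  case 0
  then show ?case by (auto intro: continuous_intros)
next
  case (Suc n)
  note f = differentiable_upto_SucD[OF Suc.prems]
  note IH = Suc.IH[OF differentiable_upto_Suc_imp[OF Suc.prems]]
  have "((\<lambda>x. sqrt (f x)) has_derivative
      (\<lambda>h. frechet_derivative f (at x) h * (inverse (sqrt (f x)) * (1/2)))) (at x)" if "x \<in> U" for x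
    using DERIV_compose_FDERIV[where g=f, OF DERIV_real_sqrt[OF assms(3)[OF that]] f(1)[OF that]]
    by (simp add: field_simps)
  then show ?case
  proof (rule differentiable_upto_SucI[OF assms(1)])
    show "differentiable_upto n U
        (\<lambda>x. frechet_derivative f (at x) h * (inverse (sqrt (f x)) * (1/2)))" for h
      by (intro differentiable_upto_mult differentiable_upto_const assms(1) f(2)
          differentiable_upto_inverse IH) (use assms(3) in force)
  qed
qed

lemma differentiable_upto_arctan:
  fixes f :: "'a::real_normed_vector \<Rightarrow> real"
  assumes "open U" "differentiable_upto n U f"
  shows "differentiable_upto n U (\<lambda>x. arctan (f x))"
  using assms(2)
proof (induction n)
  case 0
  then show ?case by (auto intro: continuous_intros)
next
  case (Suc n)
  note f = differentiable_upto_SucD[OF Suc.prems]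
  note f0 = differentiable_upto_Suc_imp[OF Suc.prems]
  have pos: "1 + f x * f x \<noteq> 0" for x by (metis add_pos_nonneg less_numeral_extra(1,3) zero_le_square)
  have "((\<lambda>x. arctan (f x)) has_derivative
      (\<lambda>h. frechet_derivative f (at x) h * inverse (1 + f x * f x))) (at x)" if "x \<in> U" for x
    using DERIV_compose_FDERIV[where g=f, OF DERIV_arctan f(1)[OF that]]
    by (simp add: power2_eq_square)
  then show ?case
    by (rule differentiable_upto_SucI[OF assms(1)])
      (assumption, intro differentiable_upto_mult differentiable_upto_inverse differentiable_upto_add
        differentiable_upto_const assms(1) f(2) f0 pos)
qed

text \<open>Differentiation under the integral sign. The smoothness is assumed jointly in the integration
  variable and the parameter, since this passes from the integrand to its derivatives.\<close>

lemma differentiable_upto_integral: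
  fixes F :: "real \<times> 'w::euclidean_space \<Rightarrow> 'b::banach"
  assumes "open V" "differentiable_upto n (UNIV \<times> V) F"
  shows "differentiable_upto n V (\<lambda>w. integral {0..1} (\<lambda>s. F (s, w)))"
  using assms(2)
proof (induction n arbitrary: F)
  case 0
  have "continuous_on (V \<times> cbox 0 1) (\<lambda>(w, s). F (s, w))"
    unfolding split_beta
    by (rule continuous_on_compose2[where g=F and t="UNIV \<times> V"])
      (use 0 in \<open>auto intro!: continuous_intros\<close>)
  from integral_continuous_on_param[OF this] show ?case by simp
next
  case (Suc n)
  note F = differentiable_upto_SucD[OF Suc.prems]
  define DF where "DF s w h = frechet_derivative F (at (s, w)) (0, h)" for s w h
  have dF: "((\<lambda>w. F (s, w)) has_derivative DF s w) (at w)" if "w \<in> V" for s w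
  proof -
    have "((\<lambda>w. (s, w)) has_derivative (\<lambda>h. (0, h))) (at w)"
      by (intro derivative_intros)
    from has_derivative_compose[OF this F(1)] show ?thesis using that by (simp add: DF_def[abs_def])
  qed
  have bl: "bounded_linear (DF s w)" if "w \<in> V" for s w
    using dF[OF that] by (rule has_derivative_bounded_linear)
  have cDF: "continuous_on (UNIV \<times> V) (\<lambda>(s, w). DF s w h)" for h
    using differentiable_upto_imp_continuous[OF F(2)[of "(0, h)"]] by (simp add: DF_def split_beta)
  have cF: "continuous_on (UNIV \<times> V) F"
    using differentiable_upto_imp_continuous[OF Suc.prems] .
  show ?case
  proof (rule differentiable_upto_SucI[OF assms(1)])
    fix w assume w: "w \<in> V"
    then obtain e where e: "e > 0" "ball w e \<subseteq> V" using assms(1) openE by blast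
    define B where "B v s = Blinfun (DF s v)" for v s
    have B: "blinfun_apply (B v s) = DF s v" if "v \<in> ball w e" for v s
      using bl[of v s] that e by (auto simp: B_def bounded_linear_Blinfun_apply)
    have "((\<lambda>w. integral (cbox 0 1) (\<lambda>s. F (s, w))) has_derivative integral (cbox 0 1) (B w))
        (at w within ball w e)"
    proof (rule leibniz_rule)
      show "((\<lambda>x. F (t, x)) has_derivative blinfun_apply (B x t)) (at x within ball w e)"
        if "x \<in> ball w e" for x t
        unfolding B[OF that] by (rule has_derivative_at_withinI[OF dF]) (use that e in blast)
      show "(\<lambda>s. F (s, x)) integrable_on cbox 0 1" if "x \<in> ball w e" for x
        by (rule integrable_continuous, rule continuous_on_compose2[OF cF])
          (use that e in \<open>auto intro!: continuous_intros\<close>)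
      show "continuous_on (ball w e \<times> cbox 0 1) (\<lambda>(x, y). B x y)"
      proof (rule continuous_on_blinfun_componentwise)
        fix i :: 'w
        have "continuous_on (ball w e \<times> cbox 0 1) (\<lambda>x. DF (snd x) (fst x) i)"
          by (rule continuous_on_compose2[OF cDF[of i, unfolded split_beta],
                where f="\<lambda>x. (snd x, fst x)", simplified])
            (use e in \<open>auto intro!: continuous_intros\<close>)
        then show "continuous_on (ball w e \<times> cbox 0 1) (\<lambda>x. blinfun_apply (case x of (x, y) \<Rightarrow> B x y) i)"
          by (rule continuous_on_eq) (auto simp: B split_beta)
      qed
    qed (use e in auto)
    moreover have "B w integrable_on {0..1}"
    proof (rule integrable_continuous_real, rule continuous_on_blinfun_componentwise)
      fix i :: 'w
      have "continuous_on {0..1} (\<lambda>x. DF x w i)"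
        by (rule continuous_on_compose2[OF cDF[of i, unfolded split_beta], where f="\<lambda>x. (x, w)", simplified])
          (use w in \<open>auto intro!: continuous_intros\<close>)
      then show "continuous_on {0..1} (\<lambda>x. blinfun_apply (B w x) i)" using e by (simp add: B)
    qed
    then have "blinfun_apply (integral {0..1} (B w)) h = integral {0..1} (\<lambda>s. DF s w h)" for h
      using e by (simp add: blinfun_apply_integral B)
    ultimately show "((\<lambda>w. integral {0..1} (\<lambda>s. F (s, w))) has_derivative
        (\<lambda>h. integral {0..1} (\<lambda>s. DF s w h))) (at w)"
      using e by (auto simp: at_within_open[of w "ball w e"] elim!: has_derivative_eq_rhs)
  next
    show "differentiable_upto n V (\<lambda>w. integral {0..1} (\<lambda>s. DF s w h))" for h
      unfolding DF_def by (rule Suc.IH[OF F(2)])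
  qed
qed

lemma differentiable_upto_minus:
  "open U \<Longrightarrow> differentiable_upto n U f \<Longrightarrow> differentiable_upto n U (\<lambda>x. - f x)"
  by (rule differentiable_upto_linear_compose[where L=uminus]) (auto intro: bounded_linear_minus bounded_linear_ident)

lemma differentiable_upto_diff:
  "open U \<Longrightarrow> differentiable_upto n U f \<Longrightarrow> differentiable_upto n U g \<Longrightarrow> differentiable_upto n U (\<lambda>x. f x - g x)"
  using differentiable_upto_add[of U n f "\<lambda>x. - g x"] differentiable_upto_minus[of U n g] by simp

lemma differentiable_upto_divide:
  fixes f g :: "'a::real_normed_vector \<Rightarrow> real"
  shows "open U \<Longrightarrow> differentiable_upto n U f \<Longrightarrow> differentiable_upto n U g \<Longrightarrow> (\<And>x. x \<in> U \<Longrightarrow> g x \<noteq> 0) \<Longrightarrow>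
    differentiable_upto n U (\<lambda>x. f x / g x)"
  unfolding divide_inverse by (intro differentiable_upto_mult differentiable_upto_inverse)

lemma differentiable_upto_power2:
  fixes f :: "'a::real_normed_vector \<Rightarrow> real"
  shows "open U \<Longrightarrow> differentiable_upto n U f \<Longrightarrow> differentiable_upto n U (\<lambda>x. (f x)\<^sup>2)"
  unfolding power2_eq_square by (intro differentiable_upto_mult)

lemmas differentiable_upto_sin = differentiable_upto_sin_cos[THEN conjunct1]
lemmas differentiable_upto_cos = differentiable_upto_sin_cos[THEN conjunct2]

lemmas differentiable_upto_intros = differentiable_upto_const differentiable_upto_minus differentiable_upto_add
  differentiable_upto_diff differentiable_upto_mult differentiable_upto_power2 differentiable_upto_sin
  differentiable_upto_cos

lemma vec_eq_sum_axis: "x = (\<Sum>i\<in>UNIV. (x $ i) *\<^sub>R axis i (1::real))" for x :: "real^'n"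
  by (simp add: vec_eq_iff axis_def if_distrib[of "\<lambda>c. _ * c"] cong: if_cong)

lemma differentiable_upto_vec:
  fixes f :: "'a::real_normed_vector \<Rightarrow> real^'n"
  assumes "open U" "\<And>i. differentiable_upto n U (\<lambda>x. f x $ i)"
  shows "differentiable_upto n U f"
  by (subst vec_eq_sum_axis[of "f _", abs_def])
    (intro differentiable_upto_sum differentiable_upto_scaleR differentiable_upto_const assms)

lemma differentiable_upto_vec_nth: "open S \<Longrightarrow> differentiable_upto n S (\<lambda>z::real^'n. z $ i)"
  by (intro differentiable_upto_bounded_linear bounded_linear_vec_nth)

lemma has_vector_derivative_vec:
  fixes f :: "real \<Rightarrow> real^'n"
  assumes "\<And>i. ((\<lambda>t. f t $ i) has_real_derivative f' $ i) (at t within S)"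
  shows "(f has_vector_derivative f') (at t within S)"
proof -
  have "((\<lambda>t. \<Sum>i\<in>UNIV. (f t $ i) *\<^sub>R axis i (1::real)) has_vector_derivative
      (\<Sum>i\<in>UNIV. (f t $ i) *\<^sub>R 0 + (f' $ i) *\<^sub>R axis i 1)) (at t within S)"
    by (intro has_vector_derivative_sum has_vector_derivative_scaleR assms has_vector_derivative_const)
  then show ?thesis by (simp add: vec_eq_sum_axis[symmetric])
qed

text \<open>A function that is defined by a choice can be smooth because it agrees near each point with a
  smooth expression; the expression may change from point to point.\<close>

lemma differentiable_upto_local:
  assumes "\<And>x. x \<in> U \<Longrightarrow> \<exists>O'. open O' \<and> x \<in> O' \<and> differentiable_upto n (U \<inter> O') f" and "open U"
  shows "differentiable_upto n U f"
  using assms(1)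
proof (induction n arbitrary: f)
  case 0
  have "isCont f x" if x: "x \<in> U" for x
  proof -
    obtain O' where "open O'" "x \<in> O'" "continuous_on (U \<inter> O') f" using 0[OF x] by auto
    then show ?thesis using x assms(2) by (auto simp: continuous_on_eq_continuous_at open_Int)
  qed
  then show ?case by (simp add: continuous_at_imp_continuous_on)
next
  case (Suc n)
  have "f differentiable (at x)" if x: "x \<in> U" for x using Suc.prems[OF x] x by auto
  moreover have "differentiable_upto n U (\<lambda>x. frechet_derivative f (at x) h)" for h
    by (rule Suc.IH) (use Suc.prems in fastforce)
  ultimately show ?case by simp
qed

section \<open>Ordinary differential equations with a Lipschitz right-hand side\<close>

text \<open>The integral of \<open>g\<close> from \<open>0\<close> to \<open>t\<close>, rescaled to a fixed interval. This form covers negative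
  \<open>t\<close>, and as a function of \<open>t\<close> and of parameters it is an integral over a compact set.\<close>

definition primitive :: "(real \<Rightarrow> 'a::banach) \<Rightarrow> real \<Rightarrow> 'a" where
  "primitive g t = t *\<^sub>R integral {0..1} (\<lambda>s. g (s * t))"

lemma integrable_rescaled:
  fixes g :: "real \<Rightarrow> 'a::banach"
  assumes "continuous_on UNIV g"
  shows "(\<lambda>s. g (s * t)) integrable_on {0..1}"
  by (rule integrable_continuous_real, rule continuous_on_compose2[OF assms])
    (auto intro!: continuous_intros)

lemma primitive_0: "primitive g 0 = 0"
  by (simp add: primitive_def)

lemma primitive_has_vector_derivative:
  fixes g :: "real \<Rightarrow> 'a::banach"
  assumes "continuous_on UNIV g"
  shows "(primitive g has_vector_derivative g t) (at t)"
proof -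
  define a where "a = \<bar>t\<bar> + 1"
  obtain H where H: "\<And>x. x \<in> {-a..a} \<Longrightarrow> (H has_vector_derivative g x) (at x within {-a..a})"
    using antiderivative_continuous[OF continuous_on_subset[OF assms subset_UNIV]] by metis
  have eq: "H s - H 0 = primitive g s" if s: "s \<in> {-a<..<a}" for s
  proof -
    have "((\<lambda>\<sigma>. s *\<^sub>R g (\<sigma> * s)) has_integral (H (1 * s) - H (0 * s))) {0..1}"
    proof (rule fundamental_theorem_of_calculus)
      fix \<sigma> :: real assume \<sigma>: "\<sigma> \<in> {0..1}"
      have b: "\<sigma> * s \<in> {-a..a}" if "\<sigma> \<in> {0..1}" for \<sigma> :: real
      proof -
        have "\<bar>\<sigma> * s\<bar> \<le> 1 * a" unfolding abs_mult using that s by (intro mult_mono) auto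
        then show ?thesis by auto
      qed
      have 1: "((\<lambda>\<sigma>. \<sigma> * s) has_vector_derivative s) (at \<sigma> within {0..1})"
        by (auto intro!: derivative_eq_intros simp: has_vector_derivative_def)
      have 2: "(H has_vector_derivative g (\<sigma> * s)) (at (\<sigma> * s) within (\<lambda>\<sigma>. \<sigma> * s) ` {0..1})"
        by (rule has_vector_derivative_within_subset[OF H[OF b[OF \<sigma>]]]) (use b in blast)
      show "((\<lambda>\<sigma>. H (\<sigma> * s)) has_vector_derivative s *\<^sub>R g (\<sigma> * s)) (at \<sigma> within {0..1})"
        using vector_diff_chain_within[OF 1 2] by (simp add: o_def)
    qed simp
    from integral_unique[OF this] show ?thesis by (simp add: primitive_def)
  qed
  have "((\<lambda>s. H s - H 0) has_vector_derivative g t - 0) (at t within {-a<..<a})"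
    by (intro has_vector_derivative_diff has_vector_derivative_const
        has_vector_derivative_within_subset[OF H]) (auto simp: a_def)
  then have "((\<lambda>s. H s - H 0) has_vector_derivative g t) (at t)"
    by (subst (asm) at_within_open) (auto simp: a_def)
  then show ?thesis
    by (rule has_vector_derivative_transform_within_open[where S="{-a<..<a}"])
      (use eq in \<open>auto simp: a_def\<close>)
qed

lemma primitive_diff:
  fixes g h :: "real \<Rightarrow> 'a::banach"
  assumes "continuous_on UNIV g" "continuous_on UNIV h"
  shows "primitive g t - primitive h t = primitive (\<lambda>s. g s - h s) t"
  unfolding primitive_def
  by (subst integral_diff[OF integrable_rescaled[OF assms(1)] integrable_rescaled[OF assms(2)]])
    (simp add: scaleR_diff_right)

lemma norm_primitive_le:
  fixes g :: "real \<Rightarrow> 'a::banach"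
  assumes "continuous_on UNIV g" "\<And>s. \<bar>s\<bar> \<le> \<bar>t\<bar> \<Longrightarrow> norm (g s) \<le> C * \<bar>s\<bar> ^ n"
  shows "norm (primitive g t) \<le> C * \<bar>t\<bar> ^ Suc n / Suc n"
proof -
  have i: "((\<lambda>s::real. C * \<bar>t\<bar> ^ n * s ^ n) has_integral C * \<bar>t\<bar> ^ n * (1 / Suc n)) {0..1}"
  proof (rule has_integral_mult_right)
    have "((\<lambda>s::real. s ^ n) has_integral (1 ^ Suc n / Suc n - 0 ^ Suc n / Suc n)) {0..1}"
      by (rule fundamental_theorem_of_calculus)
        (auto intro!: derivative_eq_intros simp: has_real_derivative_iff_has_vector_derivative[symmetric]
          simp del: power_Suc)
    then show "((\<lambda>s::real. s ^ n) has_integral (1 / Suc n)) {0..1}" by simp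
  qed
  have "norm (integral {0..1} (\<lambda>s. g (s * t))) \<le> integral {0..1} (\<lambda>s. C * \<bar>t\<bar> ^ n * s ^ n)"
  proof (rule integral_norm_bound_integral[OF integrable_rescaled[OF assms(1)]])
    show "(\<lambda>s. C * \<bar>t\<bar> ^ n * s ^ n) integrable_on {0..1}" using i by blast
    fix s :: real assume s: "s \<in> {0..1}"
    have "\<bar>s * t\<bar> \<le> 1 * \<bar>t\<bar>" unfolding abs_mult using s by (intro mult_right_mono) auto
    then have "norm (g (s * t)) \<le> C * \<bar>s * t\<bar> ^ n" using assms(2) by simp
    also have "\<dots> = C * \<bar>t\<bar> ^ n * s ^ n" using s by (simp add: abs_mult power_mult_distrib)
    finally show "norm (g (s * t)) \<le> C * \<bar>t\<bar> ^ n * s ^ n" .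
  qed
  also have "\<dots> = C * \<bar>t\<bar> ^ n * (1 / Suc n)" using i by (rule integral_unique)
  finally have "norm (primitive g t) \<le> \<bar>t\<bar> * (C * \<bar>t\<bar> ^ n * (1 / Suc n))"
    unfolding primitive_def norm_scaleR real_norm_def by (intro mult_left_mono) auto
  then show ?thesis by (simp add: algebra_simps)
qed

lemma continuous_on_slice:
  assumes "continuous_on (UNIV \<times> S) (\<lambda>(t, x). g t x)" "x \<in> S"
  shows "continuous_on UNIV (\<lambda>t. g t x)"
  by (rule continuous_on_compose2[OF assms(1)[unfolded split_beta], where f="\<lambda>t. (t, x)", simplified])
    (use assms(2) in \<open>auto intro!: continuous_intros\<close>)

lemma continuous_on_primitive:
  fixes g :: "real \<Rightarrow> 'x::topological_space \<Rightarrow> 'a::banach"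
  assumes "continuous_on (UNIV \<times> S) (\<lambda>(t, x). g t x)"
  shows "continuous_on (UNIV \<times> S) (\<lambda>(t, x). primitive (\<lambda>s. g s x) t)"
proof -
  have "continuous_on ((UNIV \<times> S) \<times> cbox (0::real) 1) (\<lambda>(z, s). g (s * fst z) (snd z))"
    unfolding split_beta
    by (rule continuous_on_compose2[OF assms[unfolded split_beta],
          where f="\<lambda>z. (snd z * fst (fst z), snd (fst z))", simplified])
      (auto intro!: continuous_intros)
  from integral_continuous_on_param[OF this]
  have "continuous_on (UNIV \<times> S) (\<lambda>z. integral (cbox 0 1) (\<lambda>s. g (s * fst z) (snd z)))" .
  then show ?thesis unfolding primitive_def split_beta by (auto intro!: continuous_intros)
qed

text \<open>Picard iteration, with a parameter on which the solution depends continuously: the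
  increments of the iterates are dominated by the terms of an exponential series, locally
  uniformly in time and uniformly in the parameter.\<close>

theorem Picard_with_parameter:
  fixes N :: "real \<Rightarrow> 'x::t2_space \<Rightarrow> 'a::banach \<Rightarrow> 'a"
  assumes cN: "continuous_on (UNIV \<times> S \<times> UNIV) (\<lambda>(s, x, u). N s x u)"
    and lip: "\<And>s x u v. x \<in> S \<Longrightarrow> norm (N s x u - N s x v) \<le> L * norm (u - v)"
    and bnd: "\<And>s x. x \<in> S \<Longrightarrow> norm (N s x (u0 x)) \<le> C"
    and cu0: "continuous_on S u0" and L: "L \<ge> 0"
  obtains u where "continuous_on (UNIV \<times> S) (\<lambda>(t, x). u t x)"
    "\<And>x. x \<in> S \<Longrightarrow> u 0 x = u0 x"
    "\<And>x t. x \<in> S \<Longrightarrow> ((\<lambda>t. u t x) has_vector_derivative N t x (u t x)) (at t)"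
proof -
  define U where "U = rec_nat (\<lambda>(t::real) x. u0 x)
    (\<lambda>_ V t x. u0 x + primitive (\<lambda>s. N s x (V s x)) t)"
  have U0: "U 0 t x = u0 x" for t x by (simp add: U_def)
  have US: "U (Suc n) t x = u0 x + primitive (\<lambda>s. N s x (U n s x)) t" for n t x by (simp add: U_def)
  have cNV: "continuous_on (UNIV \<times> S) (\<lambda>(s, x). N s x (V s x))"
    if "continuous_on (UNIV \<times> S) (\<lambda>(s, x). V s x)" for V
    unfolding split_beta
    by (rule continuous_on_compose2[OF cN[unfolded split_beta],
          where f="\<lambda>z. (fst z, snd z, V (fst z) (snd z))", simplified])
      (use that in \<open>auto intro!: continuous_intros simp: split_beta\<close>)
  have cu0': "continuous_on (UNIV \<times> S) (\<lambda>z. u0 (snd z))"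
    by (rule continuous_on_compose2[OF cu0]) (auto intro!: continuous_intros)
  have cU: "continuous_on (UNIV \<times> S) (\<lambda>(t, x). U n t x)" for n
  proof (induction n)
    case 0
    then show ?case using cu0' by (simp add: U0 split_beta)
  next
    case (Suc n)
    then show ?case
      unfolding US split_beta
      by (intro continuous_on_add cu0' continuous_on_primitive[OF cNV[OF Suc], unfolded split_beta])
  qed
  note cNU = continuous_on_slice[OF cNV[OF cU]]
  have inc: "norm (U (Suc n) t x - U n t x) \<le> C * L ^ n / fact (Suc n) * \<bar>t\<bar> ^ Suc n"
    if x: "x \<in> S" for n t x
  proof (induction n arbitrary: t)
    case 0
    have "norm (primitive (\<lambda>s. N s x (U 0 s x)) t) \<le> C * \<bar>t\<bar> ^ Suc 0 / Suc 0"
      by (rule norm_primitive_le[OF cNU[OF x]]) (use bnd[OF x] in \<open>simp add: U0\<close>)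
    then show ?case by (simp add: US[of 0, unfolded U0] U0)
  next
    case (Suc n)
    have "U (Suc (Suc n)) t x - U (Suc n) t x
        = primitive (\<lambda>s. N s x (U (Suc n) s x) - N s x (U n s x)) t"
      unfolding primitive_diff[OF cNU[OF x] cNU[OF x], symmetric] US[of "Suc n" t] US[of n t] by simp
    moreover have "norm (primitive (\<lambda>s. N s x (U (Suc n) s x) - N s x (U n s x)) t)
        \<le> (L * (C * L ^ n / fact (Suc n))) * \<bar>t\<bar> ^ Suc (Suc n) / Suc (Suc n)"
    proof (rule norm_primitive_le)
      show "continuous_on UNIV (\<lambda>s. N s x (U (Suc n) s x) - N s x (U n s x))"
        by (intro continuous_on_diff cNU x)
      show "norm (N s x (U (Suc n) s x) - N s x (U n s x)) \<le> L * (C * L ^ n / fact (Suc n)) * \<bar>s\<bar> ^ Suc n" for s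
        using order_trans[OF lip[OF x] mult_left_mono[OF Suc.IH L]] by (simp add: mult.assoc)
    qed
    ultimately show ?case
      by (simp add: field_simps)
  qed
  define u where "u t x = u0 x + (\<Sum>i. U (Suc i) t x - U i t x)" for t x
  have tel: "U n t x = u0 x + (\<Sum>i<n. U (Suc i) t x - U i t x)" for n t x
    using sum_lessThan_telescope[of "\<lambda>i. U i t x" n] by (simp add: U0)
  have unif: "uniform_limit ({-T..T} \<times> S) (\<lambda>n (t, x). U n t x) (\<lambda>(t, x). u t x) sequentially"
    if T: "T \<ge> 0" for T
  proof -
    have "uniform_limit ({-T..T} \<times> S) (\<lambda>n z. \<Sum>i<n. (\<lambda>(t, x). U (Suc i) t x - U i t x) z)
        (\<lambda>z. \<Sum>i. (\<lambda>(t, x). U (Suc i) t x - U i t x) z) sequentially"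
    proof (rule Weierstrass_m_test)
      have "summable (\<lambda>n. \<bar>C\<bar> * T * ((L * T) ^ n /\<^sub>R fact n))"
        by (intro summable_mult summable_exp_generic)
      then show "summable (\<lambda>n. \<bar>C\<bar> * L ^ n / fact (Suc n) * T ^ Suc n)"
      proof (rule summable_comparison_test'[where N=0])
        fix n :: nat
        have "\<bar>C\<bar> * L ^ n * T ^ Suc n / fact (Suc n) \<le> \<bar>C\<bar> * L ^ n * T ^ Suc n / fact n"
          using L T by (intro divide_left_mono mult_nonneg_nonneg fact_mono) auto
        then show "norm (\<bar>C\<bar> * L ^ n / fact (Suc n) * T ^ Suc n) \<le> \<bar>C\<bar> * T * ((L * T) ^ n /\<^sub>R fact n)"
          using L T by (simp add: abs_mult power_mult_distrib field_simps)
      qed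
      fix n z assume z: "z \<in> {-T..T} \<times> S"
      obtain t x where zz: "z = (t, x)" "\<bar>t\<bar> \<le> T" "x \<in> S" using z by (cases z) auto
      have "C * L ^ n / fact (Suc n) * \<bar>t\<bar> ^ Suc n \<le> \<bar>C\<bar> * L ^ n / fact (Suc n) * T ^ Suc n"
        using L T zz by (intro mult_mono divide_right_mono power_mono) auto
      then show "norm ((\<lambda>(t, x). U (Suc n) t x - U n t x) z) \<le> \<bar>C\<bar> * L ^ n / fact (Suc n) * T ^ Suc n"
        using inc[OF zz(3)] zz(1) by (auto intro: order_trans)
    qed
    then have "uniform_limit ({-T..T} \<times> S) (\<lambda>n z. u0 (snd z) + (\<Sum>i<n. (\<lambda>(t, x). U (Suc i) t x - U i t x) z))
        (\<lambda>z. u0 (snd z) + (\<Sum>i. (\<lambda>(t, x). U (Suc i) t x - U i t x) z)) sequentially"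
      by (intro uniform_limit_add uniform_limit_const)
    moreover have "(\<lambda>n z. u0 (snd z) + (\<Sum>i<n. (\<lambda>(t, x). U (Suc i) t x - U i t x) z)) = (\<lambda>n (t, x). U n t x)"
      by (simp add: fun_eq_iff split_beta tel[symmetric])
    moreover have "(\<lambda>z. u0 (snd z) + (\<Sum>i. (\<lambda>(t, x). U (Suc i) t x - U i t x) z)) = (\<lambda>(t, x). u t x)"
      by (auto simp: fun_eq_iff u_def)
    ultimately show ?thesis by simp
  qed
  have cu: "continuous_on (UNIV \<times> S) (\<lambda>(t, x). u t x)"
  proof -
    have c: "continuous_on ({-T..T} \<times> S) (\<lambda>(t, x). u t x)" if "T \<ge> 0" for T
      by (rule uniform_limit_theorem[OF _ unif[OF that]])
        (auto intro!: continuous_on_subset[OF cU] always_eventually)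
    show ?thesis unfolding continuous_on_eq_continuous_within
    proof
      fix z :: "real \<times> 'x" assume z: "z \<in> UNIV \<times> S"
      define T where "T = \<bar>fst z\<bar> + 1"
      have "continuous (at z within {-T..T} \<times> S) (\<lambda>(t, x). u t x)"
      proof (rule c[of T, unfolded continuous_on_eq_continuous_within, rule_format])
        have "- \<bar>fst z\<bar> - 1 \<le> fst z" "fst z \<le> \<bar>fst z\<bar> + 1" by linarith+
        then have "fst z \<in> {-T..T}" by (simp add: T_def)
        then show "z \<in> {-T..T} \<times> S" using z by (simp add: mem_Times_iff)
      qed (simp add: T_def)
      moreover have "at z within {-T..T} \<times> S = at z within UNIV \<times> S"
        by (rule at_within_nhd[where S="{-T<..<T} \<times> UNIV"])
          (use z in \<open>auto simp: T_def mem_Times_iff intro!: open_Times\<close>)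
      ultimately show "continuous (at z within UNIV \<times> S) (\<lambda>(t, x). u t x)" by simp
    qed
  qed
  have fixp: "u t x = u0 x + primitive (\<lambda>s. N s x (u s x)) t" if x: "x \<in> S" for t x
  proof -
    have lim: "(\<lambda>n. U n t x) \<longlonglongrightarrow> u t x"
    proof -
      have "- \<bar>t\<bar> \<le> t" "t \<le> \<bar>t\<bar>" by linarith+
      then show ?thesis using tendsto_uniform_limitI[OF unif[of "\<bar>t\<bar>"], of "(t, x)"] x by simp
    qed
    have "(\<lambda>n. primitive (\<lambda>s. N s x (U n s x)) t) \<longlonglongrightarrow> primitive (\<lambda>s. N s x (u s x)) t"
    proof (rule tendstoI)
      fix e :: real assume e: "e > 0"
      define d where "d = e / (L * \<bar>t\<bar> + 1)"
      have d: "d > 0" using e L by (auto simp: d_def intro!: divide_pos_pos add_nonneg_pos)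
      have "L * \<bar>t\<bar> * d < e"
      proof -
        have "0 < L * \<bar>t\<bar> + 1" using L by (intro add_nonneg_pos) auto
        then show ?thesis using e by (simp add: d_def field_simps)
      qed
      have "\<forall>\<^sub>F n in sequentially. \<forall>z\<in>{-\<bar>t\<bar>..\<bar>t\<bar>} \<times> S.
          dist ((\<lambda>(t, x). U n t x) z) ((\<lambda>(t, x). u t x) z) < d"
        using unif[of "\<bar>t\<bar>"] d unfolding uniform_limit_iff by auto
      then show "\<forall>\<^sub>F n in sequentially.
          dist (primitive (\<lambda>s. N s x (U n s x)) t) (primitive (\<lambda>s. N s x (u s x)) t) < e"
      proof eventually_elim
        case (elim n)
        have cu': "continuous_on UNIV (\<lambda>s. N s x (u s x))" by (rule continuous_on_slice[OF cNV[OF cu] x])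
        have "norm (primitive (\<lambda>s. N s x (U n s x) - N s x (u s x)) t) \<le> L * d * \<bar>t\<bar> ^ Suc 0 / Suc 0"
        proof (rule norm_primitive_le)
          show "continuous_on UNIV (\<lambda>s. N s x (U n s x) - N s x (u s x))"
            by (intro continuous_on_diff cNU x cu')
          fix s assume s: "\<bar>s\<bar> \<le> \<bar>t\<bar>"
          have "- \<bar>t\<bar> \<le> s \<and> s \<le> \<bar>t\<bar>" using s by linarith
          then have "norm (U n s x - u s x) \<le> d" using elim[rule_format, of "(s, x)"] x by (simp add: dist_norm)
          then have "norm (N s x (U n s x) - N s x (u s x)) \<le> L * d"
            using order_trans[OF lip[OF x] mult_left_mono[OF _ L]] by blast
          then show "norm (N s x (U n s x) - N s x (u s x)) \<le> L * d * \<bar>s\<bar> ^ 0" by simp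
        qed
        then have "norm (primitive (\<lambda>s. N s x (U n s x) - N s x (u s x)) t) < e"
          using \<open>L * \<bar>t\<bar> * d < e\<close> by (simp add: mult_ac)
        then show ?case by (simp add: dist_norm primitive_diff[OF cNU[OF x] cu'])
      qed
    qed
    then have "(\<lambda>n. U (Suc n) t x) \<longlonglongrightarrow> u0 x + primitive (\<lambda>s. N s x (u s x)) t"
      unfolding US by (intro tendsto_add tendsto_const)
    then show ?thesis using LIMSEQ_unique[OF LIMSEQ_Suc[OF lim]] by simp
  qed
  show thesis
  proof (rule that[OF cu])
    show "u 0 x = u0 x" if "x \<in> S" for x using fixp[OF that, of 0] by (simp add: primitive_0)
    fix x t assume x: "x \<in> S"
    have "((\<lambda>t. u0 x + primitive (\<lambda>s. N s x (u s x)) t) has_vector_derivative 0 + N t x (u t x)) (at t)"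
      by (intro has_vector_derivative_add has_vector_derivative_const primitive_has_vector_derivative
          continuous_on_slice[OF cNV[OF cu] x])
    then show "((\<lambda>t. u t x) has_vector_derivative N t x (u t x)) (at t)" by (simp add: fixp[OF x, symmetric])
  qed
qed

text \<open>Gronwall's inequality in differential form, for norms that come from an inner product: the
  function \<open>|e|\<^sup>2 exp (-2 L t)\<close> is nonincreasing.\<close>

lemma Gronwall_forward:
  fixes e :: "real \<Rightarrow> 'a::real_inner"
  assumes "a \<le> b"
    and d: "\<And>t. t \<in> {a..b} \<Longrightarrow> (e has_vector_derivative e' t) (at t within {a..b})"
    and le: "\<And>t. t \<in> {a..b} \<Longrightarrow> norm (e' t) \<le> L * norm (e t)"
  shows "norm (e b) \<le> norm (e a) * exp (L * (b - a))"
proof -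
  define f where "f t = (e t \<bullet> e t) * exp (- (2 * L * t))" for t
  have "f b \<le> f a"
  proof (rule DERIV_nonpos_imp_decreasing_open[OF assms(1)])
    fix t assume t: "a < t" "t < b"
    then have "(e has_vector_derivative e' t) (at t)"
      using d[of t] at_within_Icc_at[of a t b] by simp
    then have "(e has_derivative (\<lambda>h. h *\<^sub>R e' t)) (at t)" by (simp add: has_vector_derivative_def)
    from has_derivative_inner[OF this this]
    have 1: "((\<lambda>t. e t \<bullet> e t) has_real_derivative 2 * (e t \<bullet> e' t)) (at t)"
      by (simp add: has_field_derivative_def inner_commute algebra_simps mult_commute_abs)
    have "(f has_real_derivative 2 * (e t \<bullet> e' t) * exp (- (2 * L * t))
        + (exp (- (2 * L * t)) * (- (2 * L))) * (e t \<bullet> e t)) (at t)"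
      unfolding f_def by (rule DERIV_mult[OF 1]) (auto intro!: derivative_eq_intros)
    moreover have "e t \<bullet> e' t \<le> L * (e t \<bullet> e t)"
    proof -
      have "e t \<bullet> e' t \<le> norm (e t) * norm (e' t)" by (rule norm_cauchy_schwarz)
      also have "\<dots> \<le> norm (e t) * (L * norm (e t))" using le[of t] t by (intro mult_left_mono) auto
      finally show ?thesis by (simp add: dot_square_norm power2_eq_square mult.left_commute)
    qed
    then have "2 * (e t \<bullet> e' t) * exp (- (2 * L * t))
        + (exp (- (2 * L * t)) * (- (2 * L))) * (e t \<bullet> e t) \<le> 0"
      using mult_right_mono[of "e t \<bullet> e' t" "L * (e t \<bullet> e t)" "2 * exp (- (2 * L * t))"]
      by (simp add: algebra_simps)
    ultimately show "\<exists>y. (f has_real_derivative y) (at t) \<and> y \<le> 0" by blast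
  next
    have "continuous_on {a..b} e"
      unfolding continuous_on_eq_continuous_within
      by (intro ballI has_vector_derivative_continuous[OF d])
    then show "continuous_on {a..b} f" unfolding f_def by (auto intro!: continuous_intros)
  qed
  then have "(norm (e b))\<^sup>2 * exp (- (2 * L * b)) \<le> (norm (e a))\<^sup>2 * exp (- (2 * L * a))"
    by (simp add: f_def dot_square_norm)
  then have "(norm (e b))\<^sup>2 * exp (- (2 * L * b)) * exp (2 * L * b)
      \<le> (norm (e a))\<^sup>2 * exp (- (2 * L * a)) * exp (2 * L * b)"
    by (rule mult_right_mono) simp
  then have "(norm (e b))\<^sup>2 \<le> (norm (e a))\<^sup>2 * exp (2 * (L * (b - a)))"
    by (simp add: mult.assoc exp_add[symmetric] algebra_simps)
  also have "\<dots> = (norm (e a) * exp (L * (b - a)))\<^sup>2"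
    by (simp add: power_mult_distrib exp_double)
  finally show ?thesis by (rule power2_le_imp_le) simp
qed

lemma Gronwall:
  fixes e :: "real \<Rightarrow> 'a::real_inner"
  assumes d: "\<And>t. t \<in> closed_segment a b \<Longrightarrow> (e has_vector_derivative e' t) (at t within closed_segment a b)"
    and le: "\<And>t. t \<in> closed_segment a b \<Longrightarrow> norm (e' t) \<le> L * norm (e t)"
  shows "norm (e b) \<le> norm (e a) * exp (L * \<bar>b - a\<bar>)"
proof (cases "a \<le> b")
  case True
  then show ?thesis using Gronwall_forward[of a b e e' L] d le by (simp add: closed_segment_eq_real_ivl)
next
  case False
  then have ba: "b \<le> a" and s: "closed_segment a b = {b..a}" by (auto simp: closed_segment_eq_real_ivl)

  have "norm ((e \<circ> uminus) (- b)) \<le> norm ((e \<circ> uminus) (- a)) * exp (L * (- b - - a))"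
  proof (rule Gronwall_forward[where e'="\<lambda>t. (-1) *\<^sub>R e' (- t)"])
    fix t assume t: "t \<in> {- a..- b}"
    have 1: "(uminus has_vector_derivative (-1)) (at t within {- a..- b})"
      by (auto intro!: derivative_eq_intros simp: has_vector_derivative_def)
    have "(e has_vector_derivative e' (- t)) (at (- t) within uminus ` {- a..- b})"
      using d[of "- t"] t s by auto
    from vector_diff_chain_within[OF 1 this]
    show "((e \<circ> uminus) has_vector_derivative (-1) *\<^sub>R e' (- t)) (at t within {- a..- b})" .
    show "norm ((-1) *\<^sub>R e' (- t)) \<le> L * norm ((e \<circ> uminus) t)" using le[of "- t"] t s by auto
  qed (use ba in simp)
  then show ?thesis using ba by (simp add: abs_if)
qed

lemma ODE_dependence_on_initial_value:
  fixes u v :: "real \<Rightarrow> 'a::real_inner"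
  assumes "\<And>t. t \<in> closed_segment a b \<Longrightarrow> (u has_vector_derivative N t (u t)) (at t within closed_segment a b)"
    and "\<And>t. t \<in> closed_segment a b \<Longrightarrow> (v has_vector_derivative N t (v t)) (at t within closed_segment a b)"
    and "\<And>t. t \<in> closed_segment a b \<Longrightarrow> norm (N t (u t) - N t (v t)) \<le> L * norm (u t - v t)"
  shows "norm (u b - v b) \<le> norm (u a - v a) * exp (L * \<bar>b - a\<bar>)"
  by (rule Gronwall[where e="\<lambda>t. u t - v t" and e'="\<lambda>t. N t (u t) - N t (v t)"])
    (use assms in \<open>auto intro: has_vector_derivative_diff\<close>)

lemma ODE_unique:
  fixes u v :: "real \<Rightarrow> 'a::real_inner"
  assumes "\<And>t. (u has_vector_derivative N t (u t)) (at t)" "\<And>t. (v has_vector_derivative N t (v t)) (at t)"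
    and "\<And>t. norm (N t (u t) - N t (v t)) \<le> L * norm (u t - v t)" "u a = v a"
  shows "u t = v t"
  using ODE_dependence_on_initial_value[of a t u N v L] assms
  by (auto intro: has_vector_derivative_at_within)

text \<open>Motion on the circle with a positive periodic speed: time is a strictly increasing function
  of the angle, and the angle is the inverse function.\<close>

lemma clock:
  fixes \<Omega> :: "real \<Rightarrow> real"
  assumes c: "continuous_on UNIV \<Omega>" and pos: "\<And>\<theta>. \<Omega> \<theta> > 0" and per: "\<And>\<theta>. \<Omega> (\<theta> + 2 * pi) = \<Omega> \<theta>"
  obtains \<theta> T where "\<theta> 0 = \<theta>0" "\<And>t. (\<theta> has_real_derivative \<Omega> (\<theta> t)) (at t)" "T > 0"
    "\<And>t. \<theta> (t + T) = \<theta> t + 2 * pi"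
proof -
  define \<tau> where "\<tau> = primitive (\<lambda>s. inverse (\<Omega> (\<theta>0 + s)))"
  have c1: "continuous_on UNIV (\<lambda>s. inverse (\<Omega> (\<theta>0 + s)))"
    using pos by (intro continuous_on_inverse continuous_on_compose2[OF c])
      (auto intro!: continuous_intros simp: less_imp_neq[THEN not_sym])
  have d: "(\<tau> has_real_derivative inverse (\<Omega> (\<theta>0 + s))) (at s)" for s
    unfolding \<tau>_def has_real_derivative_iff_has_vector_derivative by (rule primitive_has_vector_derivative[OF c1])
  have mono: "\<tau> s < \<tau> s'" if "s < s'" for s s'
    by (rule DERIV_pos_imp_increasing[OF that]) (use d pos in force)
  define T where "T = \<tau> (2 * pi)"
  have \<tau>0: "\<tau> 0 = 0" by (simp add: \<tau>_def primitive_0)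
  have T: "T > 0" using mono[of 0 "2 * pi"] by (simp add: T_def \<tau>0)
  have \<tau>_per: "\<tau> (s + 2 * pi) = \<tau> s + T" for s
  proof -
    have "((\<lambda>s. \<tau> (s + 2 * pi) - \<tau> s) has_real_derivative 0) (at s)" for s
    proof -
      have "((\<lambda>s. \<tau> (s + 2 * pi)) has_real_derivative inverse (\<Omega> (\<theta>0 + (s + 2 * pi)))) (at s)"
        using d[of "s + 2 * pi"] by (subst (asm) DERIV_shift)
      from DERIV_diff[OF this d[of s]] show ?thesis using per[of "\<theta>0 + s"] by (simp add: add.assoc)
    qed
    then have "\<tau> (s + 2 * pi) - \<tau> s = \<tau> (0 + 2 * pi) - \<tau> 0"
      by (intro DERIV_isconst_all[of "\<lambda>s. \<tau> (s + 2 * pi) - \<tau> s"] allI)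
    then show ?thesis by (simp add: \<tau>0 T_def)
  qed
  have \<tau>_mult: "\<tau> (2 * pi * real n) = real n * T" "\<tau> (- (2 * pi * real n)) = - (real n * T)" for n
  proof (induction n)
    case (Suc n)
    show "\<tau> (2 * pi * real (Suc n)) = real (Suc n) * T"
      using \<tau>_per[of "2 * pi * real n"] Suc by (simp add: algebra_simps)
    show "\<tau> (- (2 * pi * real (Suc n))) = - (real (Suc n) * T)"
      using \<tau>_per[of "- (2 * pi * real (Suc n))"] Suc by (simp add: algebra_simps)
  qed (simp_all add: \<tau>0)
  have contt: "isCont \<tau> s" for s using d by (rule DERIV_isCont)
  have surj: "\<exists>s. \<tau> s = t" for t
  proof -
    obtain n :: nat where n: "\<bar>t\<bar> / T \<le> real n" using real_arch_simple by blast
    then have "\<bar>t\<bar> \<le> real n * T" using T by (simp add: pos_divide_le_eq)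
    then have "\<tau> (- (2 * pi * real n)) \<le> t" "t \<le> \<tau> (2 * pi * real n)" unfolding \<tau>_mult by linarith+
    then show ?thesis
      using IVT[of \<tau> "- (2 * pi * real n)" t "2 * pi * real n"] contt by (auto simp: )
  qed
  have inj: "s = s'" if "\<tau> s = \<tau> s'" for s s' using mono[of s s'] mono[of s' s] that by (cases s s' rule: linorder_cases) auto
  define \<sigma> where "\<sigma> t = (THE s. \<tau> s = t)" for t
  have \<tau>\<sigma>: "\<tau> (\<sigma> t) = t" for t unfolding \<sigma>_def by (rule theI') (use surj inj in metis)
  have \<sigma>\<tau>: "\<sigma> (\<tau> s) = s" for s using inj \<tau>\<sigma> by blast
  have cont\<sigma>: "isCont \<sigma> t" for t
    using isCont_inverse_function[of 1 "\<sigma> t" \<sigma> \<tau>] contt by (simp add: \<sigma>\<tau> \<tau>\<sigma>)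
  have d\<sigma>: "(\<sigma> has_real_derivative inverse (inverse (\<Omega> (\<theta>0 + \<sigma> t)))) (at t)" for t
    by (rule DERIV_inverse_function[OF d, where x=t and a="t - 1" and b="t + 1"])
      (use pos in \<open>auto simp: \<tau>\<sigma> cont\<sigma> less_imp_neq[THEN not_sym]\<close>)
  show thesis
  proof (rule that[of "\<lambda>t. \<theta>0 + \<sigma> t" T])
    show "\<theta>0 + \<sigma> 0 = \<theta>0" using \<sigma>\<tau>[of 0] by (simp add: \<tau>0)
    show "((\<lambda>t. \<theta>0 + \<sigma> t) has_real_derivative \<Omega> (\<theta>0 + \<sigma> t)) (at t)" for t
      using DERIV_add[OF DERIV_const d\<sigma>[of t], of \<theta>0] by simp
    show "\<theta>0 + \<sigma> (t + T) = \<theta>0 + \<sigma> t + 2 * pi" for t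
      using \<sigma>\<tau>[of "\<sigma> t + 2 * pi"] by (simp add: \<tau>_per \<tau>\<sigma>)
  qed (rule T)
qed

section \<open>Smooth dependence of a flow on time and initial point\<close>

lemma continuous_on_apply:
  fixes A :: "'x::topological_space \<Rightarrow> 'a::euclidean_space \<Rightarrow> 'b::real_normed_vector"
  assumes "\<And>x. x \<in> S \<Longrightarrow> linear (A x)" "\<And>b. b \<in> Basis \<Longrightarrow> continuous_on S (\<lambda>x. A x b)"
    and "continuous_on S k"
  shows "continuous_on S (\<lambda>x. A x (k x))"
proof (rule continuous_on_eq)
  show "continuous_on S (\<lambda>x. \<Sum>b\<in>Basis. (k x \<bullet> b) *\<^sub>R A x b)"
    by (intro continuous_on_sum continuous_on_scaleR continuous_on_inner continuous_on_const assms)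
  show "(\<Sum>b\<in>Basis. (k x \<bullet> b) *\<^sub>R A x b) = A x (k x)" if "x \<in> S" for x
    by (rule linear_eq_sum_Basis[OF assms(1)[OF that], symmetric])
qed

lemma has_vector_derivative_apply:
  fixes A :: "real \<Rightarrow> 'a::euclidean_space \<Rightarrow> 'b::real_normed_vector"
  assumes "\<And>t. linear (A t)" "linear A'" "\<And>b. ((\<lambda>t. A t b) has_vector_derivative A' b) (at t)"
    and "(c has_vector_derivative c') (at t)"
  shows "((\<lambda>t. A t (c t)) has_vector_derivative A t c' + A' (c t)) (at t)"
proof -
  have ci: "((\<lambda>t. c t \<bullet> b) has_real_derivative c' \<bullet> b) (at t)" for b
    using bounded_linear.has_vector_derivative[OF bounded_linear_inner_left assms(4)]
    by (simp add: has_real_derivative_iff_has_vector_derivative)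
  have "((\<lambda>t. \<Sum>b\<in>Basis. (c t \<bullet> b) *\<^sub>R A t b) has_vector_derivative
      (\<Sum>b\<in>Basis. (c t \<bullet> b) *\<^sub>R A' b + (c' \<bullet> b) *\<^sub>R A t b)) (at t)"
    by (intro has_vector_derivative_sum has_vector_derivative_scaleR ci assms(3))
  also have "(\<lambda>t. \<Sum>b\<in>Basis. (c t \<bullet> b) *\<^sub>R A t b) = (\<lambda>t. A t (c t))"
    by (intro ext linear_eq_sum_Basis[OF assms(1), symmetric])
  also have "(\<Sum>b\<in>Basis. (c t \<bullet> b) *\<^sub>R A' b + (c' \<bullet> b) *\<^sub>R A t b) = A t c' + A' (c t)"
    unfolding sum.distrib linear_eq_sum_Basis[OF assms(1), symmetric] linear_eq_sum_Basis[OF assms(2), symmetric]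
    by simp
  finally show ?thesis .
qed

lemma differentiable_upto_primitive:
  fixes g :: "real \<Rightarrow> 'z::euclidean_space \<Rightarrow> 'b::banach"
  assumes "open U" "differentiable_upto n (UNIV \<times> U) (\<lambda>p. g (fst p) (snd p))"
  shows "differentiable_upto n (UNIV \<times> U) (\<lambda>p. primitive (\<lambda>s. g s (snd p)) (fst p))"
proof -
  have o: "open (UNIV \<times> U)" "open (UNIV \<times> UNIV \<times> U)" using assms(1) by (auto intro: open_Times)
  have bl: "bounded_linear (\<lambda>q. snd (snd q))" "bounded_linear (\<lambda>q. fst (snd q))"
    by (intro bounded_linear_compose[OF bounded_linear_snd bounded_linear_snd]
          bounded_linear_compose[OF bounded_linear_fst bounded_linear_snd])+
  have "differentiable_upto n (UNIV \<times> UNIV \<times> U) (\<lambda>q::real \<times> real \<times> 'z. (fst q * fst (snd q), snd (snd q)))"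
    by (intro differentiable_upto_Pair differentiable_upto_mult differentiable_upto_bounded_linear o bl bounded_linear_fst)
  from differentiable_upto_compose[OF o(2) this assms(2)]
  have "differentiable_upto n (UNIV \<times> UNIV \<times> U) (\<lambda>q::real \<times> real \<times> 'z. g (fst q * fst (snd q)) (snd (snd q)))"
    by (simp add: image_subset_iff)
  from differentiable_upto_integral[OF o(1) this] show ?thesis
    unfolding primitive_def
    by (intro differentiable_upto_scaleR[OF o(1) differentiable_upto_bounded_linear[OF o(1) bounded_linear_fst]])
      simp
qed

text \<open>The mean of the derivative over the segment from \<open>x\<close> to \<open>y\<close>. It turns a difference
  \<open>f y - f x\<close> into the value of a linear map at \<open>y - x\<close> that is continuous in both end points.
  Differentiability is obtained below from such factorizations (Caratheodory's criterion).\<close>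

definition mean_derivative ::
    "('a::real_normed_vector \<Rightarrow> 'a \<Rightarrow> 'b::banach) \<Rightarrow> 'a \<Rightarrow> 'a \<Rightarrow> 'a \<Rightarrow> 'b" where
  "mean_derivative f' x y k = integral {0..1} (\<lambda>s. f' (x + s *\<^sub>R (y - x)) k)"

locale C1_on_convex =
  fixes f :: "'a::euclidean_space \<Rightarrow> 'b::banach" and f' V
  assumes convex: "convex V"
    and deriv: "\<And>x. x \<in> V \<Longrightarrow> (f has_derivative f' x) (at x)"
    and cont: "\<And>k. continuous_on V (\<lambda>x. f' x k)"
begin

lemma segment_in: "x \<in> V \<Longrightarrow> y \<in> V \<Longrightarrow> s \<in> {0..1} \<Longrightarrow> x + s *\<^sub>R (y - x) \<in> V"
  using convexD_alt[OF convex, of x y s] by (simp add: algebra_simps)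

lemma integrable: "x \<in> V \<Longrightarrow> y \<in> V \<Longrightarrow> (\<lambda>s. f' (x + s *\<^sub>R (y - x)) k) integrable_on {0..1}"
  by (rule integrable_continuous_real, rule continuous_on_compose2[OF cont])
    (auto intro!: continuous_intros segment_in)

lemma linear_deriv: "x \<in> V \<Longrightarrow> linear (f' x)"
  using deriv by (rule has_derivative_linear)

lemma linear_mean: "x \<in> V \<Longrightarrow> y \<in> V \<Longrightarrow> linear (mean_derivative f' x y)"
proof (rule linearI)
  assume xy: "x \<in> V" "y \<in> V"
  show "mean_derivative f' x y (k + k') = mean_derivative f' x y k + mean_derivative f' x y k'" for k k'
    unfolding mean_derivative_def integral_add[OF integrable[OF xy] integrable[OF xy], symmetric]
    by (rule integral_cong) (rule linear_add[OF linear_deriv[OF segment_in[OF xy]]])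
  show "mean_derivative f' x y (c *\<^sub>R k) = c *\<^sub>R mean_derivative f' x y k" for c k
    unfolding mean_derivative_def integral_cmul[symmetric]
    by (rule integral_cong) (rule linear_cmul[OF linear_deriv[OF segment_in[OF xy]]])
qed

lemma mean_diagonal: "mean_derivative f' x x k = f' x k"
  by (simp add: mean_derivative_def)

lemma mean_value:
  assumes "x \<in> V" "y \<in> V"
  shows "f y - f x = mean_derivative f' x y (y - x)"
proof -
  have "((\<lambda>s. f' (x + s *\<^sub>R (y - x)) (y - x)) has_integral
      (f (x + 1 *\<^sub>R (y - x)) - f (x + 0 *\<^sub>R (y - x)))) {0..1}"
  proof (rule fundamental_theorem_of_calculus)
    fix s :: real assume s: "s \<in> {0..1}"
    have 1: "((\<lambda>s. x + s *\<^sub>R (y - x)) has_derivative (\<lambda>h. h *\<^sub>R (y - x))) (at s within {0..1})"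
      by (auto intro!: derivative_eq_intros)
    have "((\<lambda>s. f (x + s *\<^sub>R (y - x))) has_derivative
        (\<lambda>h. f' (x + s *\<^sub>R (y - x)) (h *\<^sub>R (y - x)))) (at s within {0..1})"
      by (rule has_derivative_compose[OF 1 deriv[OF segment_in[OF assms s]]])
    then show "((\<lambda>s. f (x + s *\<^sub>R (y - x))) has_vector_derivative
        f' (x + s *\<^sub>R (y - x)) (y - x)) (at s within {0..1})"
      by (simp add: has_vector_derivative_def linear_cmul[OF linear_deriv[OF segment_in[OF assms s]]])
  qed simp
  from integral_unique[OF this] show ?thesis by (simp add: mean_derivative_def)
qed

lemma continuous_on_mean: "continuous_on (V \<times> V) (\<lambda>(x, y). mean_derivative f' x y k)"
proof -
  have "continuous_on ((V \<times> V) \<times> cbox 0 1) (\<lambda>(p, s). f' (fst p + s *\<^sub>R (snd p - fst p)) k)"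
    unfolding split_beta
    by (rule continuous_on_compose2[OF cont])
      (auto intro!: continuous_intros segment_in)
  from integral_continuous_on_param[OF this] show ?thesis by (simp add: mean_derivative_def split_beta)
qed

lemma norm_mean_le:
  assumes "x \<in> V" "y \<in> V" "\<And>x. x \<in> V \<Longrightarrow> norm (f' x k) \<le> C"
  shows "norm (mean_derivative f' x y k) \<le> C"
proof -
  have "norm (mean_derivative f' x y k) \<le> integral {0..1::real} (\<lambda>s. C)"
    unfolding mean_derivative_def
    by (rule integral_norm_bound_integral[OF integrable[OF assms(1,2)]])
      (auto intro!: assms segment_in)
  then show ?thesis by simp
qed

end

text \<open>The product rule at a zero of the first factor: the second factor need not be differentiable,
  because the increment of the product is \<open>q y\<close> times a quantity close to \<open>G x\<close>.\<close>

lemma has_derivative_vanishing_factor: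
  fixes q :: "'a::real_normed_vector \<Rightarrow> real"
  assumes q: "(q has_derivative q') (at x)" "q x = 0" and G: "isCont G x"
  shows "((\<lambda>y. q y *\<^sub>R G y) has_derivative (\<lambda>h. q' h *\<^sub>R G x)) (at x)"
proof -
  have "((\<lambda>y. q y *\<^sub>R G x) has_derivative (\<lambda>h. q' h *\<^sub>R G x)) (at x)"
    by (rule has_derivative_scaleR_left[OF q(1)])
  moreover have "((\<lambda>y. q y *\<^sub>R (G y - G x)) has_derivative (\<lambda>h. 0)) (at x)"
  proof -
    obtain K d where K: "d > 0" "\<And>y. norm (y - x) < d \<Longrightarrow> norm (q y) \<le> K * norm (y - x)"
    proof -
      have "bounded_linear q'" using q(1) by (rule has_derivative_bounded_linear)
      then obtain B where B: "\<And>h. norm (q' h) \<le> norm h * B" using bounded_linear.bounded by blast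
      obtain d where d: "d > 0" "\<And>y. norm (y - x) < d \<Longrightarrow>
          norm (q y - q x - q' (y - x)) \<le> 1 * norm (y - x)"
        using q(1) unfolding has_derivative_at_alt by (metis zero_less_one)
      show thesis
      proof (rule that[OF d(1)])
        fix y assume "norm (y - x) < d"
        then have "norm (q y - q' (y - x)) \<le> norm (y - x)" using d(2) q(2) by simp
        then show "norm (q y) \<le> (B + 1) * norm (y - x)"
          using B[of "y - x"] norm_triangle_sub[of "q y" "q' (y - x)"] by (simp add: algebra_simps)
      qed
    qed
    show ?thesis unfolding has_derivative_at_alt
    proof (intro conjI allI impI bounded_linear_zero)
      fix e :: real assume e: "e > 0"
      define K' where "K' = \<bar>K\<bar> + 1"
      have K': "K' > 0" "K \<le> K'" by (auto simp: K'_def)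
      obtain d' where d': "d' > 0" "\<And>y. norm (y - x) < d' \<Longrightarrow> norm (G y - G x) < e / K'"
        using G e K' unfolding continuous_at_eps_delta dist_norm by (metis divide_pos_pos)
      have "norm (q y *\<^sub>R (G y - G x)) \<le> e * norm (y - x)" if y: "norm (y - x) < min d d'" for y
      proof -
        have "norm (q y) \<le> K * norm (y - x)" using K y by simp
        also have "\<dots> \<le> K' * norm (y - x)" using K' by (intro mult_right_mono) auto
        finally have 1: "norm (q y) \<le> K' * norm (y - x)" .
        have 2: "norm (G y - G x) \<le> e / K'" using d'(2) y by (simp add: less_imp_le)
        have "norm (q y *\<^sub>R (G y - G x)) \<le> (K' * norm (y - x)) * (e / K')"
          unfolding norm_scaleR using 1 2 K' by (intro mult_mono) auto
        then show ?thesis using K' by (simp add: field_simps)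
      qed
      then show "\<exists>d>0. \<forall>y. norm (y - x) < d \<longrightarrow>
          norm (q y *\<^sub>R (G y - G x) - q x *\<^sub>R (G x - G x) - 0) \<le> e * norm (y - x)"
        using K(1) d'(1) by (intro exI[of _ "min d d'"]) (simp add: q(2))
    qed
  qed
  ultimately have "((\<lambda>y. q y *\<^sub>R G x + q y *\<^sub>R (G y - G x)) has_derivative (\<lambda>h. q' h *\<^sub>R G x + 0)) (at x)"
    by (rule has_derivative_add)
  then show ?thesis by (simp add: algebra_simps)
qed

text \<open>The factorization is needed only for differences with the base point \<open>z0\<close>, but at all
  times. It then yields a total derivative although time is treated at \<open>z0\<close> alone.\<close>

lemma Caratheodory_joint:
  fixes f :: "real \<Rightarrow> 'a::euclidean_space \<Rightarrow> 'b::real_normed_vector"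
  assumes U: "open U" "z0 \<in> U" and t: "((\<lambda>t. f t z0) has_vector_derivative a) (at t0)"
    and H: "\<And>t z. z \<in> U \<Longrightarrow> f t z - f t z0 = H t z (z - z0)" "\<And>t z. z \<in> U \<Longrightarrow> linear (H t z)"
    and c: "\<And>b. continuous_on (UNIV \<times> U) (\<lambda>(t, z). H t z b)"
  shows "((\<lambda>p. f (fst p) (snd p)) has_derivative (\<lambda>h. fst h *\<^sub>R a + H t0 z0 (snd h))) (at (t0, z0))"
proof -
  have o: "open (UNIV \<times> U)" using U by (auto intro: open_Times)
  have 1: "((\<lambda>p. f (fst p) z0) has_derivative (\<lambda>h. fst h *\<^sub>R a)) (at (t0, z0))"
    by (rule has_derivative_compose[where f=fst and g="\<lambda>t. f t z0", simplified])
      (use t in \<open>auto simp: has_vector_derivative_def intro: bounded_linear_imp_has_derivative bounded_linear_fst\<close>)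
  have "((\<lambda>p. ((snd p - z0) \<bullet> b) *\<^sub>R H (fst p) (snd p) b) has_derivative
      (\<lambda>h. (snd h \<bullet> b) *\<^sub>R H (fst (t0, z0)) (snd (t0, z0)) b)) (at (t0, z0))" for b
  proof (rule has_derivative_vanishing_factor)
    show "((\<lambda>p. (snd p - z0) \<bullet> b) has_derivative (\<lambda>h. snd h \<bullet> b)) (at (t0, z0))"
      by (auto intro!: derivative_eq_intros)
    show "isCont (\<lambda>p. H (fst p) (snd p) b) (t0, z0)"
      using c[of b, unfolded split_beta continuous_on_eq_continuous_at[OF o]] U by simp
  qed simp
  then have "((\<lambda>p. f (fst p) z0 + (\<Sum>b\<in>Basis. ((snd p - z0) \<bullet> b) *\<^sub>R H (fst p) (snd p) b)) has_derivative
      (\<lambda>h. fst h *\<^sub>R a + (\<Sum>b\<in>Basis. (snd h \<bullet> b) *\<^sub>R H t0 z0 b))) (at (t0, z0))"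
    by (intro has_derivative_add 1 has_derivative_sum) simp
  then have "((\<lambda>p. f (fst p) (snd p)) has_derivative
      (\<lambda>h. fst h *\<^sub>R a + (\<Sum>b\<in>Basis. (snd h \<bullet> b) *\<^sub>R H t0 z0 b))) (at (t0, z0))"
  proof (rule has_derivative_transform_within_open[OF _ o])
    fix p :: "real \<times> 'a" assume p: "p \<in> UNIV \<times> U"
    then have "(\<Sum>b\<in>Basis. ((snd p - z0) \<bullet> b) *\<^sub>R H (fst p) (snd p) b) = H (fst p) (snd p) (snd p - z0)"
      by (intro linear_eq_sum_Basis[symmetric] H(2)) auto
    then show "f (fst p) z0 + (\<Sum>b\<in>Basis. ((snd p - z0) \<bullet> b) *\<^sub>R H (fst p) (snd p) b) = f (fst p) (snd p)"
      using H(1)[of "snd p" "fst p"] p by (auto simp: algebra_simps)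
  qed (use U in auto)
  then show ?thesis by (simp only: linear_eq_sum_Basis[OF H(2)[OF U(2)], symmetric])
qed

text \<open>The right-hand side is bounded along a constant \<open>h\<close> only for bounded \<open>h\<close>; so Picard's theorem
  is applied to the vectors of a basis as initial values, and the other solutions are linear combinations.\<close>

lemma linear_ODE_solution:
  fixes A :: "real \<Rightarrow> 'x::t2_space \<Rightarrow> 'a::euclidean_space \<Rightarrow> 'a"
  assumes lin: "\<And>t x. x \<in> S \<Longrightarrow> linear (A t x)" and bnd: "\<And>t x k. x \<in> S \<Longrightarrow> norm (A t x k) \<le> L * norm k"
    and cont: "\<And>k. continuous_on (UNIV \<times> S) (\<lambda>(t, x). A t x k)" and L: "L \<ge> 0"
  obtains P where "\<And>x h. x \<in> S \<Longrightarrow> P 0 x h = h"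
    "\<And>t x. linear (P t x)"
    "\<And>x h t. x \<in> S \<Longrightarrow> ((\<lambda>t. P t x h) has_vector_derivative A t x (P t x h)) (at t)"
    "\<And>h. continuous_on (UNIV \<times> S) (\<lambda>(t, x). P t x h)"
proof -
  have "\<exists>u. continuous_on (UNIV \<times> S) (\<lambda>(t, x). u t x) \<and> (\<forall>x\<in>S. u 0 x = b \<and>
      (\<forall>t. ((\<lambda>t. u t x) has_vector_derivative A t x (u t x)) (at t)))" for b
  proof (rule Picard_with_parameter[of S A L "\<lambda>_. b" "L * norm b"])
    have c: "continuous_on (UNIV \<times> S \<times> UNIV) (\<lambda>q. A (fst q) (fst (snd q)) k)" for k
      by (rule continuous_on_compose2[OF cont[of k, unfolded split_beta],
            where f="\<lambda>q. (fst q, fst (snd q))", simplified])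
        (auto intro!: continuous_intros)
    show "continuous_on (UNIV \<times> S \<times> UNIV) (\<lambda>(s, x, u). A s x u)"
      unfolding split_beta
      by (rule continuous_on_apply[where A="\<lambda>q. A (fst q) (fst (snd q))", OF _ c])
        (auto intro!: lin continuous_on_snd continuous_on_id)
    show "norm (A s x u - A s x v) \<le> L * norm (u - v)" if "x \<in> S" for s x u v
      unfolding linear_diff[OF lin[OF that], symmetric] by (rule bnd[OF that])
    show "norm (A s x b) \<le> L * norm b" if "x \<in> S" for s x by (rule bnd[OF that])
  qed (rule continuous_on_const, rule L, blast)
  then obtain u where u: "\<And>b. continuous_on (UNIV \<times> S) (\<lambda>(t, x). u b t x)"
    "\<And>b x. x \<in> S \<Longrightarrow> u b 0 x = b"
    "\<And>b x t. x \<in> S \<Longrightarrow> ((\<lambda>t. u b t x) has_vector_derivative A t x (u b t x)) (at t)" by metis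
  define P where "P t x h = (\<Sum>b\<in>Basis. (h \<bullet> b) *\<^sub>R u b t x)" for t x h
  show thesis
  proof (rule that[of P])
    show "P 0 x h = h" if "x \<in> S" for x h
      using that by (simp add: P_def u(2) euclidean_representation)
    show "linear (P t x)" for t x
      by (rule linearI) (simp_all add: P_def inner_left_distrib scaleR_left_distrib sum.distrib scaleR_sum_right)
    show "((\<lambda>t. P t x h) has_vector_derivative A t x (P t x h)) (at t)" if "x \<in> S" for x h t
    proof -
      have "((\<lambda>t. P t x h) has_vector_derivative (\<Sum>b\<in>Basis. (h \<bullet> b) *\<^sub>R A t x (u b t x))) (at t)"
        unfolding P_def
        by (intro has_vector_derivative_sum bounded_linear.has_vector_derivative[OF bounded_linear_scaleR_right] u(3) that)
      then show ?thesis by (simp add: P_def linear_sum[OF lin[OF that]] linear_cmul[OF lin[OF that]])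
    qed
    show "continuous_on (UNIV \<times> S) (\<lambda>(t, x). P t x h)" for h
      using u(1) unfolding P_def split_beta
      by (intro continuous_on_sum continuous_on_scaleR continuous_on_const)
  qed
qed

text \<open>A complete flow on an open set \<open>U\<close>. The convex set \<open>V\<close> around \<open>U\<close> contains the segments between
  points of \<open>U\<close>, along which derivatives of the field are averaged.\<close>

locale invariant_flow =
  fixes X :: "'a::euclidean_space \<Rightarrow> 'a" and V U :: "'a set" and \<Phi> :: "real \<Rightarrow> 'a \<Rightarrow> 'a" and L :: real
  assumes open_V: "open V" and convex_V: "convex V" and open_U: "open U" and U_subset_V: "U \<subseteq> V"
    and smooth_X: "smooth_on V X"
    and norm_derivative_le: "\<And>x h. x \<in> V \<Longrightarrow> norm (frechet_derivative X (at x) h) \<le> L * norm h"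
    and L_nonneg: "L \<ge> 0"
    and flow_in: "\<And>z t. z \<in> U \<Longrightarrow> \<Phi> t z \<in> U"
    and flow_0: "\<And>z. z \<in> U \<Longrightarrow> \<Phi> 0 z = z"
    and flow_deriv: "\<And>z t. z \<in> U \<Longrightarrow> ((\<lambda>t. \<Phi> t z) has_vector_derivative X (\<Phi> t z)) (at t)"
begin

definition DX :: "'a \<Rightarrow> 'a \<Rightarrow> 'a" where "DX x k = frechet_derivative X (at x) k"

definition D2X :: "'a \<Rightarrow> 'a \<Rightarrow> 'a \<Rightarrow> 'a" where
  "D2X b x \<zeta> = frechet_derivative (\<lambda>y. DX y b) (at x) \<zeta>"

lemma flow_in_V: "z \<in> U \<Longrightarrow> \<Phi> t z \<in> V"
  using flow_in U_subset_V by blast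

lemma X_deriv: "x \<in> V \<Longrightarrow> (X has_derivative DX x) (at x)"
  using differentiable_upto_SucD(1)[of 0 V X] smooth_X unfolding smooth_on_def DX_def[abs_def] by blast

lemma linear_DX: "x \<in> V \<Longrightarrow> linear (DX x)"
  using X_deriv by (rule has_derivative_linear)

lemma differentiable_upto_DX: "differentiable_upto n V (\<lambda>x. DX x k)"
  unfolding DX_def by (rule differentiable_upto_SucD(2)) (use smooth_X in \<open>auto simp only: smooth_on_def\<close>)

lemma differentiable_upto_D2X: "differentiable_upto n V (\<lambda>x. D2X b x k)"
  unfolding D2X_def by (rule differentiable_upto_SucD(2)[OF differentiable_upto_DX])

sublocale D1: C1_on_convex X DX V
  by unfold_locales (use convex_V X_deriv differentiable_upto_imp_continuous[OF differentiable_upto_DX] in auto)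

sublocale D2: C1_on_convex "\<lambda>x. DX x b" "D2X b" V for b
  unfolding D2X_def
  by unfold_locales (use convex_V differentiable_upto_SucD(1)[OF differentiable_upto_DX]
    differentiable_upto_imp_continuous[OF differentiable_upto_D2X, unfolded D2X_def] in auto)

lemma norm_DX_le: "x \<in> V \<Longrightarrow> norm (DX x h) \<le> L * norm h"
  unfolding DX_def by (rule norm_derivative_le)

lemma X_Lipschitz:
  assumes "x \<in> V" "y \<in> V"
  shows "norm (X x - X y) \<le> L * norm (x - y)"
  unfolding D1.mean_value[OF assms(2,1)]
  by (rule D1.norm_mean_le[OF assms(2,1)]) (rule norm_DX_le)

lemma flow_Lipschitz:
  assumes "z \<in> U" "z' \<in> U"
  shows "norm (\<Phi> t z - \<Phi> t z') \<le> norm (z - z') * exp (L * \<bar>t\<bar>)"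
  using ODE_dependence_on_initial_value[of 0 t "\<lambda>t. \<Phi> t z" "\<lambda>_. X" "\<lambda>t. \<Phi> t z'" L]
  by (simp add: flow_0 assms flow_deriv has_vector_derivative_at_within X_Lipschitz flow_in_V)

lemma trajectory_eq_flow:
  assumes "trajectory X U {0..T} x" "x 0 \<in> U" "T \<ge> 0"
  shows "x T = \<Phi> T (x 0)"
proof -
  have "norm (x T - \<Phi> T (x 0)) \<le> norm (x 0 - \<Phi> 0 (x 0)) * exp (L * \<bar>T - 0\<bar>)"
    by (rule ODE_dependence_on_initial_value[where N="\<lambda>_. X"])
      (use assms U_subset_V in \<open>auto simp: trajectory_def closed_segment_eq_real_ivl
        intro!: X_Lipschitz flow_in_V has_vector_derivative_at_within flow_deriv\<close>)
  then show ?thesis by (simp add: flow_0 assms)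
qed

lemma flow_add:
  assumes "z \<in> U"
  shows "\<Phi> (s + t) z = \<Phi> s (\<Phi> t z)"
proof (rule ODE_unique[where N="\<lambda>_. X" and a=0 and L=L and u="\<lambda>s. \<Phi> (s + t) z" and v="\<lambda>s. \<Phi> s (\<Phi> t z)"])
  fix s
  have "((\<lambda>s. s + t) has_vector_derivative 1) (at s)"
    by (auto intro!: derivative_eq_intros simp: has_vector_derivative_def)
  from vector_diff_chain_at[OF this flow_deriv[OF assms]]
  show "((\<lambda>s. \<Phi> (s + t) z) has_vector_derivative X (\<Phi> (s + t) z)) (at s)" by (simp add: o_def)
  show "((\<lambda>s. \<Phi> s (\<Phi> t z)) has_vector_derivative X (\<Phi> s (\<Phi> t z))) (at s)"
    by (rule flow_deriv[OF flow_in[OF assms]])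
  show "norm (X (\<Phi> (s + t) z) - X (\<Phi> s (\<Phi> t z))) \<le> L * norm (\<Phi> (s + t) z - \<Phi> s (\<Phi> t z))"
    by (intro X_Lipschitz flow_in_V flow_in assms)
qed (simp add: flow_0 flow_in assms)

lemma flow_inverse: "z \<in> U \<Longrightarrow> \<Phi> (- t) (\<Phi> t z) = z" "z \<in> U \<Longrightarrow> \<Phi> t (\<Phi> (- t) z) = z"
  using flow_add[of z "- t" t] flow_add[of z t "- t"] by (auto simp: flow_0)

lemma continuous_on_flow: "continuous_on (UNIV \<times> U) (\<lambda>p. \<Phi> (fst p) (snd p))"
proof -
  have "isCont (\<lambda>p. \<Phi> (fst p) (snd p)) (t, z)" if z: "z \<in> U" for t z
  proof -
    have "((\<lambda>p. \<Phi> (fst p) z + (\<Phi> (fst p) (snd p) - \<Phi> (fst p) z)) \<longlongrightarrow> \<Phi> t z + 0) (at (t, z))"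
    proof (intro tendsto_add)
      have "isCont (\<lambda>t. \<Phi> t z) t" using flow_deriv[OF z] by (rule has_vector_derivative_continuous)
      from isCont_tendsto_compose[OF this, where f=fst and F="at (t, z)"]
      show "((\<lambda>p. \<Phi> (fst p) z) \<longlongrightarrow> \<Phi> t z) (at (t, z))"
        using tendsto_fst[OF tendsto_ident_at[of "(t, z)" UNIV]] by simp
      have "\<forall>\<^sub>F p in at (t, z). p \<in> UNIV \<times> U"
        by (rule eventually_at_in_open') (use open_U z in \<open>auto intro: open_Times\<close>)
      then have ev: "\<forall>\<^sub>F p in at (t, z). norm (\<Phi> (fst p) (snd p) - \<Phi> (fst p) z)
          \<le> norm (snd p - z) * exp (L * \<bar>fst p\<bar>)"
        by eventually_elim (use flow_Lipschitz z in auto)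
      have "((\<lambda>p. norm (snd p - z) * exp (L * \<bar>fst p\<bar>)) \<longlongrightarrow> norm (snd (t, z) - z) * exp (L * \<bar>fst (t, z)\<bar>)) (at (t, z))"
        by (intro tendsto_intros)
      then show "((\<lambda>p. \<Phi> (fst p) (snd p) - \<Phi> (fst p) z) \<longlongrightarrow> 0) (at (t, z))"
        by (intro Lim_null_comparison[OF ev]) simp
    qed
    then show ?thesis by (simp add: isCont_def)
  qed
  then show ?thesis by (auto intro!: continuous_at_imp_continuous_on)
qed

text \<open>The linear equation with the averaged Jacobian as coefficient transports the difference of two
  trajectories exactly. On the diagonal \<open>z' = z\<close> it is the variational equation, so that the
  continuity of the transport in \<open>(z, z')\<close> gives the differentiability of the flow.\<close>

definition transport :: "real \<Rightarrow> 'a \<times> 'a \<Rightarrow> 'a \<Rightarrow> 'a" where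
  "transport = (SOME P. (\<forall>q h. q \<in> U \<times> U \<longrightarrow> P 0 q h = h) \<and> (\<forall>t q. linear (P t q)) \<and>
    (\<forall>q h t. q \<in> U \<times> U \<longrightarrow> ((\<lambda>t. P t q h) has_vector_derivative
      mean_derivative DX (\<Phi> t (fst q)) (\<Phi> t (snd q)) (P t q h)) (at t)) \<and>
    (\<forall>h. continuous_on (UNIV \<times> (U \<times> U)) (\<lambda>p. P (fst p) (snd p) h)))"

lemma continuous_on_mean_along_flow:
  assumes "\<And>k. continuous_on (V \<times> V) (\<lambda>(x, y). m x y k)"
  shows "continuous_on (UNIV \<times> (U \<times> U)) (\<lambda>p. m (\<Phi> (fst p) (fst (snd p))) (\<Phi> (fst p) (snd (snd p))) k)"
proof -
  have "continuous_on (UNIV \<times> U \<times> U) (\<lambda>p. (\<Phi> (fst p) (fst (snd p)), \<Phi> (fst p) (snd (snd p))))"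
    by (intro continuous_on_Pair
        continuous_on_compose2[OF continuous_on_flow, where f="\<lambda>p. (fst p, fst (snd p))", simplified]
        continuous_on_compose2[OF continuous_on_flow, where f="\<lambda>p. (fst p, snd (snd p))", simplified])
      (auto intro!: continuous_intros)
  from continuous_on_compose2[OF assms[unfolded split_beta] this, of k] show ?thesis
    by (simp add: image_subset_iff flow_in_V)
qed

lemma transport:
  shows transport_0: "z \<in> U \<Longrightarrow> z' \<in> U \<Longrightarrow> transport 0 (z, z') h = h"
    and linear_transport: "linear (transport t q)"
    and transport_deriv: "z \<in> U \<Longrightarrow> z' \<in> U \<Longrightarrow> ((\<lambda>t. transport t (z, z') h) has_vector_derivative
      mean_derivative DX (\<Phi> t z) (\<Phi> t z') (transport t (z, z') h)) (at t)"
    and continuous_on_transport: "continuous_on (UNIV \<times> (U \<times> U)) (\<lambda>p. transport (fst p) (snd p) h)"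
proof -
  obtain P where "\<And>q h. q \<in> U \<times> U \<Longrightarrow> P 0 q h = h" "\<And>t q. linear (P t q)"
    "\<And>q h t. q \<in> U \<times> U \<Longrightarrow> ((\<lambda>t. P t q h) has_vector_derivative
      mean_derivative DX (\<Phi> t (fst q)) (\<Phi> t (snd q)) (P t q h)) (at t)"
    "\<And>h. continuous_on (UNIV \<times> (U \<times> U)) (\<lambda>(t, q). P t q h)"
  proof (rule linear_ODE_solution[of "U \<times> U" "\<lambda>t q. mean_derivative DX (\<Phi> t (fst q)) (\<Phi> t (snd q))" L])
    show "linear (mean_derivative DX (\<Phi> t (fst q)) (\<Phi> t (snd q)))" if "q \<in> U \<times> U" for t q
      using that by (intro D1.linear_mean flow_in_V) auto
    show "norm (mean_derivative DX (\<Phi> t (fst q)) (\<Phi> t (snd q)) k) \<le> L * norm k" if "q \<in> U \<times> U" for t q k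
      using that by (intro D1.norm_mean_le flow_in_V norm_DX_le) auto
    show "continuous_on (UNIV \<times> U \<times> U) (\<lambda>(t, q). mean_derivative DX (\<Phi> t (fst q)) (\<Phi> t (snd q)) k)" for k
      using continuous_on_mean_along_flow[where m="mean_derivative DX" and k=k, OF D1.continuous_on_mean]
      unfolding split_beta .
  qed (rule L_nonneg, blast)
  then have "\<exists>P. (\<forall>q h. q \<in> U \<times> U \<longrightarrow> P 0 q h = h) \<and> (\<forall>t q. linear (P t q)) \<and>
    (\<forall>q h t. q \<in> U \<times> U \<longrightarrow> ((\<lambda>t. P t q h) has_vector_derivative
      mean_derivative DX (\<Phi> t (fst q)) (\<Phi> t (snd q)) (P t q h)) (at t)) \<and>
    (\<forall>h. continuous_on (UNIV \<times> (U \<times> U)) (\<lambda>p. P (fst p) (snd p) h))"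
    unfolding split_beta by (intro exI[of _ P] conjI allI impI)
  note T = someI_ex[OF this, folded transport_def]
  show "z \<in> U \<Longrightarrow> z' \<in> U \<Longrightarrow> transport 0 (z, z') h = h" using T by blast
  show "linear (transport t q)" using T by blast
  show "continuous_on (UNIV \<times> (U \<times> U)) (\<lambda>p. transport (fst p) (snd p) h)" using T by blast
  show "((\<lambda>t. transport t (z, z') h) has_vector_derivative
      mean_derivative DX (\<Phi> t z) (\<Phi> t z') (transport t (z, z') h)) (at t)" if "z \<in> U" "z' \<in> U"
    using T[THEN conjunct2, THEN conjunct2, THEN conjunct1, rule_format, of "(z, z')"] that by simp
qed

lemma flow_difference:
  assumes "z \<in> U" "z' \<in> U"
  shows "\<Phi> t z' - \<Phi> t z = transport t (z, z') (z' - z)"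
proof (rule ODE_unique[where N="\<lambda>t. mean_derivative DX (\<Phi> t z) (\<Phi> t z')" and a=0 and L=L
      and u="\<lambda>t. \<Phi> t z' - \<Phi> t z" and v="\<lambda>t. transport t (z, z') (z' - z)"])
  fix t
  note V = flow_in_V[OF assms(1)] flow_in_V[OF assms(2)]
  show "((\<lambda>t. \<Phi> t z' - \<Phi> t z) has_vector_derivative
      mean_derivative DX (\<Phi> t z) (\<Phi> t z') (\<Phi> t z' - \<Phi> t z)) (at t)"
    unfolding D1.mean_value[OF V, symmetric]
    by (intro has_vector_derivative_diff flow_deriv assms)
  show "((\<lambda>t. transport t (z, z') (z' - z)) has_vector_derivative
      mean_derivative DX (\<Phi> t z) (\<Phi> t z') (transport t (z, z') (z' - z))) (at t)"
    by (rule transport_deriv[OF assms])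
  show "norm (mean_derivative DX (\<Phi> t z) (\<Phi> t z') (\<Phi> t z' - \<Phi> t z)
        - mean_derivative DX (\<Phi> t z) (\<Phi> t z') (transport t (z, z') (z' - z)))
      \<le> L * norm (\<Phi> t z' - \<Phi> t z - transport t (z, z') (z' - z))"
    unfolding linear_diff[OF D1.linear_mean[OF V], symmetric]
    by (intro D1.norm_mean_le V norm_DX_le)
qed (simp add: flow_0 transport_0 assms)

definition Dflow :: "real \<Rightarrow> 'a \<Rightarrow> 'a \<Rightarrow> 'a" where
  "Dflow t z = transport t (z, z)"

lemma linear_Dflow: "linear (Dflow t z)"
  by (simp add: Dflow_def linear_transport)

lemma Dflow_0: "z \<in> U \<Longrightarrow> Dflow 0 z h = h"
  by (simp add: Dflow_def transport_0)

lemma Dflow_deriv: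
  assumes "z \<in> U"
  shows "((\<lambda>t. Dflow t z h) has_vector_derivative DX (\<Phi> t z) (Dflow t z h)) (at t)"
  using transport_deriv[OF assms assms] by (simp add: Dflow_def D1.mean_diagonal)

lemma continuous_on_Dflow: "continuous_on (UNIV \<times> U) (\<lambda>p. Dflow (fst p) (snd p) h)"
  unfolding Dflow_def
  by (rule continuous_on_compose2[OF continuous_on_transport, where f="\<lambda>p. (fst p, (snd p, snd p))", simplified])
    (auto intro!: continuous_intros)

lemma flow_has_derivative:
  assumes "z \<in> U"
  shows "((\<lambda>p. \<Phi> (fst p) (snd p)) has_derivative (\<lambda>h. fst h *\<^sub>R X (\<Phi> t z) + Dflow t z (snd h))) (at (t, z))"
  unfolding Dflow_def
proof (rule Caratheodory_joint[where f=\<Phi> and H="\<lambda>t z'. transport t (z, z')", OF open_U assms flow_deriv[OF assms]])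
  show "continuous_on (UNIV \<times> U) (\<lambda>(t, z'). transport t (z, z') b)" for b
    unfolding split_beta
    by (rule continuous_on_compose2[OF continuous_on_transport, where f="\<lambda>p. (fst p, (z, snd p))", simplified])
      (use assms in \<open>auto intro!: continuous_intros\<close>)
qed (use assms flow_difference linear_transport in auto)

lemma Dflow_add:
  assumes "z \<in> U"
  shows "Dflow (s + t) z h = Dflow s (\<Phi> t z) (Dflow t z h)"
proof (rule ODE_unique[where N="\<lambda>s. DX (\<Phi> (s + t) z)" and a=0 and L=L
      and u="\<lambda>s. Dflow (s + t) z h" and v="\<lambda>s. Dflow s (\<Phi> t z) (Dflow t z h)"])
  fix s
  have "((\<lambda>s. s + t) has_vector_derivative 1) (at s)"
    by (auto intro!: derivative_eq_intros simp: has_vector_derivative_def)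
  from vector_diff_chain_at[OF this Dflow_deriv[OF assms]]
  show "((\<lambda>s. Dflow (s + t) z h) has_vector_derivative DX (\<Phi> (s + t) z) (Dflow (s + t) z h)) (at s)"
    by (simp add: o_def)
  show "((\<lambda>s. Dflow s (\<Phi> t z) (Dflow t z h)) has_vector_derivative
      DX (\<Phi> (s + t) z) (Dflow s (\<Phi> t z) (Dflow t z h))) (at s)"
    unfolding flow_add[OF assms] by (rule Dflow_deriv[OF flow_in[OF assms]])
  show "norm (DX (\<Phi> (s + t) z) (Dflow (s + t) z h) - DX (\<Phi> (s + t) z) (Dflow s (\<Phi> t z) (Dflow t z h)))
      \<le> L * norm (Dflow (s + t) z h - Dflow s (\<Phi> t z) (Dflow t z h))"
    unfolding linear_diff[OF linear_DX[OF flow_in_V[OF assms]], symmetric]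
    by (intro norm_DX_le flow_in_V assms)
qed (simp add: Dflow_0 flow_in assms)

lemma Dflow_inverse:
  assumes "z \<in> U"
  shows "Dflow (- t) (\<Phi> t z) (Dflow t z h) = h" "Dflow t z (Dflow (- t) (\<Phi> t z) h) = h"
  using Dflow_add[OF assms, of "- t" t h] Dflow_add[OF flow_in[OF assms], of t "- t" t h]
  by (simp_all add: Dflow_0 assms flow_in flow_inverse)

text \<open>Duhamel's formula (variation of constants) for \<open>e' = DX e + b\<close> along a trajectory, with
  \<open>e 0 = 0\<close>.\<close>

definition Duhamel :: "(real \<Rightarrow> 'a) \<Rightarrow> 'a \<Rightarrow> real \<Rightarrow> 'a" where
  "Duhamel b z t = Dflow t z (primitive (\<lambda>s. Dflow (- s) (\<Phi> s z) (b s)) t)"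

lemma continuous_on_inverse_Dflow:
  fixes z b :: "'x::topological_space \<Rightarrow> 'a"
  assumes "\<And>x. x \<in> S \<Longrightarrow> z x \<in> U" "continuous_on S s" "continuous_on S z" "continuous_on S b"
  shows "continuous_on S (\<lambda>x. Dflow (- s x) (\<Phi> (s x) (z x)) (b x))"
proof (rule continuous_on_apply[OF linear_Dflow _ assms(4)])
  have 1: "continuous_on S (\<lambda>x. \<Phi> (s x) (z x))"
    by (rule continuous_on_compose2[OF continuous_on_flow, where f="\<lambda>x. (s x, z x)", simplified])
      (use assms in \<open>auto intro!: continuous_intros\<close>)
  show "continuous_on S (\<lambda>x. Dflow (- s x) (\<Phi> (s x) (z x)) c)" for c
    by (rule continuous_on_compose2[OF continuous_on_Dflow, where f="\<lambda>x. (- s x, \<Phi> (s x) (z x))", simplified])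
      (use assms 1 flow_in in \<open>auto intro!: continuous_intros\<close>)
qed

lemma Duhamel_unique:
  assumes z: "z \<in> U" and b: "continuous_on UNIV b"
    and e: "\<And>t. (e has_vector_derivative DX (\<Phi> t z) (e t) + b t) (at t)" "e 0 = 0"
  shows "e t = Duhamel b z t"
proof (rule ODE_unique[where N="\<lambda>t u. DX (\<Phi> t z) u + b t" and a=0 and L=L and u=e and v="Duhamel b z"])
  fix t
  have c: "continuous_on UNIV (\<lambda>s. Dflow (- s) (\<Phi> s z) (b s))"
    by (rule continuous_on_inverse_Dflow) (auto intro!: continuous_intros z b)
  have "((\<lambda>t. Dflow t z (primitive (\<lambda>s. Dflow (- s) (\<Phi> s z) (b s)) t)) has_vector_derivative
      Dflow t z (Dflow (- t) (\<Phi> t z) (b t)) +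
      DX (\<Phi> t z) (Dflow t z (primitive (\<lambda>s. Dflow (- s) (\<Phi> s z) (b s)) t))) (at t)"
    by (rule has_vector_derivative_apply[where A'="\<lambda>h. DX (\<Phi> t z) (Dflow t z h)", OF linear_Dflow
          _ Dflow_deriv[OF z] primitive_has_vector_derivative[OF c]])
      (rule linear_compose[OF linear_Dflow linear_DX[OF flow_in_V[OF z]], unfolded o_def])
  then show "(Duhamel b z has_vector_derivative DX (\<Phi> t z) (Duhamel b z t) + b t) (at t)"
    by (simp add: Duhamel_def[abs_def] Dflow_inverse[OF z] add.commute)
  show "norm (DX (\<Phi> t z) (e t) + b t - (DX (\<Phi> t z) (Duhamel b z t) + b t)) \<le> L * norm (e t - Duhamel b z t)"
    unfolding add_diff_cancel_right linear_diff[OF linear_DX[OF flow_in_V[OF z]], symmetric]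
    by (intro norm_DX_le flow_in_V z)
  show "(e has_vector_derivative DX (\<Phi> t z) (e t) + b t) (at t)" by (rule e)
qed (simp add: e Duhamel_def primitive_0 linear_0[OF linear_Dflow])

text \<open>The averaged second derivative of the field, bilinear in \<open>\<zeta>\<close> and \<open>k\<close>. Through it the
  difference of the Jacobians at two points factors over the difference of the points.\<close>

definition second_mean :: "'a \<Rightarrow> 'a \<Rightarrow> 'a \<Rightarrow> 'a \<Rightarrow> 'a" where
  "second_mean x y \<zeta> k = (\<Sum>b\<in>Basis. (k \<bullet> b) *\<^sub>R mean_derivative (D2X b) x y \<zeta>)"

lemma linear_second_mean: "x \<in> V \<Longrightarrow> y \<in> V \<Longrightarrow> linear (\<lambda>\<zeta>. second_mean x y \<zeta> k)"
  by (rule linearI)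
    (simp_all add: second_mean_def linear_add[OF D2.linear_mean] linear_cmul[OF D2.linear_mean]
      scaleR_right_distrib sum.distrib scaleR_sum_right mult.commute)

lemma DX_difference:
  assumes "x \<in> V" "y \<in> V"
  shows "DX y k - DX x k = second_mean x y (y - x) k"
  unfolding second_mean_def D2.mean_value[OF assms, symmetric] scaleR_diff_right sum_subtractf
  by (simp only: linear_eq_sum_Basis[OF linear_DX, symmetric] assms)

text \<open>The difference of the differentials of the flow at \<open>z'\<close> and \<open>z\<close> solves the variational equation
  along \<open>z\<close> with a source that is linear in \<open>z' - z\<close>; \<open>\<zeta>\<close> stands for \<open>z' - z\<close>.\<close>

definition second_transport :: "'a \<Rightarrow> 'a \<Rightarrow> real \<Rightarrow> 'a \<Rightarrow> 'a \<Rightarrow> 'a" where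
  "second_transport z h t z' \<zeta> =
    Duhamel (\<lambda>s. second_mean (\<Phi> s z) (\<Phi> s z') (transport s (z, z') \<zeta>) (Dflow s z' h)) z t"

lemma continuous_on_source:
  assumes "z \<in> U"
  shows "continuous_on (UNIV \<times> U)
    (\<lambda>p. second_mean (\<Phi> (fst p) z) (\<Phi> (fst p) (snd p)) (transport (fst p) (z, snd p) \<zeta>) (Dflow (fst p) (snd p) h))"
proof -
  have 1: "linear (mean_derivative (D2X b) (\<Phi> (fst p) z) (\<Phi> (fst p) (snd p)))" if "p \<in> UNIV \<times> U" for b p
    by (intro D2.linear_mean flow_in_V) (use that assms in auto)
  have 2: "continuous_on (UNIV \<times> U) (\<lambda>p. mean_derivative (D2X b) (\<Phi> (fst p) z) (\<Phi> (fst p) (snd p)) k)" for b k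
    by (rule continuous_on_compose2[OF continuous_on_mean_along_flow[OF D2.continuous_on_mean],
          where f="\<lambda>p. (fst p, (z, snd p))", simplified])
      (use assms in \<open>auto intro!: continuous_intros\<close>)
  have 3: "continuous_on (UNIV \<times> U) (\<lambda>p. transport (fst p) (z, snd p) \<zeta>)"
    by (rule continuous_on_compose2[OF continuous_on_transport, where f="\<lambda>p. (fst p, (z, snd p))", simplified])
      (use assms in \<open>auto intro!: continuous_intros\<close>)
  note m = continuous_on_apply[OF 1 2 3]
  show ?thesis unfolding second_mean_def
    by (intro continuous_on_sum continuous_on_scaleR continuous_on_inner continuous_on_Dflow continuous_on_const m)
qed

lemma Dflow_difference:
  assumes "z \<in> U" "z' \<in> U"
  shows "Dflow t z' h - Dflow t z h = second_transport z h t z' (z' - z)"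
  unfolding second_transport_def
proof (rule Duhamel_unique[OF assms(1), where e="\<lambda>t. Dflow t z' h - Dflow t z h"])
  let ?b = "\<lambda>s. second_mean (\<Phi> s z) (\<Phi> s z') (transport s (z, z') (z' - z)) (Dflow s z' h)"
  note V = flow_in_V[OF assms(1)] flow_in_V[OF assms(2)]
  show "continuous_on UNIV ?b"
    by (rule continuous_on_compose2[OF continuous_on_source[OF assms(1)], where f="\<lambda>s. (s, z')", simplified])
      (use assms in \<open>auto intro!: continuous_intros\<close>)
  fix t
  have "?b t = DX (\<Phi> t z') (Dflow t z' h) - DX (\<Phi> t z) (Dflow t z' h)"
    unfolding DX_difference[OF V] flow_difference[OF assms] ..
  then have "DX (\<Phi> t z) (Dflow t z' h - Dflow t z h) + ?b t = DX (\<Phi> t z') (Dflow t z' h) - DX (\<Phi> t z) (Dflow t z h)"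
    by (simp add: linear_diff[OF linear_DX[OF V(1)]])
  then show "((\<lambda>t. Dflow t z' h - Dflow t z h) has_vector_derivative
      DX (\<Phi> t z) (Dflow t z' h - Dflow t z h) + ?b t) (at t)"
    by (simp only:) (intro has_vector_derivative_diff Dflow_deriv assms)
qed (simp add: Dflow_0 assms)

lemma linear_second_transport:
  assumes "z \<in> U" "z' \<in> U"
  shows "linear (second_transport z h t z')"
proof -
  note V = flow_in_V[OF assms(1)] flow_in_V[OF assms(2)]
  define B where "B s \<zeta> = Dflow (- s) (\<Phi> s z) (second_mean (\<Phi> s z) (\<Phi> s z') (transport s (z, z') \<zeta>) (Dflow s z' h))" for s \<zeta>
  have lin: "linear (B s)" for s
    using linear_compose[OF linear_compose[OF linear_transport[of s "(z, z')"]
      linear_second_mean[OF V, of s s "Dflow s z' h"]] linear_Dflow[of "- s" "\<Phi> s z"]]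
    by (simp add: B_def[abs_def] o_def)
  have "continuous_on UNIV (\<lambda>s. B s \<zeta>)" for \<zeta>
    unfolding B_def
    by (rule continuous_on_inverse_Dflow)
      (use assms in \<open>auto intro!: continuous_intros
        continuous_on_compose2[OF continuous_on_source[OF assms(1)], where f="\<lambda>s. (s, z')", simplified]\<close>)
  note i = integrable_rescaled[OF this]
  have "linear (\<lambda>\<zeta>. primitive (\<lambda>s. B s \<zeta>) t)"
    by (rule linearI)
      (simp_all add: primitive_def linear_add[OF lin] linear_cmul[OF lin] integral_add i scaleR_right_distrib mult.commute)
  from linear_compose[OF this linear_Dflow[of t z]] show ?thesis
    by (simp add: second_transport_def[abs_def] Duhamel_def B_def o_def)
qed

lemma continuous_on_second_transport:
  assumes "z \<in> U"
  shows "continuous_on (UNIV \<times> U) (\<lambda>(t, z'). second_transport z h t z' \<zeta>)"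
  unfolding second_transport_def Duhamel_def split_beta
proof (rule continuous_on_apply[OF linear_Dflow])
  show "continuous_on (UNIV \<times> U) (\<lambda>p. Dflow (fst p) z b)" for b
    by (rule continuous_on_compose2[OF continuous_on_Dflow, where f="\<lambda>p. (fst p, z)", simplified])
      (use assms in \<open>auto intro!: continuous_intros\<close>)
  have "continuous_on (UNIV \<times> U) (\<lambda>p. Dflow (- fst p) (\<Phi> (fst p) z)
      (second_mean (\<Phi> (fst p) z) (\<Phi> (fst p) (snd p)) (transport (fst p) (z, snd p) \<zeta>) (Dflow (fst p) (snd p) h)))"
    by (rule continuous_on_inverse_Dflow) (use assms in \<open>auto intro!: continuous_intros continuous_on_source\<close>)
  from continuous_on_primitive[unfolded split_beta, OF this]
  show "continuous_on (UNIV \<times> U) (\<lambda>p. primitive (\<lambda>s. Dflow (- s) (\<Phi> s z)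
      (second_mean (\<Phi> s z) (\<Phi> s (snd p)) (transport s (z, snd p) \<zeta>) (Dflow s (snd p) h))) (fst p))" .
qed

lemma Dflow_has_derivative:
  assumes "z \<in> U"
  shows "((\<lambda>p. Dflow (fst p) (snd p) b) has_derivative
    (\<lambda>h. fst h *\<^sub>R DX (\<Phi> t z) (Dflow t z b) + second_transport z b t z (snd h))) (at (t, z))"
  by (rule Caratheodory_joint[where f="\<lambda>t z. Dflow t z b" and H="second_transport z b",
        OF open_U assms Dflow_deriv[OF assms]])
    (auto intro: assms Dflow_difference linear_second_transport continuous_on_second_transport)

text \<open>Both the flow and its differential gain one derivative at a time, because the right-hand
  sides of the two derivative formulas involve no derivative of the differential.\<close>

lemma differentiable_upto_flow:
  "differentiable_upto n (UNIV \<times> U) (\<lambda>p. \<Phi> (fst p) (snd p)) \<and>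
   (\<forall>b. differentiable_upto n (UNIV \<times> U) (\<lambda>p. Dflow (fst p) (snd p) b))"
proof (induction n)
  case 0
  then show ?case using continuous_on_flow continuous_on_Dflow by simp
next
  case (Suc n)
  then have F: "differentiable_upto n (UNIV \<times> U) (\<lambda>p. \<Phi> (fst p) (snd p))"
    and D: "differentiable_upto n (UNIV \<times> U) (\<lambda>p. Dflow (fst p) (snd p) b)" for b by auto
  have o: "open (UNIV \<times> U)" using open_U by (auto intro: open_Times)
  have FV: "(\<lambda>p. \<Phi> (fst p) (snd p)) ` (UNIV \<times> U) \<subseteq> V" using flow_in_V by auto
  have f: "differentiable_upto n (UNIV \<times> U) (fst :: real \<times> 'a \<Rightarrow> real)"
    "differentiable_upto n (UNIV \<times> U) (snd :: real \<times> 'a \<Rightarrow> 'a)"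
    "differentiable_upto n (UNIV \<times> U) (\<lambda>p :: real \<times> 'a. - fst p)"
    by (intro differentiable_upto_bounded_linear o bounded_linear_fst bounded_linear_snd bounded_linear_minus)+
  have Dk: "differentiable_upto n (UNIV \<times> U) (\<lambda>p. Dflow (fst p) (snd p) (k p))"
    if "differentiable_upto n (UNIV \<times> U) k" for k
    by (rule differentiable_upto_apply[OF o linear_Dflow D that])
  have X: "differentiable_upto n (UNIV \<times> U) (\<lambda>p. X (\<Phi> (fst p) (snd p)))"
    by (rule differentiable_upto_compose[OF o F _ FV]) (use smooth_X in \<open>simp add: smooth_on_def\<close>)
  have DXc: "differentiable_upto n (UNIV \<times> U) (\<lambda>p. DX (\<Phi> (fst p) (snd p)) (k p))"
    if "differentiable_upto n (UNIV \<times> U) k" for k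
    by (rule differentiable_upto_apply[OF o linear_DX _ that])
      (use FV in \<open>auto intro: differentiable_upto_compose[OF o F differentiable_upto_DX]\<close>)
  have D2c: "differentiable_upto n (UNIV \<times> U) (\<lambda>p. D2X b (\<Phi> (fst p) (snd p)) (k p))"
    if "differentiable_upto n (UNIV \<times> U) k" for k b
    by (rule differentiable_upto_apply[OF o D2.linear_deriv _ that])
      (use FV in \<open>auto intro: differentiable_upto_compose[OF o F differentiable_upto_D2X]\<close>)
  have Di: "differentiable_upto n (UNIV \<times> U) (\<lambda>p. Dflow (- fst p) (\<Phi> (fst p) (snd p)) b)" for b
    using differentiable_upto_compose[OF o differentiable_upto_Pair[OF o f(3) F] D] flow_in
    by (auto simp: image_subset_iff)
  have S: "differentiable_upto n (UNIV \<times> U) (\<lambda>p. second_transport (snd p) b (fst p) (snd p) k)" for b k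
    unfolding second_transport_def Duhamel_def Dflow_def[symmetric]
    by (intro Dk differentiable_upto_primitive[OF open_U] differentiable_upto_apply[OF o linear_Dflow Di])
      (unfold second_mean_def D2.mean_diagonal,
        intro differentiable_upto_sum differentiable_upto_scaleR differentiable_upto_inner
          differentiable_upto_const o D D2c)
  have lS: "linear (second_transport (snd p) b (fst p) (snd p))" if "p \<in> UNIV \<times> U" for p b
    using that by (intro linear_second_transport) auto
  have "differentiable_upto (Suc n) (UNIV \<times> U) (\<lambda>p. \<Phi> (fst p) (snd p))"
    by (rule differentiable_upto_SucI[OF o, where f'="\<lambda>p h. fst h *\<^sub>R X (\<Phi> (fst p) (snd p)) + Dflow (fst p) (snd p) (snd h)"])
      (use flow_has_derivative in force, intro differentiable_upto_add differentiable_upto_scaleR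
        differentiable_upto_const o X D)
  moreover have "differentiable_upto (Suc n) (UNIV \<times> U) (\<lambda>p. Dflow (fst p) (snd p) b)" for b
    by (rule differentiable_upto_SucI[OF o, where f'="\<lambda>p h. fst h *\<^sub>R DX (\<Phi> (fst p) (snd p)) (Dflow (fst p) (snd p) b)
        + second_transport (snd p) b (fst p) (snd p) (snd h)"])
      (use Dflow_has_derivative in force, intro differentiable_upto_add differentiable_upto_scaleR
        differentiable_upto_const o DXc D S)
  ultimately show ?case by blast
qed

theorem smooth_flow: "smooth_on (UNIV \<times> U) (\<lambda>p. \<Phi> (fst p) (snd p))"
  using differentiable_upto_flow by (simp add: smooth_on_def)

end

section \<open>Liouville's theorem\<close>

text \<open>A permutation other than the identity moves at least two indices, so that its term in the
  Leibniz formula vanishes to second order at the identity matrix.\<close>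

lemma DERIV_det_at_identity:
  fixes A :: "real \<Rightarrow> real^'n^'n"
  assumes "\<And>i j. ((\<lambda>t. A t $ i $ j) has_real_derivative B $ i $ j) (at t0)" "A t0 = mat 1"
  shows "((\<lambda>t. det (A t)) has_real_derivative trace B) (at t0)"
proof -
  let ?P = "{p. p permutes (UNIV :: 'n set)}"
  define S where "S p = (\<Sum>i\<in>UNIV. B $ i $ p i * (\<Prod>j\<in>UNIV - {i}. A t0 $ j $ p j))" for p
  have "((\<lambda>t. det (A t)) has_real_derivative (\<Sum>p\<in>?P. of_int (sign p) * S p)) (at t0)"
    unfolding det_def S_def
    by (intro DERIV_sum DERIV_cmult has_field_derivative_prod assms(1))
  also have "(\<Sum>p\<in>?P. of_int (sign p) * S p) = (\<Sum>p\<in>?P. if p = id then trace B else 0)"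
  proof (rule sum.cong[OF refl])
    fix p assume "p \<in> ?P"
    then have p: "p permutes (UNIV :: 'n set)" by simp
    show "of_int (sign p) * S p = (if p = id then trace B else 0)"
    proof (cases "p = id")
      case True
      then show ?thesis by (simp add: S_def assms(2) mat_def trace_def sign_id)
    next
      case False
      then obtain k where k: "p k \<noteq> k" by (auto simp: fun_eq_iff)
      have k': "p (p k) \<noteq> p k" using permutes_inj[OF p] k by (auto dest: injD)
      have "(\<Prod>j\<in>UNIV - {i}. A t0 $ j $ p j) = 0" for i
      proof -
        obtain j where "j \<noteq> i" "p j \<noteq> j" using k k' by metis
        then show ?thesis by (intro prod_zero) (auto simp: assms(2) mat_def intro!: bexI[of _ j])
      qed
      then show ?thesis using False by (simp add: S_def del: prod_zero_iff)
    qed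
  qed
  also have "\<dots> = trace B"
    using permutes_id[of "UNIV :: 'n set"] by (simp add: finite_permutations)
  finally show ?thesis .
qed

text \<open>The transformation formula is a statement about integrable functions. If \<open>\<rho>\<close> is not integrable
  over \<open>A\<close>, then it is not integrable over \<open>g ` A\<close> either, and both measures are infinite.\<close>

lemma emeasure_image_with_density:
  fixes g :: "real^'n::{finite,wellorder} \<Rightarrow> real^'n::_" and \<rho> :: "real^'n::_ \<Rightarrow> real"
  assumes U: "open U" and \<rho>: "continuous_on U \<rho>" "\<And>z. z \<in> U \<Longrightarrow> \<rho> z > 0"
    and A: "A \<in> sets borel" "A \<subseteq> U" "g ` A \<in> sets borel" "g ` A \<subseteq> U" "inj_on g A"
    and g': "\<And>z. z \<in> A \<Longrightarrow> (g has_derivative g' z) (at z)"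
    and jac: "\<And>z. z \<in> A \<Longrightarrow> \<bar>det (matrix (g' z))\<bar> * \<rho> (g z) = \<rho> z"
  shows "emeasure (measure_with_density U \<rho>) (g ` A) = emeasure (measure_with_density U \<rho>) A"
proof -
  have Um: "U \<in> sets borel" using U by simp
  have meas: "(\<lambda>z. ennreal (\<rho> z) * indicator U z) \<in> borel_measurable borel"
  proof -
    have "(\<lambda>z. indicator U z *\<^sub>R \<rho> z) \<in> borel_measurable borel"
      by (rule borel_measurable_continuous_on_indicator[OF Um \<rho>(1)])
    then have "(\<lambda>z. ennreal (indicator U z *\<^sub>R \<rho> z)) \<in> borel_measurable borel" by simp
    also have "(\<lambda>z. ennreal (indicator U z *\<^sub>R \<rho> z)) = (\<lambda>z. ennreal (\<rho> z) * indicator U z)"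
      by (auto simp: fun_eq_iff indicator_def)
    finally show ?thesis .
  qed
  have em: "emeasure (measure_with_density U \<rho>) S = (\<integral>\<^sup>+z. ennreal (\<rho> z) * indicator S z \<partial>lborel)"
    if "S \<in> sets borel" "S \<subseteq> U" for S
  proof -
    have "emeasure (measure_with_density U \<rho>) S
        = (\<integral>\<^sup>+z. ennreal (\<rho> z) * indicator U z * indicator S z \<partial>lborel)"
      unfolding measure_with_density_def by (rule emeasure_density) (use meas that in auto)
    also have "\<dots> = (\<integral>\<^sup>+z. ennreal (\<rho> z) * indicator S z \<partial>lborel)"
      using that(2) by (intro nn_integral_cong) (auto simp: indicator_def)
    finally show ?thesis .
  qed
  have fin: "\<rho> integrable_on S"
    if S: "S \<in> sets borel" "S \<subseteq> U" and "emeasure (measure_with_density U \<rho>) S < \<infinity>" for S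
  proof -
    have c: "(\<lambda>z. indicator S z *\<^sub>R \<rho> z) \<in> borel_measurable borel"
      by (rule borel_measurable_continuous_on_indicator[OF S(1) continuous_on_subset[OF \<rho>(1) S(2)]])
    have nonneg: "0 \<le> indicator S z *\<^sub>R \<rho> z" for z using \<rho>(2) S(2) by (auto simp: indicator_def less_imp_le)
    have "(\<integral>\<^sup>+z. ennreal (indicator S z *\<^sub>R \<rho> z) \<partial>lborel) < \<infinity>"
      using that(3) unfolding em[OF S]
      by (rule back_subst[where P="\<lambda>x. x < \<infinity>"]) (auto intro!: nn_integral_cong simp: indicator_def)
    then obtain r where r: "(\<integral>\<^sup>+z. ennreal (indicator S z *\<^sub>R \<rho> z) \<partial>lborel) = ennreal r" "r \<ge> 0"
      by (metis ennreal_cases infinity_ennreal_def order_less_irrefl)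
    have "((\<lambda>z. indicator S z *\<^sub>R \<rho> z) has_integral r) UNIV"
      by (rule nn_integral_has_integral[OF c nonneg r])
    then have "((\<lambda>z. if z \<in> S then \<rho> z else 0) has_integral r) UNIV"
      by (rule has_integral_eq[rotated]) (auto simp: indicator_def)
    then show ?thesis by (auto simp: has_integral_restrict_UNIV)
  qed
  have int: "emeasure (measure_with_density U \<rho>) S = ennreal I"
    if "S \<in> sets borel" "S \<subseteq> U" "(\<rho> has_integral I) S" for S I
    unfolding em[OF that(1,2)]
    by (rule nn_integral_has_integral_lebesgue') (use that \<rho> in \<open>auto intro: less_imp_le\<close>)
  have bl: "bounded_linear (vec :: real \<Rightarrow> real^1)" "bounded_linear (\<lambda>x :: real^1. x $ 1)"
    by (auto intro!: linear_conv_bounded_linear[THEN iffD1] linearI simp: vec_eq_iff)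
  have ai: "(\<lambda>z. vec (\<rho> z) :: real^1) absolutely_integrable_on S \<and> integral S (\<lambda>z. vec (\<rho> z) :: real^1) = vec I
      \<longleftrightarrow> (\<rho> has_integral I) S" if "S \<subseteq> U" for S I
  proof
    assume l: "(\<lambda>z. vec (\<rho> z) :: real^1) absolutely_integrable_on S \<and> integral S (\<lambda>z. vec (\<rho> z) :: real^1) = vec I"
    then have "((\<lambda>z. vec (\<rho> z) :: real^1) has_integral vec I) S"
      using set_lebesgue_integral_eq_integral(1) integrable_integral by metis
    from has_integral_linear[OF this bl(2)] show "(\<rho> has_integral I) S" by (simp add: o_def)
  next
    assume r: "(\<rho> has_integral I) S"
    then have "\<rho> absolutely_integrable_on S"
      using absolutely_integrable_on_iff_nonneg[of S \<rho>] \<rho>(2) that by (metis has_integral_integrable less_imp_le subsetD)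
    from absolutely_integrable_linear[OF this bl(1)] integral_unique[OF has_integral_linear[OF r bl(1)]]
    show "(\<lambda>z. vec (\<rho> z) :: real^1) absolutely_integrable_on S \<and> integral S (\<lambda>z. vec (\<rho> z) :: real^1) = vec I"
      by (simp add: o_def)
  qed
  have change: "(\<rho> has_integral I) A \<longleftrightarrow> (\<rho> has_integral I) (g ` A)" for I
  proof -
    have eq: "\<bar>det (matrix (g' x))\<bar> *\<^sub>R (vec (\<rho> (g x)) :: real^1) = vec (\<rho> x)" if "x \<in> A" for x
      using jac[OF that] by (simp add: vec_eq_iff)
    have "(\<lambda>x. \<bar>det (matrix (g' x))\<bar> *\<^sub>R (vec (\<rho> (g x)) :: real^1)) absolutely_integrable_on A \<and>
        integral A (\<lambda>x. \<bar>det (matrix (g' x))\<bar> *\<^sub>R (vec (\<rho> (g x)) :: real^1)) = vec I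
      \<longleftrightarrow> (\<lambda>z. vec (\<rho> z) :: real^1) absolutely_integrable_on (g ` A) \<and> integral (g ` A) (\<lambda>z. vec (\<rho> z) :: real^1) = vec I"
      by (rule has_absolute_integral_change_of_variables)
        (use A g' in \<open>auto intro: has_derivative_at_withinI\<close>)
    moreover have "(\<lambda>x. \<bar>det (matrix (g' x))\<bar> *\<^sub>R (vec (\<rho> (g x)) :: real^1)) absolutely_integrable_on A
        \<longleftrightarrow> (\<lambda>z. vec (\<rho> z) :: real^1) absolutely_integrable_on A"
      by (rule set_integrable_cong) (auto simp: eq)
    moreover have "integral A (\<lambda>x. \<bar>det (matrix (g' x))\<bar> *\<^sub>R (vec (\<rho> (g x)) :: real^1)) = integral A (\<lambda>z. vec (\<rho> z))"
      by (rule integral_cong) (rule eq)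
    ultimately show ?thesis using ai[OF A(2), of I] ai[OF A(4), of I] by simp
  qed
  show ?thesis
  proof (cases "\<rho> integrable_on A")
    case True
    then obtain I where I: "(\<rho> has_integral I) A" by blast
    then show ?thesis using change int A by metis
  next
    case False
    then have "\<not> \<rho> integrable_on g ` A" using change by (meson has_integral_integrable integrable_on_def)
    then show ?thesis using False fin[OF A(1,2)] fin[OF A(3,4)] by (metis infinity_ennreal_def less_top)
  qed
qed

locale invariant_flow_vec = invariant_flow X V U \<Phi> L
  for X :: "real^'n::{finite,wellorder} \<Rightarrow> real^'n::_" and V U \<Phi> L
begin

text \<open>By the cocycle property it suffices to differentiate at time zero, where the differential of the
  flow is the identity.\<close>

lemma DERIV_det_Dflow:
  assumes z: "z \<in> U"
  shows "((\<lambda>t. det (matrix (Dflow t z))) has_real_derivative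
    trace (matrix (DX (\<Phi> t z))) * det (matrix (Dflow t z))) (at t)"
proof -
  let ?w = "\<Phi> t z"
  have w: "?w \<in> U" by (rule flow_in[OF z])
  have "((\<lambda>s. det (matrix (Dflow s ?w))) has_real_derivative trace (matrix (DX ?w))) (at 0)"
  proof (rule DERIV_det_at_identity)
    have "((\<lambda>s. Dflow s ?w (axis j 1) $ i) has_vector_derivative DX (\<Phi> 0 ?w) (Dflow 0 ?w (axis j 1)) $ i) (at 0)" for i j
      by (rule bounded_linear.has_vector_derivative[OF bounded_linear_vec_nth Dflow_deriv[OF w]])
    then show "((\<lambda>s. matrix (Dflow s ?w) $ i $ j) has_real_derivative matrix (DX ?w) $ i $ j) (at 0)" for i j
      by (simp add: matrix_def Dflow_0 flow_0 w has_real_derivative_iff_has_vector_derivative)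
    have "Dflow 0 ?w = id" by (auto simp: Dflow_0 w)
    then show "matrix (Dflow 0 ?w) = mat 1" by (simp add: matrix_id_mat_1)
  qed
  from DERIV_mult[OF this DERIV_const[of "det (matrix (Dflow t z))"]]
  have "((\<lambda>s. det (matrix (Dflow s ?w)) * det (matrix (Dflow t z))) has_real_derivative
      trace (matrix (DX ?w)) * det (matrix (Dflow t z))) (at 0)" by simp
  moreover have "det (matrix (Dflow s ?w)) * det (matrix (Dflow t z)) = det (matrix (Dflow (s + t) z))" for s
  proof -
    have "Dflow (s + t) z = Dflow s ?w \<circ> Dflow t z" by (auto simp: Dflow_add[OF z])
    then show ?thesis by (simp add: matrix_compose[OF linear_Dflow linear_Dflow] det_mul)
  qed
  ultimately have "((\<lambda>s. det (matrix (Dflow (s + t) z))) has_real_derivative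
      trace (matrix (DX ?w)) * det (matrix (Dflow t z))) (at 0)" by simp
  then show ?thesis by (subst (asm) DERIV_shift[symmetric]) simp
qed

text \<open>The condition says that the divergence of \<open>\<rho> X\<close> vanishes. It makes the product of \<open>\<rho>\<close> and the
  Jacobian determinant of the flow constant along trajectories.\<close>

theorem Liouville:
  assumes \<rho>: "smooth_on U \<rho>" "\<And>z. z \<in> U \<Longrightarrow> \<rho> z > 0"
    and div: "\<And>z. z \<in> U \<Longrightarrow> frechet_derivative \<rho> (at z) (X z) + \<rho> z * trace (matrix (DX z)) = 0"
  shows "smooth_invariant_measure X U \<rho>"
proof -
  have \<rho>': "(\<rho> has_derivative frechet_derivative \<rho> (at z)) (at z)" if "z \<in> U" for z
    using differentiable_upto_SucD(1)[of 0 U \<rho>, OF _ that] \<rho>(1) unfolding smooth_on_def by blast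
  have cont: "continuous_on U \<rho>"
    using \<rho>(1) unfolding smooth_on_def by (intro differentiable_upto_imp_continuous[of 0]) blast
  have jac: "\<bar>det (matrix (Dflow t z))\<bar> * \<rho> (\<Phi> t z) = \<rho> z" if z: "z \<in> U" for z t
  proof -
    let ?J = "\<lambda>t. \<rho> (\<Phi> t z) * det (matrix (Dflow t z))"
    have "(?J has_real_derivative 0) (at t)" for t
    proof -
      note w = flow_in[OF z, of t]
      have "((\<lambda>t. \<Phi> t z) has_derivative (\<lambda>h. h *\<^sub>R X (\<Phi> t z))) (at t)"
        using flow_deriv[OF z] by (simp add: has_vector_derivative_def)
      from has_derivative_compose[OF this \<rho>'[OF w]]
      have "((\<lambda>t. \<rho> (\<Phi> t z)) has_real_derivative frechet_derivative \<rho> (at (\<Phi> t z)) (X (\<Phi> t z))) (at t)"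
        by (simp add: has_field_derivative_def linear_cmul[OF has_derivative_linear[OF \<rho>'[OF w]]] mult_commute_abs)
      from DERIV_mult[OF this DERIV_det_Dflow[OF z]]
      have "(?J has_real_derivative
          (frechet_derivative \<rho> (at (\<Phi> t z)) (X (\<Phi> t z)) + \<rho> (\<Phi> t z) * trace (matrix (DX (\<Phi> t z))))
            * det (matrix (Dflow t z))) (at t)"
        by (simp add: algebra_simps)
      then show ?thesis by (simp add: div[OF w])
    qed
    then have "?J t = ?J 0" by (intro DERIV_isconst_all[of ?J] allI)
    moreover have "Dflow 0 z = id" by (auto simp: Dflow_0 z)
    ultimately have J: "\<rho> (\<Phi> t z) * det (matrix (Dflow t z)) = \<rho> z"
      by (simp add: flow_0 z matrix_id_mat_1)
    then have "det (matrix (Dflow t z)) > 0"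
      using \<rho>(2)[OF z] \<rho>(2)[OF flow_in[OF z, of t]] zero_less_mult_pos by metis
    then show ?thesis using J by (simp add: mult.commute)
  qed
  show ?thesis unfolding smooth_invariant_measure_def
  proof (intro conjI allI impI \<rho>(1) ballI \<rho>(2))
    fix A T \<gamma>
    assume A: "A \<in> sets borel" "A \<subseteq> U" and T: "T \<ge> 0"
      and \<gamma>: "\<forall>z\<in>A. trajectory X U {0..T} (\<gamma> z) \<and> \<gamma> z 0 = z"
    have "\<gamma> z T = \<Phi> T z" if "z \<in> A" for z
      using trajectory_eq_flow[of T "\<gamma> z"] \<gamma> that A T by auto
    then have im: "(\<lambda>z. \<gamma> z T) ` A = \<Phi> T ` A" by (intro image_cong) auto
    have c: "continuous_on U (\<Phi> (- T))"
      by (rule continuous_on_compose2[OF continuous_on_flow, where f="\<lambda>z. (- T, z)", simplified])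
        (auto intro!: continuous_intros)
    have pre: "\<Phi> T ` A = \<Phi> (- T) -` A \<inter> U"
    proof
      show "\<Phi> T ` A \<subseteq> \<Phi> (- T) -` A \<inter> U" using A flow_in flow_inverse by auto
      have "z \<in> \<Phi> T ` A" if z: "z \<in> U" "\<Phi> (- T) z \<in> A" for z
        using flow_inverse(2)[OF z(1), of T] z(2) by (metis imageI)
      then show "\<Phi> (- T) -` A \<inter> U \<subseteq> \<Phi> T ` A" by auto
    qed
    have "\<Phi> T ` A \<in> sets borel"
      unfolding pre using measurable_sets[OF borel_measurable_continuous_on_restrict[OF c] A(1)] open_U
      by (simp add: space_restrict_space sets_restrict_space_iff)
    moreover have "inj_on (\<Phi> T) A"      by (rule inj_on_inverseI[where g="\<Phi> (- T)"]) (use A flow_inverse(1) in blast)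
    moreover have "(\<Phi> T has_derivative Dflow T z) (at z)" if "z \<in> A" for z
    proof -
      have z: "z \<in> U" using that A by auto
      have "((\<lambda>z. (T, z)) has_derivative (\<lambda>h. (0, h))) (at z)" by (intro derivative_intros)
      from has_derivative_compose[OF this, of "\<lambda>p. \<Phi> (fst p) (snd p)", OF flow_has_derivative[OF z]]
      show ?thesis by simp
    qed
    moreover have "\<Phi> T ` A \<subseteq> U" using A flow_in by auto
    ultimately show "emeasure (measure_with_density U \<rho>) ((\<lambda>z. \<gamma> z T) ` A) = emeasure (measure_with_density U \<rho>) A"
      unfolding im using A jac \<rho>(2)
      by (intro emeasure_image_with_density[OF open_U cont, where g'="Dflow T"]) auto
  qed
qed

end

section \<open>Reversible equations with periodic coefficients\<close>

lemma bounded_derivative_on_compact: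
  fixes D :: "'x::topological_space \<Rightarrow> 'a::euclidean_space \<Rightarrow> 'b::real_normed_vector"
  assumes "compact K" "\<And>q. q \<in> K \<Longrightarrow> linear (D q)" "\<And>k. continuous_on K (\<lambda>q. D q k)"
  obtains L where "L \<ge> 0" "\<And>q k. q \<in> K \<Longrightarrow> norm (D q k) \<le> L * norm k"
proof -
  have "\<exists>C. \<forall>q\<in>K. norm (D q b) \<le> C" for b
    using compact_imp_bounded[OF compact_continuous_image[OF assms(3,1)]] by (auto simp: bounded_iff)
  then obtain C where C: "\<And>b q. q \<in> K \<Longrightarrow> norm (D q b) \<le> C b" by metis
  define L where "L = (\<Sum>b\<in>Basis. \<bar>C b\<bar>)"
  show thesis
  proof (rule that[of L])
    show "L \<ge> 0" by (auto simp: L_def intro: sum_nonneg)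
    fix q k assume q: "q \<in> K"
    have "norm (D q k) \<le> (\<Sum>b\<in>Basis. norm ((k \<bullet> b) *\<^sub>R D q b))"
      unfolding linear_eq_sum_Basis[OF assms(2)[OF q], of k] by (rule norm_sum)
    also have "\<dots> \<le> (\<Sum>b\<in>Basis. norm k * \<bar>C b\<bar>)"
    proof (rule sum_mono)
      fix b :: 'a assume "b \<in> Basis"
      then show "norm ((k \<bullet> b) *\<^sub>R D q b) \<le> norm k * \<bar>C b\<bar>"
        unfolding norm_scaleR using C[OF q, of b]
        by (intro mult_mono) (auto simp: Basis_le_norm)
    qed
    finally show "norm (D q k) \<le> L * norm k" by (simp add: L_def sum_distrib_left mult.commute)
  qed
qed

text \<open>If \<open>N\<close> is odd and \<open>2\<pi>\<close>-periodic in the angle, then every solution of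
  \<open>dw/d\<theta> = N \<theta> w\<close> that exists on \<open>[-\<pi>, \<pi>]\<close> is even, therefore takes
  the same value at \<open>-\<pi>\<close> and \<open>\<pi>\<close>, and therefore is periodic. The bound \<open>\<beta>\<close> keeps
  the solutions that start near the centre of the box inside the box during half a turn.\<close>

locale reversible_ODE =
  fixes N :: "real \<Rightarrow> 'a::euclidean_space \<Rightarrow> 'a" and G :: "(real \<times> 'a) set" and c h \<beta> :: 'a
  assumes open_G: "open G" and box_in_G: "UNIV \<times> cbox (c - h) (c + h) \<subseteq> G"
    and smooth_N: "smooth_on G (\<lambda>q. N (fst q) (snd q))"
    and odd_N: "\<And>\<theta> w. N (- \<theta>) w = - N \<theta> w"
    and periodic_N: "\<And>\<theta> w. N (\<theta> + 2 * pi) w = N \<theta> w"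
    and bounded_N: "\<And>\<theta> w i. w \<in> cbox (c - h) (c + h) \<Longrightarrow> i \<in> Basis \<Longrightarrow> \<bar>N \<theta> w \<bullet> i\<bar> \<le> \<beta> \<bullet> i"
    and \<beta>_nonneg: "\<And>i. i \<in> Basis \<Longrightarrow> 0 \<le> \<beta> \<bullet> i"
    and small: "\<And>i. i \<in> Basis \<Longrightarrow> pi * (\<beta> \<bullet> i) < h \<bullet> i"
begin

abbreviation B :: "'a set" where "B \<equiv> cbox (c - h) (c + h)"
abbreviation DN :: "real \<times> 'a \<Rightarrow> real \<times> 'a \<Rightarrow> 'a" where
  "DN q \<equiv> frechet_derivative (\<lambda>q. N (fst q) (snd q)) (at q)"
abbreviation cut :: "'a \<Rightarrow> 'a" where "cut \<equiv> clamp (c - h) (c + h)"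

lemma periodic_N_int: "N (\<theta> + 2 * pi * of_int n) w = N \<theta> w"
proof (induction n rule: int_induct[where k=0])
  case (step1 i)
  then show ?case using periodic_N[of "\<theta> + 2 * pi * of_int i" w] by (simp add: algebra_simps)
next
  case (step2 i)
  then show ?case using periodic_N[of "\<theta> + 2 * pi * of_int (i - 1)" w] by (simp add: algebra_simps)
qed simp

lemma h_pos: "i \<in> Basis \<Longrightarrow> 0 < h \<bullet> i"
  using small[of i] \<beta>_nonneg[of i] mult_nonneg_nonneg[of pi "\<beta> \<bullet> i"] pi_ge_zero by linarith

lemma cut_in_B: "cut w \<in> B"
  by (rule clamp_in_interval) (use h_pos in \<open>force simp: inner_diff_left inner_add_left\<close>)

lemma continuous_on_cut: "continuous_on S cut"
  by (rule clamp_continuous_on[where f="\<lambda>x. x", OF continuous_on_id])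

lemma DN: "q \<in> G \<Longrightarrow> ((\<lambda>q. N (fst q) (snd q)) has_derivative DN q) (at q)"
  using differentiable_upto_SucD(1)[of 0 G] smooth_N unfolding smooth_on_def by blast

lemma reduce_angle: obtains n :: int where "\<theta> - 2 * pi * of_int n \<in> {-pi..pi}"
proof (rule that[of "\<lfloor>(\<theta> + pi) / (2 * pi)\<rfloor>"])
  let ?n = "real_of_int \<lfloor>(\<theta> + pi) / (2 * pi)\<rfloor>"
  have "?n \<le> (\<theta> + pi) / (2 * pi)" "(\<theta> + pi) / (2 * pi) \<le> ?n + 1"
    by linarith+
  then have "?n * (2 * pi) \<le> \<theta> + pi" "\<theta> + pi \<le> (?n + 1) * (2 * pi)"
    by (simp_all only: pos_le_divide_eq pos_divide_le_eq pi_gt_zero zero_less_mult_iff zero_less_numeral simp_thms)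
  then show "\<theta> - 2 * pi * ?n \<in> {-pi..pi}"
    by (simp add: algebra_simps)
qed

lemma Lipschitz_constant:
  obtains L where "L \<ge> 0" "\<And>\<theta> w k. w \<in> B \<Longrightarrow> norm (DN (\<theta>, w) k) \<le> L * norm k"
proof -
  have sub: "{-pi..pi} \<times> B \<subseteq> G" using box_in_G by auto
  obtain L where L: "L \<ge> 0" "\<And>q k. q \<in> {-pi..pi} \<times> B \<Longrightarrow> norm (DN q k) \<le> L * norm k"
  proof (rule bounded_derivative_on_compact[of "{-pi..pi} \<times> B" DN])
    show "linear (DN q)" if "q \<in> {-pi..pi} \<times> B" for q
      using DN that sub by (blast intro: has_derivative_linear)
    have "differentiable_upto 0 G (\<lambda>q. DN q k)" for k
      by (rule differentiable_upto_SucD(2)) (use smooth_N in \<open>simp only: smooth_on_def\<close>)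
    then show "continuous_on ({-pi..pi} \<times> B) (\<lambda>q. DN q k)" for k
      by (intro continuous_on_subset[OF _ sub]) simp
  qed (auto intro: compact_Times)
  show thesis
  proof (rule that[OF L(1)])
    fix \<theta> w k assume w: "w \<in> B"
    obtain n where n: "\<theta> - 2 * pi * of_int n \<in> {-pi..pi}" by (rule reduce_angle)
    have "((\<lambda>q. (fst q - 2 * pi * of_int n, snd q)) has_derivative (\<lambda>k. k)) (at (\<theta>, w))"
      by (auto intro!: derivative_eq_intros)
    from has_derivative_compose[OF this, of "\<lambda>q. N (fst q) (snd q)", OF DN]
    have "((\<lambda>q. N (fst q - 2 * pi * of_int n) (snd q)) has_derivative DN (\<theta> - 2 * pi * of_int n, w)) (at (\<theta>, w))"
      using subsetD[OF sub, of "(\<theta> - 2 * pi * of_int n, w)"] n w by simp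
    moreover have "N (\<theta> - 2 * pi * of_int n) w = N \<theta> w" for \<theta> w
      using periodic_N_int[of \<theta> "- n" w] by simp
    ultimately have "((\<lambda>q. N (fst q) (snd q)) has_derivative DN (\<theta> - 2 * pi * of_int n, w)) (at (\<theta>, w))"
      by simp
    then have "DN (\<theta>, w) = DN (\<theta> - 2 * pi * of_int n, w)"
      by (rule frechet_derivative_at[symmetric])
    then show "norm (DN (\<theta>, w) k) \<le> L * norm k" using L(2)[of "(\<theta> - 2 * pi * of_int n, w)"] n w by simp
  qed
qed

text \<open>The equation is extended beyond the box by its values at the nearest points of the box.\<close>

lemma Lipschitz_cut:
  obtains L where "L \<ge> 0" "\<And>\<theta> u v. norm (N \<theta> (cut u) - N \<theta> (cut v)) \<le> L * norm (u - v)"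
proof -
  obtain L where L: "L \<ge> 0" "\<And>\<theta> w k. w \<in> B \<Longrightarrow> norm (DN (\<theta>, w) k) \<le> L * norm k"
    by (rule Lipschitz_constant) blast
  show thesis
  proof (rule that[OF L(1)])
    fix \<theta> u v
    have "norm (N \<theta> (cut u) - N \<theta> (cut v)) \<le> L * norm (cut u - cut v)"
    proof (rule differentiable_bound[where S=B and f'="\<lambda>w k. DN (\<theta>, w) (0, k)"])
      fix w assume w: "w \<in> B"
      have "((\<lambda>w. (\<theta>, w)) has_derivative (\<lambda>k. (0, k))) (at w within B)"
        by (auto intro!: derivative_eq_intros)
      from has_derivative_compose[OF this DN] show "(N \<theta> has_derivative (\<lambda>k. DN (\<theta>, w) (0, k))) (at w within B)"
        using w box_in_G by auto
      show "onorm (\<lambda>k. DN (\<theta>, w) (0, k)) \<le> L"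
        by (rule onorm_bound[OF L(1)]) (use L(2)[OF w, of \<theta> "(0, _)"] in simp)
    qed (auto intro: cut_in_B)
    also have "norm (cut u - cut v) \<le> norm (u - v)"
      using dist_clamps_le_dist_args[of "c - h" "c + h" u v] by (simp add: dist_norm)
    finally show "norm (N \<theta> (cut u) - N \<theta> (cut v)) \<le> L * norm (u - v)"
      using L(1) by (simp add: mult_left_mono)
  qed
qed

text \<open>The solution at the angle \<open>\<theta> + s\<close> with value \<open>w\<close> at the angle \<open>\<theta>\<close>.\<close>

definition sol :: "real \<Rightarrow> real \<Rightarrow> 'a \<Rightarrow> 'a" where
  "sol = (SOME u. (\<forall>\<theta> w. u 0 \<theta> w = w) \<and>
    (\<forall>s \<theta> w. ((\<lambda>s. u s \<theta> w) has_vector_derivative N (\<theta> + s) (cut (u s \<theta> w))) (at s)) \<and>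
    continuous_on UNIV (\<lambda>p. u (fst p) (fst (snd p)) (snd (snd p))))"

lemma sol:
  shows sol_0: "sol 0 \<theta> w = w"
    and sol_deriv: "((\<lambda>s. sol s \<theta> w) has_vector_derivative N (\<theta> + s) (cut (sol s \<theta> w))) (at s)"
    and continuous_on_sol: "continuous_on UNIV (\<lambda>p. sol (fst p) (fst (snd p)) (snd (snd p)))"
proof -
  obtain L where L: "L \<ge> 0" "\<And>\<theta> u v. norm (N \<theta> (cut u) - N \<theta> (cut v)) \<le> L * norm (u - v)"
    by (rule Lipschitz_cut) blast
  have cG: "continuous_on G (\<lambda>q. N (fst q) (snd q))"
    using smooth_N unfolding smooth_on_def by (intro differentiable_upto_imp_continuous[of 0]) blast
  obtain u where u: "continuous_on (UNIV \<times> UNIV) (\<lambda>(s, x). u s x)" "\<And>x. u 0 x = snd x"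
    "\<And>x s. ((\<lambda>s. u s x) has_vector_derivative N (fst x + s) (cut (u s x))) (at s)"
  proof (rule Picard_with_parameter[of UNIV "\<lambda>s x u. N (fst x + s) (cut u)" L snd "\<Sum>i\<in>Basis. \<beta> \<bullet> i"])
    have "continuous_on UNIV (\<lambda>p::real \<times> (real \<times> 'a) \<times> 'a. cut (snd (snd p)))"
      by (rule continuous_on_compose2[OF continuous_on_cut[of UNIV]]) (auto intro!: continuous_intros)
    then have "continuous_on UNIV (\<lambda>p::real \<times> (real \<times> 'a) \<times> 'a. (fst (fst (snd p)) + fst p, cut (snd (snd p))))"
      by (intro continuous_on_Pair) (auto intro!: continuous_intros)
    from continuous_on_compose2[OF cG this]
    show "continuous_on (UNIV \<times> UNIV \<times> UNIV) (\<lambda>(s, x::real \<times> 'a, u). N (fst x + s) (cut u))"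
      using box_in_G cut_in_B by (auto simp: split_beta)
    show "norm (N (fst x + s) (cut u) - N (fst x + s) (cut v)) \<le> L * norm (u - v)" for s and x :: "real \<times> 'a" and u v
      by (rule L)
    show "norm (N (fst x + s) (cut (snd x))) \<le> (\<Sum>i\<in>Basis. \<beta> \<bullet> i)" for s and x :: "real \<times> 'a"
      by (rule order_trans[OF norm_le_l1]) (intro sum_mono bounded_N cut_in_B)
  qed (auto intro: L continuous_intros)
  have "\<exists>u. (\<forall>\<theta> w. u 0 \<theta> w = w) \<and>
    (\<forall>s \<theta> w. ((\<lambda>s. u s \<theta> w) has_vector_derivative N (\<theta> + s) (cut (u s \<theta> w))) (at s)) \<and>
    continuous_on UNIV (\<lambda>p. u (fst p) (fst (snd p)) (snd (snd p)))"
    using u(1) u(2) u(3)[of "(_, _)"] by (intro exI[of _ "\<lambda>s \<theta> w. u s (\<theta>, w)"]) (simp add: split_beta)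
  note * = someI_ex[OF this, folded sol_def]
  show "sol 0 \<theta> w = w" using * by blast
  show "((\<lambda>s. sol s \<theta> w) has_vector_derivative N (\<theta> + s) (cut (sol s \<theta> w))) (at s)" using * by blast
  show "continuous_on UNIV (\<lambda>p. sol (fst p) (fst (snd p)) (snd (snd p)))" using * by blast
qed

lemma sol_unique:
  assumes "\<And>s. (u has_vector_derivative N (\<theta> + s) (cut (u s))) (at s)" "u a = sol a \<theta> w"
  shows "u s = sol s \<theta> w"
proof -
  obtain L where L: "L \<ge> 0" "\<And>\<theta> u v. norm (N \<theta> (cut u) - N \<theta> (cut v)) \<le> L * norm (u - v)"
    by (rule Lipschitz_cut) blast
  show ?thesis
    by (rule ODE_unique[where N="\<lambda>s u. N (\<theta> + s) (cut u)" and L=L and a=a])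
      (rule assms sol_deriv L)+
qed

lemma shift_deriv: "((\<lambda>s. s + (t::real)) has_vector_derivative 1) (at s)"
  by (auto intro!: derivative_eq_intros simp: has_vector_derivative_def)

lemma sol_add: "sol (s + t) \<theta> w = sol s (\<theta> + t) (sol t \<theta> w)"
proof (rule sol_unique[of "\<lambda>s. sol (s + t) \<theta> w" "\<theta> + t" 0])
  show "((\<lambda>s. sol (s + t) \<theta> w) has_vector_derivative N (\<theta> + t + s) (cut (sol (s + t) \<theta> w))) (at s)" for s
    using vector_diff_chain_at[OF shift_deriv[of t s] sol_deriv[of \<theta> w "s + t"]] by (simp add: o_def add_ac)
qed (simp add: sol_0)

lemma sol_even: "sol (- s) 0 w = sol s 0 w"
proof (rule sol_unique[of "\<lambda>s. sol (- s) 0 w" 0 0])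
  show "((\<lambda>s. sol (- s) 0 w) has_vector_derivative N (0 + s) (cut (sol (- s) 0 w))) (at s)" for s
  proof -
    have "(uminus has_vector_derivative (-1::real)) (at s)"
      by (auto intro!: derivative_eq_intros simp: has_vector_derivative_def)
    from vector_diff_chain_at[OF this sol_deriv[of 0 w "- s"]] show ?thesis by (simp add: o_def odd_N)
  qed
qed (simp add: sol_0)

text \<open>\<open>\<eta> \<theta>\<close> carries values at angle zero to angle \<open>\<theta>\<close>, and \<open>\<kappa> \<theta>\<close> is its inverse; the components
  of \<open>\<kappa>\<close> are constant along solutions.\<close>

definition \<eta> :: "real \<Rightarrow> 'a \<Rightarrow> 'a" where "\<eta> \<theta> w = sol \<theta> 0 w"
definition \<kappa> :: "real \<Rightarrow> 'a \<Rightarrow> 'a" where "\<kappa> \<theta> w = sol (- \<theta>) \<theta> w"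

lemma \<eta>_0: "\<eta> 0 w = w" by (simp add: \<eta>_def sol_0)

lemma \<eta>_\<kappa>: "\<eta> \<theta> (\<kappa> \<theta> w) = w"
  using sol_add[of \<theta> "- \<theta>" \<theta> w] by (simp add: \<eta>_def \<kappa>_def sol_0)

lemma \<kappa>_\<eta>: "\<kappa> \<theta> (\<eta> \<theta> w) = w"
  using sol_add[of "- \<theta>" \<theta> 0 w] by (simp add: \<eta>_def \<kappa>_def sol_0)

lemma \<eta>_periodic: "\<eta> (\<theta> + 2 * pi) w = \<eta> \<theta> w"
  unfolding \<eta>_def
proof (rule sol_unique[of "\<lambda>s. sol (s + 2 * pi) 0 w" 0 "- pi"])
  show "((\<lambda>s. sol (s + 2 * pi) 0 w) has_vector_derivative N (0 + s) (cut (sol (s + 2 * pi) 0 w))) (at s)" for s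
    using vector_diff_chain_at[OF shift_deriv[of "2 * pi" s] sol_deriv[of 0 w "s + 2 * pi"]]
    by (simp add: o_def periodic_N)
qed (simp add: sol_even)

lemma \<eta>_periodic_int: "\<eta> (\<theta> + 2 * pi * of_int n) w = \<eta> \<theta> w"
proof (induction n rule: int_induct[where k=0])
  case (step1 i)
  then show ?case using \<eta>_periodic[of "\<theta> + 2 * pi * of_int i" w] by (simp add: algebra_simps)
next
  case (step2 i)
  then show ?case using \<eta>_periodic[of "\<theta> + 2 * pi * of_int (i - 1)" w] by (simp add: algebra_simps)
qed simp

lemma \<kappa>_periodic_int: "\<kappa> (\<theta> + 2 * pi * of_int n) w = \<kappa> \<theta> w"
  using \<kappa>_\<eta>[of "\<theta> + 2 * pi * of_int n" "\<kappa> \<theta> w"] by (simp add: \<eta>_periodic_int \<eta>_\<kappa>)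

lemma \<eta>_drift:
  assumes "i \<in> Basis"
  shows "\<bar>(\<eta> \<theta> w - w) \<bullet> i\<bar> \<le> pi * (\<beta> \<bullet> i)"
proof -
  obtain n where n: "\<theta> - 2 * pi * of_int n \<in> {-pi..pi}" by (rule reduce_angle)
  define t where "t = \<theta> - 2 * pi * of_int n"
  have "norm (sol t 0 w \<bullet> i - sol 0 0 w \<bullet> i) \<le> (\<beta> \<bullet> i) * norm (t - 0)"
  proof (rule differentiable_bound[where S=UNIV and f'="\<lambda>s k. k * (N (0 + s) (cut (sol s 0 w)) \<bullet> i)"])
    fix s
    have "((\<lambda>s. sol s 0 w \<bullet> i) has_vector_derivative N (0 + s) (cut (sol s 0 w)) \<bullet> i) (at s)"
      by (rule bounded_linear.has_vector_derivative[OF bounded_linear_inner_left sol_deriv])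
    then show "((\<lambda>s. sol s 0 w \<bullet> i) has_derivative (\<lambda>k. k * (N (0 + s) (cut (sol s 0 w)) \<bullet> i))) (at s)"
      by (simp add: has_vector_derivative_def)
    show "onorm (\<lambda>k. k * (N (0 + s) (cut (sol s 0 w)) \<bullet> i)) \<le> \<beta> \<bullet> i"
      by (rule onorm_bound[OF \<beta>_nonneg[OF assms]])
        (use bounded_N[OF cut_in_B assms] in \<open>simp add: abs_mult mult.commute[of "\<beta> \<bullet> i"] mult_left_mono\<close>)
  qed auto
  also have "\<dots> \<le> (\<beta> \<bullet> i) * pi"
    using n \<beta>_nonneg[OF assms] by (intro mult_left_mono) (auto simp: t_def)
  also have "sol t 0 w = \<eta> \<theta> w"
    using \<eta>_periodic_int[of t n w] by (simp add: \<eta>_def t_def)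
  finally show ?thesis by (simp add: sol_0 inner_diff_left mult.commute)
qed

text \<open>Half a turn moves the \<open>i\<close>-th component by at most \<open>\<pi> \<beta> \<bullet> i\<close>, which is the margin left to
  the boundary of the box.\<close>

definition D :: "'a set" where "D = {w. \<forall>i\<in>Basis. \<bar>(w - c) \<bullet> i\<bar> < h \<bullet> i - pi * (\<beta> \<bullet> i)}"

lemma centre_in_D: "c \<in> D"
  using small by (simp add: D_def)

lemma open_D: "open D"
proof -
  have "D = (\<Inter>i\<in>Basis. {w. \<bar>(w - c) \<bullet> i\<bar> < h \<bullet> i - pi * (\<beta> \<bullet> i)})" by (auto simp: D_def)
  then show ?thesis by (auto intro!: open_INT open_Collect_less continuous_intros)
qed

lemma \<eta>_in_box:
  assumes "w \<in> D"
  shows "\<eta> \<theta> w \<in> box (c - h) (c + h)"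
proof -
  have "\<bar>(\<eta> \<theta> w - c) \<bullet> i\<bar> < h \<bullet> i" if "i \<in> Basis" for i
    using \<eta>_drift[OF that, of \<theta> w] assms that by (auto simp: D_def inner_diff_left)
  then show ?thesis by (force simp: mem_box inner_diff_left inner_add_left abs_less_iff)
qed

lemma \<eta>_deriv:
  assumes "w \<in> D"
  shows "((\<lambda>\<theta>. \<eta> \<theta> w) has_vector_derivative N \<theta> (\<eta> \<theta> w)) (at \<theta>)"
  using sol_deriv[of 0 w \<theta>] \<eta>_in_box[OF assms, of \<theta>] box_subset_cbox[of "c - h" "c + h"]
  by (auto simp: \<eta>_def[symmetric] \<eta>_def[abs_def, symmetric])

text \<open>The tube of the periodic solutions, in the space of angles and states.\<close>

definition U :: "(real \<times> 'a) set" where "U = {q. \<kappa> (fst q) (snd q) \<in> D}"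

lemma U_I: "w \<in> D \<Longrightarrow> (\<theta>, \<eta> \<theta> w) \<in> U"
  by (simp add: U_def \<kappa>_\<eta>)

lemma in_U_box: "q \<in> U \<Longrightarrow> snd q \<in> box (c - h) (c + h)"
  using \<eta>_in_box[of "\<kappa> (fst q) (snd q)" "fst q"] by (simp add: U_def \<eta>_\<kappa>)

lemma open_U: "open U"
proof -
  have "continuous_on UNIV (\<lambda>q. \<kappa> (fst q) (snd q))"
    unfolding \<kappa>_def
    by (rule continuous_on_compose2[OF continuous_on_sol, where f="\<lambda>q. (- fst q, (fst q, snd q))", simplified])
      (auto intro!: continuous_intros)
  from open_vimage[OF open_D this] show ?thesis by (simp add: U_def vimage_def)
qed

text \<open>With the angle as a state variable the equation becomes autonomous, and the tube is invariant
  under its complete flow.\<close>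

lemma invariant_tube:
  obtains L where "invariant_flow (\<lambda>q. (1, N (fst q) (snd q))) (UNIV \<times> box (c - h) (c + h)) U
    (\<lambda>s q. (fst q + s, sol s (fst q) (snd q))) L"
proof -
  obtain L where L: "L \<ge> 0" "\<And>\<theta> w k. w \<in> B \<Longrightarrow> norm (DN (\<theta>, w) k) \<le> L * norm k"
    by (rule Lipschitz_constant) blast
  let ?V = "UNIV \<times> box (c - h) (c + h) :: (real \<times> 'a) set"
  have VG: "?V \<subseteq> G" using box_in_G box_subset_cbox[of "c - h" "c + h"] by blast
  have oV: "open ?V" by (auto intro: open_Times open_box)
  show thesis
  proof (rule that[of L], unfold_locales)
    show "open ?V" "open U" "L \<ge> 0" by (fact oV open_U L)+
    show "convex ?V" by (intro convex_Times) auto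
    show "U \<subseteq> ?V" using in_U_box by (auto simp: mem_Times_iff)
    show "smooth_on ?V (\<lambda>q. (1, N (fst q) (snd q)))"
      unfolding smooth_on_def
      by (intro allI differentiable_upto_Pair oV differentiable_upto_const
          differentiable_upto_subset[OF _ VG]) (use smooth_N in \<open>simp add: smooth_on_def\<close>)
    fix q k :: "real \<times> 'a"
    show "norm (frechet_derivative (\<lambda>q. (1::real, N (fst q) (snd q))) (at q) k) \<le> L * norm k" if "q \<in> ?V"
    proof -
      have "((\<lambda>q. (1::real, N (fst q) (snd q))) has_derivative (\<lambda>k. (0, DN q k))) (at q)"
        by (intro has_derivative_Pair has_derivative_const DN) (use that VG in blast)
      then have "frechet_derivative (\<lambda>q. (1, N (fst q) (snd q))) (at q) = (\<lambda>k. (0::real, DN q k))"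
        by (rule frechet_derivative_at[symmetric])
      moreover have "snd q \<in> B" using that box_subset_cbox[of "c - h" "c + h"] by auto
      ultimately show ?thesis using L(2)[of "snd q" "fst q" k] by (simp add: norm_Pair)
    qed
  next
    fix q s assume q: "q \<in> U"
    have inv: "(fst q + s, sol s (fst q) (snd q)) \<in> U" for s
    proof -
      have "\<kappa> (fst q + s) (sol s (fst q) (snd q)) = \<kappa> (fst q) (snd q)"
        using sol_add[of "- (fst q + s)" s "fst q" "snd q"] by (simp add: \<kappa>_def)
      then show ?thesis using q by (simp add: U_def)
    qed
    then show "(fst q + s, sol s (fst q) (snd q)) \<in> U" .
    have "cut (sol s (fst q) (snd q)) = sol s (fst q) (snd q)"
      using in_U_box[OF inv[of s]] box_subset_cbox[of "c - h" "c + h"] by auto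
    then show "((\<lambda>s. (fst q + s, sol s (fst q) (snd q))) has_vector_derivative
        (1, N (fst (fst q + s, sol s (fst q) (snd q))) (snd (fst q + s, sol s (fst q) (snd q))))) (at s)"
      using has_vector_derivative_Pair[OF shift_deriv[of "fst q" s] sol_deriv[of "fst q" "snd q" s]]
      by (simp add: add.commute)
  qed (simp add: sol_0)
qed

theorem smooth_\<kappa>: "smooth_on U (\<lambda>q. \<kappa> (fst q) (snd q))"
proof -
  obtain L where "invariant_flow (\<lambda>q. (1, N (fst q) (snd q))) (UNIV \<times> box (c - h) (c + h)) U
    (\<lambda>s q. (fst q + s, sol s (fst q) (snd q))) L" by (rule invariant_tube)
  then interpret F: invariant_flow "\<lambda>q. (1, N (fst q) (snd q))" "UNIV \<times> box (c - h) (c + h)" U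
    "\<lambda>s q. (fst q + s, sol s (fst q) (snd q))" L .
  have o: "open (UNIV \<times> U)" using open_U by (auto intro: open_Times)
  have "differentiable_upto n U (\<lambda>q. \<kappa> (fst q) (snd q))" for n
  proof -
    have 1: "differentiable_upto n (UNIV \<times> U) (\<lambda>p. snd (fst (snd p) + fst p, sol (fst p) (fst (snd p)) (snd (snd p))))"
      by (rule differentiable_upto_linear_compose[OF bounded_linear_snd o]) (use F.smooth_flow in \<open>simp add: smooth_on_def\<close>)
    have 2: "differentiable_upto n U (\<lambda>q. (- fst q, q))"
      by (rule differentiable_upto_bounded_linear[OF open_U])
        (intro bounded_linear_Pair bounded_linear_minus bounded_linear_fst bounded_linear_ident)
    have "(\<lambda>q. (- fst q, q)) ` U \<subseteq> UNIV \<times> U" by auto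
    from differentiable_upto_compose[OF open_U 2 1 this] show ?thesis by (simp add: \<kappa>_def)
  qed
  then show ?thesis by (simp add: smooth_on_def)
qed

theorem differentiable_\<eta>:
  assumes "w \<in> D"
  shows "\<eta> \<theta> differentiable (at w)"
proof -
  obtain L where "invariant_flow (\<lambda>q. (1, N (fst q) (snd q))) (UNIV \<times> box (c - h) (c + h)) U
    (\<lambda>s q. (fst q + s, sol s (fst q) (snd q))) L" by (rule invariant_tube)
  then interpret F: invariant_flow "\<lambda>q. (1, N (fst q) (snd q))" "UNIV \<times> box (c - h) (c + h)" U
    "\<lambda>s q. (fst q + s, sol s (fst q) (snd q))" L .
  have w: "(0, w) \<in> U" using U_I[OF assms, of 0] by (simp add: \<eta>_0)
  have 1: "((\<lambda>w. (\<theta>, (0, w))) has_derivative (\<lambda>k. (0, (0, k)))) (at w)"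
    by (auto intro!: derivative_eq_intros)
  have "(\<lambda>p. snd (fst (snd p) + fst p, sol (fst p) (fst (snd p)) (snd (snd p)))) differentiable (at (\<theta>, (0, w)))"
    using has_derivative_snd[OF F.flow_has_derivative[OF w]] unfolding differentiable_def by blast
  then obtain d where "((\<lambda>p. sol (fst p) (fst (snd p)) (snd (snd p))) has_derivative d) (at (\<theta>, (0, w)))"
    by (auto simp: differentiable_def)
  from has_derivative_compose[OF 1 this] show ?thesis
    by (auto simp: \<eta>_def[abs_def] differentiable_def)
qed

end

section \<open>The pendulum in polar coordinates\<close>

definition detA :: "pendulum \<Rightarrow> real \<Rightarrow> real" where
  "detA p \<phi> = A11 p * A22 p \<phi> - (A12 p \<phi>)\<^sup>2"

text \<open>The effective mass of the oscillation in \<open>\<phi>\<^sub>1\<close> at fixed momentum conjugate to \<open>\<phi>\<^sub>2\<close>.\<close>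

definition mass1 :: "pendulum \<Rightarrow> real \<Rightarrow> real" where "mass1 p \<phi> = detA p \<phi> / A22 p \<phi>"

definition asymmetry :: "pendulum \<Rightarrow> real" where "asymmetry p = (m1 p * l1 p - m3 p * l3 p) * l2 p"

text \<open>The equations of motion amount to \<open>mass1 \<phi>\<^sub>1'' + mass1' (\<phi>\<^sub>1')\<^sup>2 / 2 = force1\<close> and \<open>P' = torque2\<close>,
  where \<open>P\<close> is the momentum conjugate to \<open>\<phi>\<^sub>2\<close>. The term with \<open>P\<^sup>2\<close> is the centrifugal force; it
  absorbs all terms with \<open>v\<^sub>2\<close>.\<close>

definition force1 :: "pendulum \<Rightarrow> real \<Rightarrow> real \<Rightarrow> real \<Rightarrow> real" where
  "force1 p F \<phi> P = - k1 p * \<phi> + F * l2 p * sin \<phi> * A12 p \<phi> / A22 p \<phi> - P\<^sup>2 * asymmetry p * sin \<phi> / (A22 p \<phi>)\<^sup>2"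

definition torque2 :: "pendulum \<Rightarrow> real \<Rightarrow> real \<Rightarrow> real" where "torque2 p F \<phi> = - F * l2 p * sin \<phi>"

context
  fixes p :: pendulum
  assumes pos: "positive_masses_and_lengths p"
begin

lemma A_pos: "A11 p > 0" "A22 p \<phi> > 0" "detA p \<phi> > 0" "mass1 p \<phi> > 0"
  using A_det_pos(1)[OF pos] A_det_pos(2,3)[OF pos, of \<phi>] by (auto simp: mass1_def detA_def)

lemma A_nz: "A11 p \<noteq> 0" "A22 p \<phi> \<noteq> 0" "detA p \<phi> \<noteq> 0" "mass1 p \<phi> \<noteq> 0" "sqrt (mass1 p \<phi>) \<noteq> 0"
  using A_pos(1) A_pos(2-4)[where \<phi>=\<phi>] by auto

lemma dv_eq:
  "dv1 p F \<phi> v1 v2 = (A22 p \<phi> * r1 p \<phi> v1 v2 - A12 p \<phi> * r2 p F \<phi> v1 v2) / detA p \<phi>"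
  "dv2 p F \<phi> v1 v2 = (A11 p * r2 p F \<phi> v1 v2 - A12 p \<phi> * r1 p \<phi> v1 v2) / detA p \<phi>"
proof -
  have "A11 p - (A12 p \<phi>)\<^sup>2 / A22 p \<phi> = detA p \<phi> / A22 p \<phi>" "A22 p \<phi> - (A12 p \<phi>)\<^sup>2 / A11 p = detA p \<phi> / A11 p"
    using A_nz by (auto simp: detA_def field_simps)
  then show "dv1 p F \<phi> v1 v2 = (A22 p \<phi> * r1 p \<phi> v1 v2 - A12 p \<phi> * r2 p F \<phi> v1 v2) / detA p \<phi>"
    "dv2 p F \<phi> v1 v2 = (A11 p * r2 p F \<phi> v1 v2 - A12 p \<phi> * r1 p \<phi> v1 v2) / detA p \<phi>"
    using A_nz by (auto simp: dv1_def dv2_def field_simps)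
qed

lemma dv1_force1:
  "mass1 p \<phi> * dv1 p F \<phi> v1 v2 = force1 p F \<phi> (A12 p \<phi> * v1 + A22 p \<phi> * v2)
    - (2 * A12 p \<phi> * asymmetry p * sin \<phi> / A22 p \<phi> - 2 * (A12 p \<phi>)\<^sup>2 * asymmetry p * sin \<phi> / (A22 p \<phi>)\<^sup>2) * v1\<^sup>2 / 2"
proof -
  define q where "q = A12 p \<phi> / A22 p \<phi>"
  have 1: "mass1 p \<phi> * dv1 p F \<phi> v1 v2 = r1 p \<phi> v1 v2 - q * r2 p F \<phi> v1 v2"
    using A_nz(2-5)[of \<phi>] by (simp add: dv_eq mass1_def q_def field_simps)
  have 2: "force1 p F \<phi> (A12 p \<phi> * v1 + A22 p \<phi> * v2)
      = - k1 p * \<phi> + F * l2 p * sin \<phi> * q - (q * v1 + v2)\<^sup>2 * asymmetry p * sin \<phi>"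
  proof -
    have "A12 p \<phi> * v1 + A22 p \<phi> * v2 = (q * v1 + v2) * A22 p \<phi>"
      using A_nz(2)[of \<phi>] by (simp add: q_def field_simps)
    then show ?thesis
      using A_nz(2)[of \<phi>] by (simp add: force1_def q_def power_mult_distrib)
  qed
  have 3: "2 * A12 p \<phi> * asymmetry p * sin \<phi> / A22 p \<phi> - 2 * (A12 p \<phi>)\<^sup>2 * asymmetry p * sin \<phi> / (A22 p \<phi>)\<^sup>2
      = 2 * (q - q\<^sup>2) * asymmetry p * sin \<phi>"
    by (simp add: q_def power_divide algebra_simps diff_divide_distrib)
  have 4: "r1 p \<phi> v1 v2 = - k1 p * \<phi> - asymmetry p * v2\<^sup>2 * sin \<phi>"
    "r2 p F \<phi> v1 v2 = - F * l2 p * sin \<phi> + asymmetry p * v1 * (v1 + 2 * v2) * sin \<phi>"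
    by (simp_all add: r1_def r2_def asymmetry_def)
  show ?thesis unfolding 1 2 3 4 by (simp add: power2_eq_square field_simps)
qed

lemma DERIV_A12: "(A12 p has_real_derivative - asymmetry p * sin \<phi>) (at \<phi>)"
  unfolding A12_def[abs_def] asymmetry_def by (auto intro!: derivative_eq_intros)

lemma DERIV_A22: "(A22 p has_real_derivative - 2 * asymmetry p * sin \<phi>) (at \<phi>)"
  unfolding A22_def[abs_def] asymmetry_def by (auto intro!: derivative_eq_intros)

lemma DERIV_mass1: "(mass1 p has_real_derivative
   2 * A12 p \<phi> * asymmetry p * sin \<phi> / A22 p \<phi> - 2 * (A12 p \<phi>)\<^sup>2 * asymmetry p * sin \<phi> / (A22 p \<phi>)\<^sup>2) (at \<phi>)"
  unfolding mass1_def[abs_def] detA_def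
  by (rule derivative_eq_intros DERIV_A12 DERIV_A22 refl A_nz)+
    (use A_nz(2)[of \<phi>] in \<open>simp add: field_simps power2_eq_square\<close>)

lemma differentiable_upto_A:
  assumes "open U" "differentiable_upto n U f"
  shows "differentiable_upto n U (\<lambda>x. A12 p (f x))" "differentiable_upto n U (\<lambda>x. A22 p (f x))"
    "differentiable_upto n U (\<lambda>x. detA p (f x))" "differentiable_upto n U (\<lambda>x. mass1 p (f x))"
    "differentiable_upto n U (\<lambda>x. sqrt (mass1 p (f x)))" "differentiable_upto n U (\<lambda>x. torque2 p F (f x))"
proof -
  show 1: "differentiable_upto n U (\<lambda>x. A12 p (f x))" "differentiable_upto n U (\<lambda>x. A22 p (f x))"
    unfolding A12_def A22_def by (intro differentiable_upto_intros assms)+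
  then show 2: "differentiable_upto n U (\<lambda>x. detA p (f x))"
    unfolding detA_def by (intro differentiable_upto_intros assms)
  show 3: "differentiable_upto n U (\<lambda>x. mass1 p (f x))"
    unfolding mass1_def by (intro differentiable_upto_divide assms 1 2 A_nz)
  show "differentiable_upto n U (\<lambda>x. sqrt (mass1 p (f x)))"
    by (intro differentiable_upto_sqrt assms 3 A_pos)
  show "differentiable_upto n U (\<lambda>x. torque2 p F (f x))"
    unfolding torque2_def by (intro differentiable_upto_intros assms)
qed

lemma differentiable_upto_force1:
  assumes "open U" "differentiable_upto n U f" "differentiable_upto n U P"
  shows "differentiable_upto n U (\<lambda>x. force1 p F (f x) (P x))"
  unfolding force1_def
  by (intro differentiable_upto_intros differentiable_upto_divide differentiable_upto_A assms A_nz)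
    (simp add: A_nz)

lemma differentiable_upto_dv:
  assumes "open U" "differentiable_upto n U f" "differentiable_upto n U v1" "differentiable_upto n U v2"
  shows "differentiable_upto n U (\<lambda>x. dv1 p F (f x) (v1 x) (v2 x))"
    "differentiable_upto n U (\<lambda>x. dv2 p F (f x) (v1 x) (v2 x))"
  unfolding dv_eq r1_def r2_def
  by (intro differentiable_upto_intros differentiable_upto_divide differentiable_upto_A assms A_nz)+

end

text \<open>Polar coordinates are centred at \<open>\<phi>\<^sub>1 = c0\<close>, \<open>y = 0\<close>, and \<open>\<omega>\<close> is the frequency of the harmonic
  oscillator to which the motion is compared; \<open>\<delta>\<close> bounds the deviation of the force from that of
  the oscillator. The solutions stay in the box \<open>\<bar>r - r0\<bar> \<le> a\<close>, \<open>\<bar>P - P0\<bar> \<le> b\<close>. There the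
  condition \<open>2 \<delta> \<le> \<omega> (r0 - a)\<close> keeps the angular speed at least \<open>\<omega> / 2\<close>, so that half a turn
  changes \<open>r\<close> and \<open>P\<close> by at most \<open>2 \<pi> \<delta> / \<omega>\<close> and \<open>2 \<pi> \<sigma> / \<omega>\<close>.\<close>

locale polar_pendulum =
  fixes p :: pendulum and F c0 \<omega> r0 P0 a b \<delta> \<sigma> :: real
  assumes pos: "positive_masses_and_lengths p"
    and center: "c0 = 0 \<or> c0 = pi \<and> k1 p = 0"
    and \<omega>_pos: "\<omega> > 0" and a_less: "a < r0"
    and force_bound: "\<And>x P. \<bar>x\<bar> \<le> (r0 + a) / \<omega> \<Longrightarrow> \<bar>P - P0\<bar> \<le> b \<Longrightarrow> \<bar>force1 p F (c0 + x) P + \<omega>\<^sup>2 * x\<bar> \<le> \<delta>"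
    and torque_bound: "\<And>x. \<bar>x\<bar> \<le> (r0 + a) / \<omega> \<Longrightarrow> \<bar>sqrt (mass1 p (c0 + x)) * torque2 p F (c0 + x)\<bar> \<le> \<sigma>"
    and \<delta>: "0 \<le> \<delta>" "2 * \<delta> \<le> \<omega> * (r0 - a)" "2 * pi * \<delta> < \<omega> * a"
    and \<sigma>: "0 \<le> \<sigma>" "2 * pi * \<sigma> < \<omega> * b"
begin

definition \<Delta> :: "real \<Rightarrow> real \<Rightarrow> real" where "\<Delta> x P = force1 p F (c0 + x) P + \<omega>\<^sup>2 * x"

text \<open>\<open>\<Theta>\<close> is the angular speed in the rescaled time, and \<open>N\<close> is the derivative of \<open>w = (r, P)\<close> with
  respect to the angle.\<close>

definition \<Theta> :: "real \<Rightarrow> real \<times> real \<Rightarrow> real" where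
  "\<Theta> \<theta> w = \<omega> - sin \<theta> * \<Delta> (fst w * sin \<theta> / \<omega>) (snd w) / fst w"

definition N :: "real \<Rightarrow> real \<times> real \<Rightarrow> real \<times> real" where
  "N \<theta> w = (cos \<theta> * \<Delta> (fst w * sin \<theta> / \<omega>) (snd w) / \<Theta> \<theta> w,
    sqrt (mass1 p (c0 + fst w * sin \<theta> / \<omega>)) * torque2 p F (c0 + fst w * sin \<theta> / \<omega>) / \<Theta> \<theta> w)"

definition G :: "(real \<times> (real \<times> real)) set" where "G = {q. fst (snd q) > 0 \<and> \<Theta> (fst q) (snd q) > 0}"

lemma reflect: "sin (c0 - x) = - sin (c0 + x)" "cos (c0 - x) = cos (c0 + x)"
  using center by (auto simp: sin_diff sin_add cos_diff cos_add)

lemma even_coefficients: "A12 p (c0 - x) = A12 p (c0 + x)" "A22 p (c0 - x) = A22 p (c0 + x)"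
  "mass1 p (c0 - x) = mass1 p (c0 + x)"
  by (auto simp: A12_def A22_def mass1_def detA_def reflect)

lemma \<Delta>_odd: "\<Delta> (- x) P = - \<Delta> x P"
  using center by (auto simp: \<Delta>_def force1_def even_coefficients[of x, simplified] reflect[of x, simplified] algebra_simps)

lemma box_iff: "w \<in> cbox ((r0, P0) - (a, b)) ((r0, P0) + (a, b)) \<longleftrightarrow> \<bar>fst w - r0\<bar> \<le> a \<and> \<bar>snd w - P0\<bar> \<le> b"
  by (cases w) (auto simp: cbox_Pair_eq)

lemma box_estimates:
  assumes "\<bar>fst w - r0\<bar> \<le> a" "\<bar>snd w - P0\<bar> \<le> b"
  shows "fst w > 0" "\<bar>fst w * sin \<theta> / \<omega>\<bar> \<le> (r0 + a) / \<omega>" "\<bar>\<Delta> (fst w * sin \<theta> / \<omega>) (snd w)\<bar> \<le> \<delta>"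
    "\<Theta> \<theta> w \<ge> \<omega> / 2"
proof -
  show r: "fst w > 0" using assms a_less by linarith
  have "\<bar>fst w * sin \<theta>\<bar> \<le> fst w * 1" unfolding abs_mult using r by (intro mult_mono) auto
  then have "\<bar>fst w * sin \<theta>\<bar> \<le> r0 + a" using assms by linarith
  then show x: "\<bar>fst w * sin \<theta> / \<omega>\<bar> \<le> (r0 + a) / \<omega>" using \<omega>_pos by (simp add: divide_right_mono)
  show d: "\<bar>\<Delta> (fst w * sin \<theta> / \<omega>) (snd w)\<bar> \<le> \<delta>" unfolding \<Delta>_def by (rule force_bound[OF x assms(2)])
  have "\<bar>sin \<theta> * \<Delta> (fst w * sin \<theta> / \<omega>) (snd w)\<bar> \<le> 1 * \<delta>" unfolding abs_mult using d by (intro mult_mono) auto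
  also have "1 * \<delta> \<le> \<omega> / 2 * fst w"
  proof -
    have "r0 - a \<le> fst w" using assms by linarith
    then have "\<omega> * (r0 - a) \<le> \<omega> * fst w" using \<omega>_pos by (simp add: mult_left_mono)
    then show ?thesis using \<delta> by simp
  qed
  finally have "\<bar>sin \<theta> * \<Delta> (fst w * sin \<theta> / \<omega>) (snd w)\<bar> / fst w \<le> \<omega> / 2"
    using r by (simp add: pos_divide_le_eq)
  then have "\<bar>sin \<theta> * \<Delta> (fst w * sin \<theta> / \<omega>) (snd w) / fst w\<bar> \<le> \<omega> / 2" using r by simp
  then show "\<Theta> \<theta> w \<ge> \<omega> / 2" unfolding \<Theta>_def by linarith
qed

lemma differentiable_upto_\<Delta>:
  assumes "open U" "differentiable_upto n U x" "differentiable_upto n U P"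
  shows "differentiable_upto n U (\<lambda>q. \<Delta> (x q) (P q))"
  unfolding \<Delta>_def by (intro differentiable_upto_intros differentiable_upto_force1 pos assms)

lemma polar_coordinates_smooth:
  "differentiable_upto n {q. fst (snd q) > 0} (\<lambda>q::real \<times> real \<times> real. fst q)"
  "differentiable_upto n {q. fst (snd q) > 0} (\<lambda>q::real \<times> real \<times> real. fst (snd q))"
  "differentiable_upto n {q. fst (snd q) > 0} (\<lambda>q::real \<times> real \<times> real. snd (snd q))"
  and open_positive_radius: "open {q::real \<times> real \<times> real. fst (snd q) > 0}"
proof -
  show o: "open {q::real \<times> real \<times> real. fst (snd q) > 0}" by (intro open_Collect_less continuous_intros)
  show "differentiable_upto n {q. fst (snd q) > 0} (\<lambda>q::real \<times> real \<times> real. fst q)"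
    "differentiable_upto n {q. fst (snd q) > 0} (\<lambda>q::real \<times> real \<times> real. fst (snd q))"
    "differentiable_upto n {q. fst (snd q) > 0} (\<lambda>q::real \<times> real \<times> real. snd (snd q))"
    by (intro differentiable_upto_bounded_linear o bounded_linear_fst
        bounded_linear_compose[OF bounded_linear_fst bounded_linear_snd]
        bounded_linear_compose[OF bounded_linear_snd bounded_linear_snd])+
qed

lemma polar_functions_smooth:
  "differentiable_upto n {q. fst (snd q) > 0} (\<lambda>q::real \<times> real \<times> real. fst (snd q) * sin (fst q) / \<omega>)"
  "differentiable_upto n {q. fst (snd q) > 0} (\<lambda>q. \<Theta> (fst q) (snd q))"
proof -
  note o = open_positive_radius
  show 1: "differentiable_upto n {q::real \<times> real \<times> real. fst (snd q) > 0} (\<lambda>q. fst (snd q) * sin (fst q) / \<omega>)"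
    by (intro differentiable_upto_divide differentiable_upto_intros o polar_coordinates_smooth) (use \<omega>_pos in simp)
  show "differentiable_upto n {q. fst (snd q) > 0} (\<lambda>q. \<Theta> (fst q) (snd q))"
    unfolding \<Theta>_def
    by (intro differentiable_upto_diff differentiable_upto_const differentiable_upto_divide differentiable_upto_mult
        differentiable_upto_sin differentiable_upto_\<Delta> o 1 polar_coordinates_smooth) auto
qed

sublocale reversible_ODE N G "(r0, P0)" "(a, b)" "(2 * \<delta> / \<omega>, 2 * \<sigma> / \<omega>)"
proof
  note o = open_positive_radius
  have "G = {q. fst (snd q) > 0} \<inter> (\<lambda>q. \<Theta> (fst q) (snd q)) -` {0<..}" by (auto simp: G_def)
  then show oG: "open G"
    using continuous_open_preimage[OF differentiable_upto_imp_continuous[OF polar_functions_smooth(2)[of 0]] o, of "{0<..}"]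
    by simp
  have pG: "G \<subseteq> {q. fst (snd q) > 0}" by (auto simp: G_def)
  show "UNIV \<times> cbox ((r0, P0) - (a, b)) ((r0, P0) + (a, b)) \<subseteq> G"
  proof
    fix q :: "real \<times> real \<times> real" assume "q \<in> UNIV \<times> cbox ((r0, P0) - (a, b)) ((r0, P0) + (a, b))"
    then have "\<bar>fst (snd q) - r0\<bar> \<le> a" "\<bar>snd (snd q) - P0\<bar> \<le> b"
      using box_iff[of "snd q"] by (auto simp del: diff_Pair add_Pair)
    from box_estimates(1)[OF this] box_estimates(4)[OF this, of "fst q"] show "q \<in> G"
      using \<omega>_pos by (simp add: G_def)
  qed
  have nz: "\<Theta> (fst q) (snd q) \<noteq> 0" if "q \<in> G" for q using that by (simp add: G_def)
  note sub = differentiable_upto_subset[OF _ pG]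
  show "smooth_on G (\<lambda>q. N (fst q) (snd q))"
    unfolding smooth_on_def N_def
    by (intro allI differentiable_upto_Pair differentiable_upto_divide differentiable_upto_mult oG
        differentiable_upto_cos differentiable_upto_\<Delta> differentiable_upto_A[OF pos] differentiable_upto_add
        differentiable_upto_const sub polar_functions_smooth[THEN sub] polar_coordinates_smooth[THEN sub] nz)
  show "N (- \<theta>) w = - N \<theta> w" for \<theta> w
  proof -
    have "\<Theta> (- \<theta>) w = \<Theta> \<theta> w" by (simp add: \<Theta>_def \<Delta>_odd)
    then show ?thesis
      using even_coefficients(3)[of "fst w * sin \<theta> / \<omega>"] reflect(1)[of "fst w * sin \<theta> / \<omega>"]
      by (simp add: N_def \<Delta>_odd torque2_def)
  qed
  show "N (\<theta> + 2 * pi) w = N \<theta> w" for \<theta> w by (simp add: N_def \<Theta>_def)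
  fix i :: "real \<times> real" assume "i \<in> Basis"
  then have i: "i = (1, 0) \<or> i = (0, 1)" by (auto simp: Basis_prod_def)
  show "0 \<le> (2 * \<delta> / \<omega>, 2 * \<sigma> / \<omega>) \<bullet> i" using i \<delta> \<sigma> \<omega>_pos by auto
  show "pi * ((2 * \<delta> / \<omega>, 2 * \<sigma> / \<omega>) \<bullet> i) < (a, b) \<bullet> i"
    using i \<delta> \<sigma> \<omega>_pos by (auto simp: field_simps)
  show "\<bar>N \<theta> w \<bullet> i\<bar> \<le> (2 * \<delta> / \<omega>, 2 * \<sigma> / \<omega>) \<bullet> i"
    if "w \<in> cbox ((r0, P0) - (a, b)) ((r0, P0) + (a, b))" for \<theta> w
  proof -
    note w = box_estimates(2-4)[OF that[unfolded box_iff, THEN conjunct1] that[unfolded box_iff, THEN conjunct2], of \<theta>]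
    have \<Theta>: "\<Theta> \<theta> w > 0" using w(3) \<omega>_pos by linarith
    have div: "\<bar>y / \<Theta> \<theta> w\<bar> \<le> 2 * k / \<omega>" if "\<bar>y\<bar> \<le> k" for y k
    proof -
      have "\<bar>y\<bar> / \<Theta> \<theta> w \<le> k / (\<omega> / 2)"
        using that w(3) \<omega>_pos \<Theta> by (intro frac_le) auto
      then show ?thesis using \<Theta> by (simp add: mult.commute)
    qed
    have "\<bar>cos \<theta> * \<Delta> (fst w * sin \<theta> / \<omega>) (snd w)\<bar> \<le> 1 * \<delta>"
      unfolding abs_mult using w(2) by (intro mult_mono) auto
    then show ?thesis using i div[of _ \<delta>] div[OF torque_bound[OF w(1)]] by (auto simp: N_def)
  qed
qed

text \<open>The polar representation of the reduced phase space.\<close>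

definition Pi :: "real \<Rightarrow> real \<times> real \<Rightarrow> real^3" where
  "Pi \<theta> w = (let \<phi> = c0 + fst w * sin \<theta> / \<omega>; v = fst w * cos \<theta> / sqrt (mass1 p \<phi>) in
    vector [\<phi>, v, (snd w - A12 p \<phi> * v) / A22 p \<phi>])"

lemma Pi_nth:
  "Pi \<theta> w $ 1 = c0 + fst w * sin \<theta> / \<omega>"
  "Pi \<theta> w $ 2 = fst w * cos \<theta> / sqrt (mass1 p (Pi \<theta> w $ 1))"
  "Pi \<theta> w $ 3 = (snd w - A12 p (Pi \<theta> w $ 1) * Pi \<theta> w $ 2) / A22 p (Pi \<theta> w $ 1)"
  by (simp_all add: Pi_def Let_def)

text \<open>The angular speed in the original time.\<close>

definition clock_speed :: "real \<Rightarrow> real \<times> real \<Rightarrow> real" where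
  "clock_speed \<theta> w = \<Theta> \<theta> w / sqrt (mass1 p (c0 + fst w * sin \<theta> / \<omega>))"

lemma in_D_estimates:
  assumes "w \<in> D"
  shows "fst (\<eta> \<theta> w) > 0" "\<Theta> \<theta> (\<eta> \<theta> w) > 0"
proof -
  have "\<eta> \<theta> w \<in> cbox ((r0, P0) - (a, b)) ((r0, P0) + (a, b))"
    using \<eta>_in_box[OF assms] box_subset_cbox by blast
  then have "\<bar>fst (\<eta> \<theta> w) - r0\<bar> \<le> a" "\<bar>snd (\<eta> \<theta> w) - P0\<bar> \<le> b" unfolding box_iff by auto
  from box_estimates(1)[OF this] box_estimates(4)[OF this, of \<theta>] \<omega>_pos
  show "fst (\<eta> \<theta> w) > 0" "\<Theta> \<theta> (\<eta> \<theta> w) > 0" by auto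
qed

lemma clock_speed_pos: "w \<in> D \<Longrightarrow> clock_speed \<theta> (\<eta> \<theta> w) > 0"
  unfolding clock_speed_def using in_D_estimates(2)[of w \<theta>] A_pos(4)[OF pos] by simp

text \<open>The derivatives of \<open>y\<close> and \<open>P\<close> depend on \<open>\<phi>\<^sub>1\<close> and \<open>P\<close> only; the products of velocities in
  the accelerations come from differentiating \<open>mass1\<close>, \<open>A12\<close> and \<open>A22\<close> in the formulas for
  \<open>v\<^sub>1\<close> and \<open>v\<^sub>2\<close>.\<close>

lemma Pi_solution:
  assumes w: "w \<in> D"
  shows "((\<lambda>\<theta>. Pi \<theta> (\<eta> \<theta> w)) has_vector_derivative
    (1 / clock_speed \<theta> (\<eta> \<theta> w)) *\<^sub>R reduced_system p F (Pi \<theta> (\<eta> \<theta> w))) (at \<theta>)"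
proof -
  define r where "r \<theta> = fst (\<eta> \<theta> w)" for \<theta>
  define P where "P \<theta> = snd (\<eta> \<theta> w)" for \<theta>
  define \<phi> where "\<phi> \<theta> = c0 + r \<theta> * sin \<theta> / \<omega>" for \<theta>
  define y where "y \<theta> = r \<theta> * cos \<theta>" for \<theta>
  define v1 where "v1 \<theta> = y \<theta> / sqrt (mass1 p (\<phi> \<theta>))" for \<theta>
  define v2 where "v2 \<theta> = (P \<theta> - A12 p (\<phi> \<theta>) * v1 \<theta>) / A22 p (\<phi> \<theta>)" for \<theta>
  define T where "T = \<Theta> \<theta> (\<eta> \<theta> w)"
  define S where "S = sqrt (mass1 p (\<phi> \<theta>))"
  define dl where "dl = \<Delta> (r \<theta> * sin \<theta> / \<omega>) (P \<theta>)"
  have T: "T > 0" and r: "r \<theta> > 0" using in_D_estimates[OF w] by (auto simp: T_def r_def)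
  have S: "S > 0" "S * S = mass1 p (\<phi> \<theta>)" using A_pos(4)[OF pos] by (auto simp: S_def less_imp_le)
  have Tr: "T * r \<theta> = \<omega> * r \<theta> - sin \<theta> * dl"
    using r by (simp add: T_def \<Theta>_def dl_def r_def P_def field_simps)
  have dr: "(r has_real_derivative cos \<theta> * dl / T) (at \<theta>)"
    and dP: "(P has_real_derivative S * torque2 p F (\<phi> \<theta>) / T) (at \<theta>)"
    using bounded_linear.has_vector_derivative[OF bounded_linear_fst \<eta>_deriv[OF w, of \<theta>]]
      bounded_linear.has_vector_derivative[OF bounded_linear_snd \<eta>_deriv[OF w, of \<theta>]]
    by (simp_all add: N_def T_def S_def dl_def \<phi>_def r_def[abs_def] P_def[abs_def] has_real_derivative_iff_has_vector_derivative)
  have d\<phi>: "(\<phi> has_real_derivative v1 \<theta> * S / T) (at \<theta>)"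
  proof -
    have "(\<phi> has_real_derivative (cos \<theta> * dl / T * sin \<theta> + cos \<theta> * r \<theta>) / \<omega>) (at \<theta>)"
      unfolding \<phi>_def[abs_def]
      using DERIV_add[OF DERIV_const DERIV_cdivide[OF DERIV_mult[OF dr DERIV_sin]], of c0] by simp
    also have "(cos \<theta> * dl / T * sin \<theta> + cos \<theta> * r \<theta>) / \<omega> = (cos \<theta> * dl * sin \<theta> + cos \<theta> * (T * r \<theta>)) / (T * \<omega>)"
      using T \<omega>_pos by (simp add: field_simps)
    also have "\<dots> = r \<theta> * cos \<theta> / T" unfolding Tr using T \<omega>_pos by (simp add: field_simps)
    finally show ?thesis using S by (simp add: v1_def y_def S_def)
  qed
  have dy: "(y has_real_derivative force1 p F (\<phi> \<theta>) (P \<theta>) / T) (at \<theta>)"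
  proof -
    have "(y has_real_derivative cos \<theta> * dl / T * cos \<theta> - r \<theta> * sin \<theta>) (at \<theta>)"
      unfolding y_def[abs_def] using DERIV_mult[OF dr DERIV_cos] by (simp add: mult.commute[of "sin \<theta>" "r \<theta>"])
    also have "cos \<theta> * dl / T * cos \<theta> - r \<theta> * sin \<theta> = (cos \<theta> * cos \<theta> * dl - sin \<theta> * (T * r \<theta>)) / T"
      using T by (simp add: field_simps)
    also have "cos \<theta> * cos \<theta> * dl - sin \<theta> * (T * r \<theta>) = ((sin \<theta>)\<^sup>2 + (cos \<theta>)\<^sup>2) * dl - \<omega> * r \<theta> * sin \<theta>"
      unfolding Tr by (simp only: algebra_simps power2_eq_square)
    also have "\<dots> = force1 p F (\<phi> \<theta>) (P \<theta>)"
      unfolding sin_cos_squared_add using \<omega>_pos by (simp add: dl_def \<Delta>_def \<phi>_def power2_eq_square)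
    finally show ?thesis .
  qed
  define m' where "m' = 2 * A12 p (\<phi> \<theta>) * asymmetry p * sin (\<phi> \<theta>) / A22 p (\<phi> \<theta>)
    - 2 * (A12 p (\<phi> \<theta>))\<^sup>2 * asymmetry p * sin (\<phi> \<theta>) / (A22 p (\<phi> \<theta>))\<^sup>2"
  have PP: "A12 p (\<phi> \<theta>) * v1 \<theta> + A22 p (\<phi> \<theta>) * v2 \<theta> = P \<theta>"
    using A_nz(2)[OF pos, of "\<phi> \<theta>"] by (simp add: v2_def)
  define d1 where "d1 = dv1 p F (\<phi> \<theta>) (v1 \<theta>) (v2 \<theta>)"
  define d2 where "d2 = dv2 p F (\<phi> \<theta>) (v1 \<theta>) (v2 \<theta>)"
  have d1: "S * S * d1 = force1 p F (\<phi> \<theta>) (P \<theta>) - m' * (v1 \<theta>)\<^sup>2 / 2"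
    using dv1_force1[OF pos, of "\<phi> \<theta>" F "v1 \<theta>" "v2 \<theta>"] unfolding PP S(2) m'_def d1_def .
  have dm: "((\<lambda>\<theta>. mass1 p (\<phi> \<theta>)) has_real_derivative m' * (v1 \<theta> * S / T)) (at \<theta>)"
    unfolding m'_def by (rule DERIV_chain2[OF DERIV_mass1[OF pos] d\<phi>])
  have dv1: "(v1 has_real_derivative S / T * d1) (at \<theta>)"
  proof -
    have "((\<lambda>\<theta>. sqrt (mass1 p (\<phi> \<theta>))) has_real_derivative inverse S / 2 * (m' * (v1 \<theta> * S / T))) (at \<theta>)"
      unfolding S_def by (rule DERIV_chain2[OF DERIV_real_sqrt[OF A_pos(4)[OF pos]] dm[unfolded S_def]])
    from DERIV_divide[OF dy this] S
    have "(v1 has_real_derivative (force1 p F (\<phi> \<theta>) (P \<theta>) / T * S - y \<theta> * (inverse S / 2 * (m' * (v1 \<theta> * S / T)))) / (S * S)) (at \<theta>)"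
      by (simp add: v1_def[abs_def] S_def)
    also have "y \<theta> = v1 \<theta> * S" using S by (simp add: v1_def S_def)
    also have "(force1 p F (\<phi> \<theta>) (P \<theta>) / T * S - v1 \<theta> * S * (inverse S / 2 * (m' * (v1 \<theta> * S / T)))) / (S * S)
        = S / T * ((force1 p F (\<phi> \<theta>) (P \<theta>) - m' * (v1 \<theta>)\<^sup>2 / 2) / (S * S))"
      using S(1) T by (simp add: field_simps power2_eq_square)
    also have "\<dots> = S / T * d1" unfolding d1[symmetric] using S(1) by simp
    finally show ?thesis .
  qed
  have dv2: "(v2 has_real_derivative S / T * d2) (at \<theta>)"
  proof -
    define A e B where "A = A12 p (\<phi> \<theta>)" and "e = asymmetry p * sin (\<phi> \<theta>)" and "B = A22 p (\<phi> \<theta>)"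
    have B: "B > 0" using A_pos(2)[OF pos] by (simp add: B_def)
    have dA: "((\<lambda>\<theta>. A12 p (\<phi> \<theta>)) has_real_derivative - e * (v1 \<theta> * S / T)) (at \<theta>)"
      using DERIV_chain2[OF DERIV_A12[OF pos] d\<phi>] by (simp add: e_def)
    have dB: "((\<lambda>\<theta>. A22 p (\<phi> \<theta>)) has_real_derivative - 2 * e * (v1 \<theta> * S / T)) (at \<theta>)"
      using DERIV_chain2[OF DERIV_A22[OF pos] d\<phi>] by (simp add: e_def mult.assoc)
    have "(v2 has_real_derivative ((S * torque2 p F (\<phi> \<theta>) / T - (- e * (v1 \<theta> * S / T) * v1 \<theta> + S / T * d1 * A)) * B
        - (P \<theta> - A * v1 \<theta>) * (- 2 * e * (v1 \<theta> * S / T))) / (B * B)) (at \<theta>)"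
      unfolding v2_def[abs_def] A_def B_def
      by (rule DERIV_divide DERIV_diff DERIV_mult dP dA dB dv1 A_nz(2)[OF pos])+
    also have "P \<theta> - A * v1 \<theta> = v2 \<theta> * B" using B by (simp add: v2_def A_def B_def)
    also have "((S * torque2 p F (\<phi> \<theta>) / T - (- e * (v1 \<theta> * S / T) * v1 \<theta> + S / T * d1 * A)) * B
        - v2 \<theta> * B * (- 2 * e * (v1 \<theta> * S / T))) / (B * B)
      = S / T * ((torque2 p F (\<phi> \<theta>) + e * v1 \<theta> * (v1 \<theta> + 2 * v2 \<theta>) - A * d1) / B)"
      using B T by (simp add: field_simps)
    also have "torque2 p F (\<phi> \<theta>) + e * v1 \<theta> * (v1 \<theta> + 2 * v2 \<theta>) = r2 p F (\<phi> \<theta>) (v1 \<theta>) (v2 \<theta>)"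
      by (simp add: torque2_def r2_def e_def asymmetry_def)
    also have "\<dots> = A * d1 + B * d2"
      using accelerations_unique[OF pos, of d1 "\<phi> \<theta>" d2 "v1 \<theta>" "v2 \<theta>" F] by (simp add: d1_def d2_def A_def B_def)
    finally show ?thesis using B by simp
  qed
  have nth: "Pi \<theta> (\<eta> \<theta> w) $ 1 = \<phi> \<theta>" "Pi \<theta> (\<eta> \<theta> w) $ 2 = v1 \<theta>" "Pi \<theta> (\<eta> \<theta> w) $ 3 = v2 \<theta>" for \<theta>
    by (simp_all add: Pi_nth \<phi>_def v1_def v2_def y_def r_def P_def)
  have cs: "1 / clock_speed \<theta> (\<eta> \<theta> w) = S / T"
    by (simp add: clock_speed_def S_def T_def \<phi>_def r_def)
  show ?thesis
  proof (rule has_vector_derivative_vec)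
    fix i :: 3
    show "((\<lambda>\<theta>. Pi \<theta> (\<eta> \<theta> w) $ i) has_real_derivative
        ((1 / clock_speed \<theta> (\<eta> \<theta> w)) *\<^sub>R reduced_system p F (Pi \<theta> (\<eta> \<theta> w))) $ i) (at \<theta>)"
      using d\<phi> dv1 dv2 exhaust_3[of i]
      by (auto simp: nth reduced_system_def cs d1_def d2_def mult.commute)
  qed
qed

end

section \<open>The tube of periodic trajectories\<close>

context polar_pendulum
begin

definition rad :: "real^3 \<Rightarrow> real" where
  "rad z = sqrt ((\<omega> * (z $ 1 - c0))\<^sup>2 + mass1 p (z $ 1) * (z $ 2)\<^sup>2)"

definition mom :: "real^3 \<Rightarrow> real" where "mom z = A12 p (z $ 1) * z $ 2 + A22 p (z $ 1) * z $ 3"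

lemma sqrt_mass1: "sqrt (mass1 p \<phi>) > 0" "(sqrt (mass1 p \<phi>))\<^sup>2 = mass1 p \<phi>"
  using A_pos(4)[OF pos, of \<phi>] by auto

lemma Pi_polar:
  "\<omega> * (Pi \<theta> w $ 1 - c0) = fst w * sin \<theta>" "sqrt (mass1 p (Pi \<theta> w $ 1)) * Pi \<theta> w $ 2 = fst w * cos \<theta>"
  using \<omega>_pos sqrt_mass1(1)[of "Pi \<theta> w $ 1"] unfolding Pi_nth(1,2) by auto

lemma rad_eq: "rad z = sqrt ((\<omega> * (z $ 1 - c0))\<^sup>2 + (sqrt (mass1 p (z $ 1)) * z $ 2)\<^sup>2)"
  by (simp add: rad_def power_mult_distrib sqrt_mass1(2))

lemma rad_Pi: "fst w > 0 \<Longrightarrow> rad (Pi \<theta> w) = fst w"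
proof -
  assume w: "fst w > 0"
  have "(fst w * sin \<theta>)\<^sup>2 + (fst w * cos \<theta>)\<^sup>2 = (fst w)\<^sup>2 * ((sin \<theta>)\<^sup>2 + (cos \<theta>)\<^sup>2)"
    by (simp only: power_mult_distrib distrib_left)
  also have "\<dots> = (fst w)\<^sup>2" by simp
  finally show ?thesis using w by (simp add: rad_eq Pi_polar)
qed

lemma mom_Pi: "mom (Pi \<theta> w) = snd w"
  unfolding mom_def Pi_nth(3) using A_nz(2)[OF pos, of "Pi \<theta> w $ 1"] by (simp add: field_simps)

lemma Pi_eqI:
  assumes "\<omega> * (z $ 1 - c0) = rad z * sin \<theta>" "sqrt (mass1 p (z $ 1)) * z $ 2 = rad z * cos \<theta>"
  shows "Pi \<theta> (rad z, mom z) = z"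
proof -
  have 1: "Pi \<theta> (rad z, mom z) $ 1 = z $ 1"
    using assms(1) \<omega>_pos by (simp add: Pi_nth(1) field_simps)
  have 2: "Pi \<theta> (rad z, mom z) $ 2 = z $ 2"
    unfolding Pi_nth(2) 1 using assms(2) sqrt_mass1(1)[of "z $ 1"] by (simp add: field_simps)
  have 3: "Pi \<theta> (rad z, mom z) $ 3 = z $ 3"
    unfolding Pi_nth(3) 1 2 using A_nz(2)[OF pos, of "z $ 1"] by (simp add: mom_def field_simps)
  show ?thesis using 1 2 3 by (simp add: vec_eq_iff forall_3)
qed

lemma Pi_inj:
  assumes "Pi \<theta> w = Pi \<theta>' w'" "fst w > 0" "fst w' > 0"
  obtains n :: int where "\<theta> = \<theta>' + 2 * pi * of_int n" "w = w'"
proof -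
  have "fst w = fst w'" using rad_Pi[OF assms(2), of \<theta>] rad_Pi[OF assms(3), of \<theta>'] assms(1) by simp
  moreover have "snd w = snd w'" using mom_Pi[of \<theta> w] mom_Pi[of \<theta>' w'] assms(1) by simp
  ultimately have w: "w = w'" by (simp add: prod_eq_iff)
  have "sin \<theta> = sin \<theta>' \<and> cos \<theta> = cos \<theta>'"
    using Pi_polar[of \<theta> w] Pi_polar[of \<theta>' w'] assms unfolding w by simp
  then show thesis using sin_cos_eq_iff[of \<theta> \<theta>'] w that by auto
qed

lemma Pi_smooth: "differentiable_upto n UNIV (\<lambda>q. Pi (fst q) (snd q))"
proof (rule differentiable_upto_vec[OF open_UNIV])
  have f: "differentiable_upto n UNIV (\<lambda>q::real \<times> real \<times> real. fst q)"
    "differentiable_upto n UNIV (\<lambda>q::real \<times> real \<times> real. fst (snd q))"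
    "differentiable_upto n UNIV (\<lambda>q::real \<times> real \<times> real. snd (snd q))"
    by (intro differentiable_upto_bounded_linear open_UNIV bounded_linear_fst
        bounded_linear_compose[OF bounded_linear_fst bounded_linear_snd]
        bounded_linear_compose[OF bounded_linear_snd bounded_linear_snd])+
  have 1: "differentiable_upto n UNIV (\<lambda>q. Pi (fst q) (snd q) $ 1)"
    unfolding Pi_nth
    by (intro differentiable_upto_intros differentiable_upto_divide open_UNIV f) (use \<omega>_pos in simp)
  have 2: "differentiable_upto n UNIV (\<lambda>q. Pi (fst q) (snd q) $ 2)"
    unfolding Pi_nth(2)
    by (intro differentiable_upto_divide differentiable_upto_mult differentiable_upto_cos
        differentiable_upto_A(5) open_UNIV pos f 1 A_nz)
  have 3: "differentiable_upto n UNIV (\<lambda>q. Pi (fst q) (snd q) $ 3)"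
    unfolding Pi_nth(3)
    by (intro differentiable_upto_divide differentiable_upto_mult differentiable_upto_diff
        differentiable_upto_A(1,2) open_UNIV pos f 1 2 A_nz)
  show "differentiable_upto n UNIV (\<lambda>q. Pi (fst q) (snd q) $ i)" for i
    using exhaust_3[of i] 1 2 3 by metis
qed

text \<open>A branch of the angle near \<open>\<theta>0\<close>: \<open>ahead\<close> and \<open>aside\<close> are \<open>r cos (\<theta> - \<theta>0)\<close> and
  \<open>r sin (\<theta> - \<theta>0)\<close>.\<close>

definition ahead :: "real \<Rightarrow> real^3 \<Rightarrow> real" where
  "ahead \<theta>0 z = \<omega> * (z $ 1 - c0) * sin \<theta>0 + sqrt (mass1 p (z $ 1)) * z $ 2 * cos \<theta>0"
definition aside :: "real \<Rightarrow> real^3 \<Rightarrow> real" where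
  "aside \<theta>0 z = \<omega> * (z $ 1 - c0) * cos \<theta>0 - sqrt (mass1 p (z $ 1)) * z $ 2 * sin \<theta>0"
definition branch :: "real \<Rightarrow> real^3 \<Rightarrow> real" where
  "branch \<theta>0 z = \<theta>0 + arctan (aside \<theta>0 z / ahead \<theta>0 z)"
definition chart :: "real \<Rightarrow> real^3 \<Rightarrow> real \<times> (real \<times> real)" where
  "chart \<theta>0 z = (branch \<theta>0 z, (rad z, mom z))"

lemma ahead_smooth: "open S \<Longrightarrow> differentiable_upto n S (ahead \<theta>0)" "open S \<Longrightarrow> differentiable_upto n S (aside \<theta>0)"
  unfolding ahead_def[abs_def] aside_def[abs_def]
  by (intro differentiable_upto_intros differentiable_upto_A pos differentiable_upto_vec_nth; assumption)+

lemma open_ahead: "open {z. ahead \<theta>0 z > 0}"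
  using differentiable_upto_imp_continuous[OF ahead_smooth(1)[OF open_UNIV, of 0 \<theta>0]]
  by (intro open_Collect_less continuous_on_const)

lemma rad_aside_ahead: "rad z = sqrt ((aside \<theta>0 z)\<^sup>2 + (ahead \<theta>0 z)\<^sup>2)"
proof -
  have "(aside \<theta>0 z)\<^sup>2 + (ahead \<theta>0 z)\<^sup>2
      = ((\<omega> * (z $ 1 - c0))\<^sup>2 + (sqrt (mass1 p (z $ 1)) * z $ 2)\<^sup>2) * ((sin \<theta>0)\<^sup>2 + (cos \<theta>0)\<^sup>2)"
    unfolding aside_def ahead_def by (simp only: power2_eq_square algebra_simps)
  then show ?thesis by (simp add: rad_eq)
qed

lemma rad_pos: "ahead \<theta>0 z > 0 \<Longrightarrow> rad z > 0"
  unfolding rad_aside_ahead[of z \<theta>0] by (simp add: add_nonneg_pos)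

lemma chart_smooth: "differentiable_upto n {z. ahead \<theta>0 z > 0} (chart \<theta>0)"
proof -
  note o = open_ahead[of \<theta>0]
  have 1: "differentiable_upto n {z. ahead \<theta>0 z > 0} (branch \<theta>0)"
    unfolding branch_def[abs_def]
    by (intro differentiable_upto_add differentiable_upto_const differentiable_upto_arctan differentiable_upto_divide
        ahead_smooth o) auto
  have pos': "(\<omega> * (z $ 1 - c0))\<^sup>2 + mass1 p (z $ 1) * (z $ 2)\<^sup>2 > 0" if "z \<in> {z. ahead \<theta>0 z > 0}" for z
    using rad_pos[of \<theta>0 z] that unfolding rad_def by simp
  have 2: "differentiable_upto n {z. ahead \<theta>0 z > 0} rad"
    unfolding rad_def[abs_def]
    by (intro differentiable_upto_sqrt differentiable_upto_intros differentiable_upto_A pos differentiable_upto_vec_nth o pos')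
  have 3: "differentiable_upto n {z. ahead \<theta>0 z > 0} mom"
    unfolding mom_def[abs_def]
    by (intro differentiable_upto_intros differentiable_upto_A pos differentiable_upto_vec_nth o)
  show ?thesis unfolding chart_def[abs_def] by (intro differentiable_upto_Pair o 1 2 3)
qed

lemma Pi_chart:
  assumes "ahead \<theta>0 z > 0"
  shows "Pi (branch \<theta>0 z) (rad z, mom z) = z"
proof (rule Pi_eqI)
  define x y where "x = \<omega> * (z $ 1 - c0)" and "y = sqrt (mass1 p (z $ 1)) * z $ 2"
  define d n where "d = ahead \<theta>0 z" and "n = aside \<theta>0 z"
  have dn: "d = x * sin \<theta>0 + y * cos \<theta>0" "n = x * cos \<theta>0 - y * sin \<theta>0"
    by (simp_all add: d_def n_def ahead_def aside_def x_def y_def)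
  have d: "d > 0" using assms by (simp add: d_def)
  have r: "rad z = d * sqrt (1 + (n / d)\<^sup>2)"
  proof -
    have "n\<^sup>2 + d\<^sup>2 = d\<^sup>2 * (1 + (n / d)\<^sup>2)" using d by (simp add: field_simps power2_eq_square)
    then show ?thesis using d unfolding rad_aside_ahead[of z \<theta>0] d_def[symmetric] n_def[symmetric]
      by (simp add: real_sqrt_mult)
  qed
  have s: "sqrt (1 + (n / d)\<^sup>2) > 0" by (simp add: add_pos_nonneg)
  have rc: "rad z * cos (arctan (n / d)) = d" using s by (simp add: r cos_arctan)
  have rs: "rad z * sin (arctan (n / d)) = n" using s d by (simp add: r sin_arctan)
  have b: "branch \<theta>0 z = \<theta>0 + arctan (n / d)" by (simp add: branch_def n_def d_def)
  have "rad z * sin (branch \<theta>0 z) = sin \<theta>0 * (rad z * cos (arctan (n / d))) + cos \<theta>0 * (rad z * sin (arctan (n / d)))"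
    unfolding b sin_add by (simp only: algebra_simps)
  also have "\<dots> = x * ((sin \<theta>0)\<^sup>2 + (cos \<theta>0)\<^sup>2)" unfolding rc rs unfolding dn by (simp only: power2_eq_square algebra_simps)
  finally show "\<omega> * (z $ 1 - c0) = rad z * sin (branch \<theta>0 z)" by (simp add: x_def)
  have "rad z * cos (branch \<theta>0 z) = cos \<theta>0 * (rad z * cos (arctan (n / d))) - sin \<theta>0 * (rad z * sin (arctan (n / d)))"
    unfolding b cos_add by (simp only: algebra_simps)
  also have "\<dots> = y * ((sin \<theta>0)\<^sup>2 + (cos \<theta>0)\<^sup>2)" unfolding rc rs unfolding dn by (simp only: power2_eq_square algebra_simps)
  finally show "sqrt (mass1 p (z $ 1)) * z $ 2 = rad z * cos (branch \<theta>0 z)" by (simp add: y_def)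
qed

lemma chart_Pi:
  assumes "fst w > 0"
  shows "ahead \<theta> (Pi \<theta> w) > 0" "chart \<theta> (Pi \<theta> w) = (\<theta>, w)"
proof -
  have 1: "ahead \<theta> (Pi \<theta> w) = fst w * ((sin \<theta>)\<^sup>2 + (cos \<theta>)\<^sup>2)"
    unfolding ahead_def Pi_polar by (simp only: power2_eq_square algebra_simps)
  have 2: "aside \<theta> (Pi \<theta> w) = 0" unfolding aside_def Pi_polar by simp
  show "ahead \<theta> (Pi \<theta> w) > 0" using 1 assms by simp
  show "chart \<theta> (Pi \<theta> w) = (\<theta>, w)" by (simp add: chart_def branch_def 2 rad_Pi[OF assms] mom_Pi)
qed

text \<open>\<open>K\<close> sends a point to the value of \<open>w = (r, P)\<close> at angle zero on the trajectory through it. Any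
  choice of the angle gives the same result, since \<open>\<kappa>\<close> is periodic.\<close>

definition W :: "(real^3) set" where "W = (\<lambda>q. Pi (fst q) (snd q)) ` U"

definition K :: "real^3 \<Rightarrow> real \<times> real" where
  "K z = \<kappa> (SOME \<theta>. Pi \<theta> (rad z, mom z) = z) (rad z, mom z)"

lemma W_cases:
  assumes "z \<in> W"
  obtains \<theta> w where "w \<in> D" "z = Pi \<theta> (\<eta> \<theta> w)"
proof -
  from assms obtain q where q: "q \<in> U" "z = Pi (fst q) (snd q)" by (auto simp: W_def)
  show thesis by (rule that[of "\<kappa> (fst q) (snd q)" "fst q"]) (use q in \<open>auto simp: U_def \<eta>_\<kappa>\<close>)
qed

lemma W_I: "w \<in> D \<Longrightarrow> Pi \<theta> (\<eta> \<theta> w) \<in> W"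
  unfolding W_def by (rule image_eqI[of _ _ "(\<theta>, \<eta> \<theta> w)"]) (auto intro: U_I)

lemma K_Pi:
  assumes "fst w > 0"
  shows "K (Pi \<theta> w) = \<kappa> \<theta> w"
proof -
  have eq: "(rad (Pi \<theta> w), mom (Pi \<theta> w)) = w" by (simp add: rad_Pi[OF assms] mom_Pi)
  define \<theta>' where "\<theta>' = (SOME \<theta>'. Pi \<theta>' w = Pi \<theta> w)"
  have "Pi \<theta>' w = Pi \<theta> w" unfolding \<theta>'_def by (rule someI) (rule refl)
  then obtain n :: int where "\<theta>' = \<theta> + 2 * pi * of_int n" using Pi_inj[OF _ assms assms] by metis
  then have "\<kappa> \<theta>' w = \<kappa> \<theta> w" by (simp only: \<kappa>_periodic_int)
  then show ?thesis unfolding K_def eq \<theta>'_def .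
qed

lemma K_solution: "w \<in> D \<Longrightarrow> K (Pi \<theta> (\<eta> \<theta> w)) = w"
  by (simp add: K_Pi in_D_estimates \<kappa>_\<eta>)

lemma chart_neighbourhood:
  assumes "z \<in> W"
  obtains \<theta> S where "open S" "z \<in> S" "S \<subseteq> W" "S \<subseteq> {z. ahead \<theta> z > 0}" "chart \<theta> ` S \<subseteq> U"
proof -
  obtain \<theta> w where w: "w \<in> D" "z = Pi \<theta> (\<eta> \<theta> w)" using W_cases[OF assms] .
  let ?H = "{z. ahead \<theta> z > 0}"
  let ?S = "?H \<inter> chart \<theta> -` U"
  show thesis
  proof (rule that[of ?S \<theta>])
    show "open ?S"
      by (rule continuous_open_preimage[OF differentiable_upto_imp_continuous[OF chart_smooth[of 0]] open_ahead open_U])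
    show "z \<in> ?S" using chart_Pi[OF in_D_estimates(1)[OF w(1)], of \<theta> \<theta>] U_I[OF w(1)] by (simp add: w(2))
    show "?S \<subseteq> W"
    proof
      fix x assume x: "x \<in> ?S"
      then have "x = Pi (fst (chart \<theta> x)) (snd (chart \<theta> x))" using Pi_chart[of \<theta> x] by (simp add: chart_def)
      then show "x \<in> W" unfolding W_def using x by (intro image_eqI[of _ _ "chart \<theta> x"]) auto
    qed
  qed auto
qed

lemma open_W: "open W"
  by (rule Topological_Spaces.openI) (use chart_neighbourhood in metis)

lemma smooth_K: "differentiable_upto n W K"
proof (rule differentiable_upto_local[OF _ open_W])
  fix z assume "z \<in> W"
  then obtain \<theta> S where S: "open S" "z \<in> S" "S \<subseteq> W" "S \<subseteq> {z. ahead \<theta> z > 0}" "chart \<theta> ` S \<subseteq> U"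
    by (rule chart_neighbourhood)
  have "differentiable_upto n S (\<lambda>z. (\<lambda>q. \<kappa> (fst q) (snd q)) (chart \<theta> z))"
    by (rule differentiable_upto_compose[OF S(1) differentiable_upto_subset[OF chart_smooth S(4)] _ S(5)])
      (use smooth_\<kappa> in \<open>simp add: smooth_on_def\<close>)
  then have "differentiable_upto n S K"
  proof (rule differentiable_upto_cong[OF S(1), rotated])
    fix x assume x: "x \<in> S"
    then have a: "ahead \<theta> x > 0" using S(4) by auto
    show "\<kappa> (fst (chart \<theta> x)) (snd (chart \<theta> x)) = K x"
      using K_Pi[of "(rad x, mom x)" "branch \<theta> x"] rad_pos[OF a] Pi_chart[OF a] by (simp add: chart_def)
  qed
  moreover have "W \<inter> S = S" using S(3) by auto
  ultimately show "\<exists>O'. open O' \<and> z \<in> O' \<and> differentiable_upto n (W \<inter> O') K" using S(1,2) by (intro exI[of _ S]) simp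
qed

lemma clock_speed_smooth: "differentiable_upto n {q. fst (snd q) > 0} (\<lambda>q. clock_speed (fst q) (snd q))"
  unfolding clock_speed_def
  by (intro differentiable_upto_divide polar_functions_smooth differentiable_upto_A pos differentiable_upto_add
      differentiable_upto_const open_positive_radius A_nz)

lemma periodic_trajectory:
  assumes "z \<in> W"
  obtains x T where "x 0 = z" "\<And>t. x t \<in> W" "\<And>t. (x has_vector_derivative reduced_system p F (x t)) (at t)"
    "T > 0" "\<And>t. x (t + T) = x t" "\<And>t. K (x t) = K z"
proof -
  obtain \<theta>0 w where w: "w \<in> D" "z = Pi \<theta>0 (\<eta> \<theta>0 w)" using W_cases[OF assms] .
  have c: "continuous_on UNIV (\<lambda>\<theta>. clock_speed \<theta> (\<eta> \<theta> w))"
  proof (rule continuous_on_compose2[OF differentiable_upto_imp_continuous[OF clock_speed_smooth[of 0]],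
        where f="\<lambda>\<theta>. (\<theta>, \<eta> \<theta> w)", simplified])
    have "continuous_on UNIV (\<lambda>\<theta>. \<eta> \<theta> w)"
      using has_vector_derivative_continuous[OF \<eta>_deriv[OF w(1)]] by (simp add: continuous_at_imp_continuous_on)
    then show "continuous_on UNIV (\<lambda>\<theta>. (\<theta>, \<eta> \<theta> w))" by (intro continuous_on_Pair continuous_on_id)
    show "(\<lambda>\<theta>. (\<theta>, \<eta> \<theta> w)) ` UNIV \<subseteq> {q. 0 < fst (snd q)}" using in_D_estimates(1)[OF w(1)] by auto
  qed
  have per: "clock_speed (\<theta> + 2 * pi) (\<eta> (\<theta> + 2 * pi) w) = clock_speed \<theta> (\<eta> \<theta> w)" for \<theta>
    by (simp add: clock_speed_def \<Theta>_def \<eta>_periodic)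
  obtain \<theta> T where \<theta>: "\<theta> 0 = \<theta>0" "\<And>t. (\<theta> has_real_derivative clock_speed (\<theta> t) (\<eta> (\<theta> t) w)) (at t)"
    "T > 0" "\<And>t. \<theta> (t + T) = \<theta> t + 2 * pi"
    using clock[OF c clock_speed_pos[OF w(1)] per] by metis
  show thesis
  proof (rule that[of "\<lambda>t. Pi (\<theta> t) (\<eta> (\<theta> t) w)" T])
    fix t
    have "(\<theta> has_vector_derivative clock_speed (\<theta> t) (\<eta> (\<theta> t) w)) (at t)"
      using \<theta>(2) by (simp add: has_real_derivative_iff_has_vector_derivative)
    from vector_diff_chain_at[OF this Pi_solution[OF w(1)]]
    show "((\<lambda>t. Pi (\<theta> t) (\<eta> (\<theta> t) w)) has_vector_derivative
        reduced_system p F (Pi (\<theta> t) (\<eta> (\<theta> t) w))) (at t)"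
      using clock_speed_pos[OF w(1), of "\<theta> t"] by (simp add: o_def)
    show "Pi (\<theta> (t + T)) (\<eta> (\<theta> (t + T)) w) = Pi (\<theta> t) (\<eta> (\<theta> t) w)"
      by (simp add: \<theta>(4) \<eta>_periodic Pi_def)
  qed (use w \<theta> W_I K_solution in auto)
qed

text \<open>At an equilibrium \<open>cos \<theta>\<close> and the force vanish, which makes the angular speed zero.\<close>

lemma reduced_system_nz:
  assumes "z \<in> W"
  shows "z $ 2 \<noteq> 0 \<or> dv1 p F (z $ 1) (z $ 2) (z $ 3) \<noteq> 0"
proof (rule ccontr)
  assume "\<not> ?thesis"
  then have z: "z $ 2 = 0" "dv1 p F (z $ 1) (z $ 2) (z $ 3) = 0" by auto
  obtain \<theta> w where w: "w \<in> D" "z = Pi \<theta> (\<eta> \<theta> w)" using W_cases[OF assms] .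
  note e = in_D_estimates[OF w(1), of \<theta>]
  define r where "r = fst (\<eta> \<theta> w)"
  have r: "r > 0" using e by (simp add: r_def)
  have "r * cos \<theta> = 0" using Pi_polar(2)[of \<theta> "\<eta> \<theta> w"] z(1) by (simp add: w(2) r_def)
  then have "cos \<theta> = 0" using r by simp
  then have s: "sin \<theta> * sin \<theta> = 1" using sin_cos_squared_add[of \<theta>] by (simp add: power2_eq_square)
  have "mom z = snd (\<eta> \<theta> w)" by (simp add: w(2) mom_Pi)
  moreover have "z $ 1 = c0 + r * sin \<theta> / \<omega>" by (simp add: w(2) Pi_nth(1) r_def)
  ultimately have "force1 p F (c0 + r * sin \<theta> / \<omega>) (snd (\<eta> \<theta> w)) = 0"
    using dv1_force1[OF pos, of "z $ 1" F "z $ 2" "z $ 3", folded mom_def] z by simp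
  then have "\<Delta> (r * sin \<theta> / \<omega>) (snd (\<eta> \<theta> w)) = \<omega> * r * sin \<theta>"
    using \<omega>_pos by (simp add: \<Delta>_def power2_eq_square)
  then have "\<Theta> \<theta> (\<eta> \<theta> w) = \<omega> - \<omega> * (sin \<theta> * sin \<theta>)"
    unfolding \<Theta>_def r_def[symmetric] using r by simp
  then show False using e(2) s by simp
qed

lemma reduced_periodic: "filled_by_periodic_trajectories (reduced_system p F) W"
  unfolding filled_by_periodic_trajectories_def
proof
  fix z assume z: "z \<in> W"
  obtain x T where x: "x 0 = z" "\<And>t. x t \<in> W" "\<And>t. (x has_vector_derivative reduced_system p F (x t)) (at t)"
    "T > 0" "\<And>t. x (t + T) = x t" using periodic_trajectory[OF z] by metis
  have "\<not> x constant_on UNIV"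
  proof
    assume "x constant_on UNIV"
    then have "x = (\<lambda>_. z)" using x(1) by (auto simp: constant_on_def)
    then have "reduced_system p F z = 0"
      using x(3)[of 0] has_vector_derivative_const[of z] x(1) by (metis vector_derivative_at)
    then have "reduced_system p F z $ 1 = 0" "reduced_system p F z $ 2 = 0" by simp_all
    then show False using reduced_system_nz[OF z] by (simp add: reduced_system_def)
  qed
  then show "\<exists>x T. trajectory (reduced_system p F) W UNIV x \<and> x 0 = z \<and> 0 < T \<and> (\<forall>t. x (t + T) = x t) \<and> \<not> x constant_on UNIV"
    using x by (intro exI[of _ x] exI[of _ T]) (auto simp: trajectory_def)
qed

text \<open>The derivative of \<open>K\<close> is onto, because \<open>w \<mapsto> Pi \<theta> (\<eta> \<theta> w)\<close> is a differentiable right inverse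
  of \<open>K\<close>. It annihilates the field, because \<open>K\<close> is constant along the trajectories.\<close>

lemma K_derivative:
  assumes z: "z \<in> W"
  obtains DK where "(K has_derivative DK) (at z)" "DK (reduced_system p F z) = 0" "\<And>k. \<exists>h. DK h = k"
proof -
  have DK: "(K has_derivative frechet_derivative K (at z)) (at z)"
    by (rule differentiable_upto_SucD(1)[OF smooth_K[of "Suc 0"] z])
  obtain x where x: "x 0 = z" "\<And>t. (x has_vector_derivative reduced_system p F (x t)) (at t)" "\<And>t. K (x t) = K z"
    using periodic_trajectory[OF z] by metis
  have "((\<lambda>t. K (x t)) has_derivative (\<lambda>h. frechet_derivative K (at z) (h *\<^sub>R reduced_system p F z))) (at 0)"
    using has_derivative_compose[of x "\<lambda>h. h *\<^sub>R reduced_system p F z" 0 UNIV K] x(1) x(2)[of 0] DK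
    by (simp add: has_vector_derivative_def)
  then have "frechet_derivative K (at z) (1 *\<^sub>R reduced_system p F z) = 0"
    unfolding x(3) using has_derivative_unique[OF _ has_derivative_const] by metis
  then have 1: "frechet_derivative K (at z) (reduced_system p F z) = 0" by simp
  obtain \<theta> w where w: "w \<in> D" "z = Pi \<theta> (\<eta> \<theta> w)" using W_cases[OF z] .
  have "((\<lambda>v. (\<theta>, v)) has_derivative (\<lambda>k. (0, k))) (at (\<eta> \<theta> w))"
    by (auto intro!: derivative_eq_intros)
  from has_derivative_compose[OF this differentiable_upto_SucD(1)[OF Pi_smooth[of "Suc 0"] UNIV_I]]
  have "Pi \<theta> differentiable (at (\<eta> \<theta> w))" unfolding differentiable_def by auto
  with differentiable_\<eta>[OF w(1), of \<theta>] obtain E where E: "((\<lambda>v. Pi \<theta> (\<eta> \<theta> v)) has_derivative E) (at w)"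
    unfolding differentiable_def using has_derivative_compose by metis
  have "((\<lambda>v. K (Pi \<theta> (\<eta> \<theta> v))) has_derivative (\<lambda>k. frechet_derivative K (at z) (E k))) (at w)"
    by (rule has_derivative_compose[OF E]) (use DK w in simp)
  then have "((\<lambda>v. v) has_derivative (\<lambda>k. frechet_derivative K (at z) (E k))) (at w)"
    by (rule has_derivative_transform_within_open[OF _ open_D w(1)]) (rule K_solution)
  then have "(\<lambda>k. frechet_derivative K (at z) (E k)) = (\<lambda>k. k)"
    using has_derivative_unique has_derivative_ident by blast
  then show thesis using that[OF DK 1] by metis
qed

end

section \<open>Integrability in the tube\<close>

definition reduce :: "real^4 \<Rightarrow> real^3" where "reduce z = vector [z $ 1, z $ 3, z $ 4]"

lemma reduce_nth: "reduce z $ 1 = z $ 1" "reduce z $ 2 = z $ 3" "reduce z $ 3 = z $ 4"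
  by (simp_all add: reduce_def)

lemma bounded_linear_reduce: "bounded_linear reduce"
  by (auto intro!: linear_conv_bounded_linear[THEN iffD1] linearI simp: vec_eq_iff forall_3 reduce_nth)

lemma full_region_eq: "full_region W = reduce -` W"
  by (auto simp: full_region_def reduce_def)

lemma surj_reduce: "\<exists>z. reduce z = w"
  by (rule exI[of _ "\<chi> i. if i = 1 then w $ 1 else if i = 3 then w $ 2 else w $ 3"])
    (simp add: vec_eq_iff forall_3 reduce_nth)

text \<open>The full system depends on the reduced state only. Its derivative is therefore bounded on the
  preimage of a bounded set, although \<open>\<phi>\<^sub>2\<close> is unbounded there.\<close>

definition lift_field :: "pendulum \<Rightarrow> real \<Rightarrow> real^3 \<Rightarrow> real^4" where
  "lift_field p F w = (\<chi> i. if i = 1 then w $ 2 else if i = 2 then w $ 3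
    else if i = 3 then dv1 p F (w $ 1) (w $ 2) (w $ 3) else dv2 p F (w $ 1) (w $ 2) (w $ 3))"

context polar_pendulum
begin

lemma full_system_lift: "full_system p F z = lift_field p F (reduce z)"
  by (simp add: vec_eq_iff forall_4 full_system_nth[OF pos] lift_field_def reduce_nth)

lemma reduce_full_system: "reduce (full_system p F z) = reduced_system p F (reduce z)"
  by (simp add: vec_eq_iff forall_3 reduce_nth full_system_nth[OF pos] reduced_system_def)

lemma smooth_lift_field: "differentiable_upto n UNIV (lift_field p F)"
proof (rule differentiable_upto_vec[OF open_UNIV])
  fix i :: 4
  have c: "differentiable_upto n UNIV (\<lambda>z::real^3. z $ j)" for j
    by (intro differentiable_upto_bounded_linear open_UNIV bounded_linear_vec_nth)
  note dv = differentiable_upto_dv[OF pos open_UNIV c c c]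
  show "differentiable_upto n UNIV (\<lambda>x. lift_field p F x $ i)"
    using exhaust_4[of i] by (auto simp: lift_field_def c dv simp del: differentiable_upto.simps)
qed

lemma full_system_derivative:
  "(full_system p F has_derivative (\<lambda>h. frechet_derivative (lift_field p F) (at (reduce z)) (reduce h))) (at z)"
  unfolding full_system_lift[abs_def]
  by (rule has_derivative_compose[OF bounded_linear_imp_has_derivative[OF bounded_linear_reduce]])
    (rule differentiable_upto_SucD(1)[OF smooth_lift_field[of "Suc 0"] UNIV_I])

lemma smooth_full_system: "differentiable_upto n UNIV (full_system p F)"
  unfolding full_system_lift[abs_def]
  by (rule differentiable_upto_compose[OF open_UNIV _ smooth_lift_field])
    (auto intro: differentiable_upto_bounded_linear bounded_linear_reduce)

text \<open>The map \<open>\<pi>\<close> will be the identity for the reduced system and \<open>reduce\<close> for the full one.\<close>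

lemma integrals_pullback:
  fixes \<pi> :: "'b::euclidean_space \<Rightarrow> real^3"
  assumes \<pi>: "bounded_linear \<pi>" "\<And>w. \<exists>z. \<pi> z = w" and X: "\<And>z. \<pi> (X z) = reduced_system p F (\<pi> z)"
  shows "first_integral X (\<pi> -` W) (\<lambda>z. fst (K (\<pi> z)))" "first_integral X (\<pi> -` W) (\<lambda>z. snd (K (\<pi> z)))"
    "functionally_independent (\<pi> -` W) (\<lambda>z. fst (K (\<pi> z))) (\<lambda>z. snd (K (\<pi> z)))"
    "(\<forall>z. \<pi> (Y z) = 0) \<or> Y = X \<Longrightarrow> preserves Y (\<pi> -` W) (\<lambda>z. fst (K (\<pi> z)))"
    "(\<forall>z. \<pi> (Y z) = 0) \<or> Y = X \<Longrightarrow> preserves Y (\<pi> -` W) (\<lambda>z. snd (K (\<pi> z)))"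
proof -
  have o: "open (\<pi> -` W)" by (intro open_vimage open_W linear_continuous_on \<pi>)
  have s: "differentiable_upto n (\<pi> -` W) (\<lambda>z. K (\<pi> z))" for n
    by (rule differentiable_upto_compose[OF o differentiable_upto_bounded_linear[OF o \<pi>(1)] smooth_K]) auto
  have D: "\<exists>E. ((\<lambda>z. K (\<pi> z)) has_derivative E) (at z) \<and> E (X z) = 0 \<and> (\<forall>k. \<exists>h. E h = k) \<and> (\<forall>h. \<pi> h = 0 \<longrightarrow> E h = 0)"
    if z: "\<pi> z \<in> W" for z
  proof -
    obtain DK where DK: "(K has_derivative DK) (at (\<pi> z))" "DK (reduced_system p F (\<pi> z)) = 0" "\<And>k. \<exists>h. DK h = k"
      using K_derivative[OF z] by metis
    have "((\<lambda>z. K (\<pi> z)) has_derivative (\<lambda>h. DK (\<pi> h))) (at z)"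
      by (rule has_derivative_compose[OF bounded_linear_imp_has_derivative[OF \<pi>(1)] DK(1)])
    moreover have "\<exists>h. DK (\<pi> h) = k" for k using DK(3)[of k] \<pi>(2) by metis
    moreover have "DK 0 = 0" using has_derivative_linear[OF DK(1)] by (rule linear_0)
    ultimately show ?thesis using X[of z] DK(2) by (intro exI[of _ "\<lambda>h. DK (\<pi> h)"]) auto
  qed
  have const: "\<exists>k. \<forall>t\<in>J. K (\<pi> (x t)) = k" if J: "is_interval J" and x: "trajectory X (\<pi> -` W) J x" for J x
  proof (rule has_derivative_zero_constant)
    show "convex J" using J by (simp add: is_interval_convex)
    fix t assume t: "t \<in> J"
    then have "\<pi> (x t) \<in> W" "(x has_derivative (\<lambda>h. h *\<^sub>R X (x t))) (at t within J)"
      using x by (auto simp: trajectory_def has_vector_derivative_def)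
    moreover obtain E where E: "((\<lambda>z. K (\<pi> z)) has_derivative E) (at (x t))" "E (X (x t)) = 0"
      using D[OF \<open>\<pi> (x t) \<in> W\<close>] by blast
    ultimately have "((\<lambda>t. K (\<pi> (x t))) has_derivative (\<lambda>h. E (h *\<^sub>R X (x t)))) (at t within J)"
      using has_derivative_compose[of x "\<lambda>h. h *\<^sub>R X (x t)" t J "\<lambda>z. K (\<pi> z)" E] by simp
    then show "((\<lambda>t. K (\<pi> (x t))) has_derivative (\<lambda>h. 0)) (at t within J)"
      by (simp add: linear_cmul[OF has_derivative_linear[OF E(1)]] E(2))
  qed
  show "first_integral X (\<pi> -` W) (\<lambda>z. fst (K (\<pi> z)))"
    unfolding first_integral_def smooth_on_def
    using const differentiable_upto_linear_compose[OF bounded_linear_fst o s]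
    by (auto simp: constant_on_def simp del: differentiable_upto.simps) (metis fst_conv)
  show "first_integral X (\<pi> -` W) (\<lambda>z. snd (K (\<pi> z)))"
    unfolding first_integral_def smooth_on_def
    using const differentiable_upto_linear_compose[OF bounded_linear_snd o s]
    by (auto simp: constant_on_def simp del: differentiable_upto.simps) (metis snd_conv)
  have fd: "frechet_derivative (\<lambda>z. fst (K (\<pi> z))) (at z) = (\<lambda>h. fst (E h))"
    "frechet_derivative (\<lambda>z. snd (K (\<pi> z))) (at z) = (\<lambda>h. snd (E h))"
    if "((\<lambda>z. K (\<pi> z)) has_derivative E) (at z)" for z E
    using frechet_derivative_at[OF has_derivative_fst[OF that]] frechet_derivative_at[OF has_derivative_snd[OF that]]
    by auto
  show "functionally_independent (\<pi> -` W) (\<lambda>z. fst (K (\<pi> z))) (\<lambda>z. snd (K (\<pi> z)))"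
    unfolding functionally_independent_def
  proof (intro ballI allI impI)
    fix z a b assume "z \<in> \<pi> -` W"
      and 0: "\<forall>h. a * frechet_derivative (\<lambda>z. fst (K (\<pi> z))) (at z) h + b * frechet_derivative (\<lambda>z. snd (K (\<pi> z))) (at z) h = 0"
    then obtain E where E: "((\<lambda>z. K (\<pi> z)) has_derivative E) (at z)" "\<And>k. \<exists>h. E h = k" using D by (metis vimageD)
    obtain h h' where "E h = (1, 0)" "E h' = (0, 1)" using E(2) by metis
    then show "a = 0 \<and> b = 0" using 0[rule_format, of h] 0[rule_format, of h'] by (simp add: fd[OF E(1)])
  qed
  assume Y: "(\<forall>z. \<pi> (Y z) = 0) \<or> Y = X"
  have "frechet_derivative (\<lambda>z. fst (K (\<pi> z))) (at z) (Y z) = 0 \<and> frechet_derivative (\<lambda>z. snd (K (\<pi> z))) (at z) (Y z) = 0"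
    if zW: "z \<in> \<pi> -` W" for z
  proof -
    obtain E where E: "((\<lambda>z. K (\<pi> z)) has_derivative E) (at z)" "E (X z) = 0" "\<And>h. \<pi> h = 0 \<Longrightarrow> E h = 0"
      using D[OF vimageD[OF zW]] by metis
    then have "E (Y z) = 0" using Y by auto
    then show ?thesis by (simp add: fd[OF E(1)])
  qed
  then show "preserves Y (\<pi> -` W) (\<lambda>z. fst (K (\<pi> z)))" "preserves Y (\<pi> -` W) (\<lambda>z. snd (K (\<pi> z)))"
    unfolding preserves_def by blast+
qed

lemma reduced_integrals: "two_independent_first_integrals (reduced_system p F) W"
  using integrals_pullback(1-3)[of "\<lambda>z. z" "reduced_system p F"]
  unfolding two_independent_first_integrals_def by (auto simp: bounded_linear_ident)

lemmas full_integrals = integrals_pullback[OF bounded_linear_reduce surj_reduce reduce_full_system, folded full_region_eq]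

lemma full_symmetric: "broadly_integrable (full_system p F) d_phi2 (full_region W)"
proof -
  have Y: "reduce (d_phi2 z) = 0" for z by (simp add: vec_eq_iff forall_3 reduce_nth d_phi2_def axis_def)
  have o: "open (full_region W)"
    unfolding full_region_eq by (intro open_vimage open_W linear_continuous_on bounded_linear_reduce)
  show ?thesis unfolding broadly_integrable_def
  proof (intro conjI ballI allI impI)
    show "smooth_on (full_region W) (full_system p F)"
      unfolding smooth_on_def using smooth_full_system differentiable_upto_subset by blast
    show "smooth_on (full_region W) d_phi2"
      unfolding smooth_on_def d_phi2_def[abs_def] using differentiable_upto_const[OF o] by blast
    show "lie_bracket (full_system p F) d_phi2 z = 0" for z
    proof -
      have "frechet_derivative (full_system p F) (at z) (d_phi2 z) = 0"
        unfolding frechet_derivative_at[OF full_system_derivative, symmetric] Y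
        by (rule linear_0, rule has_derivative_linear) (rule differentiable_upto_SucD(1)[OF smooth_lift_field[of "Suc 0"] UNIV_I])
      moreover have "frechet_derivative d_phi2 (at z) = (\<lambda>h. 0)"
        unfolding d_phi2_def[abs_def] by (rule frechet_derivative_at[symmetric]) (rule has_derivative_const)
      ultimately show ?thesis by (simp add: lie_bracket_def)
    qed
  next
    fix z a b assume z: "z \<in> full_region W" and 0: "a *\<^sub>R full_system p F z + b *\<^sub>R d_phi2 z = 0"
    have c: "a * z $ 3 = 0" "a * dv1 p F (z $ 1) (z $ 3) (z $ 4) = 0" "a * z $ 4 + b = 0"
      using 0 by (auto simp: vec_eq_iff forall_4 full_system_nth[OF pos] d_phi2_def axis_def)
    have "z $ 3 \<noteq> 0 \<or> dv1 p F (z $ 1) (z $ 3) (z $ 4) \<noteq> 0"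
      using reduced_system_nz[of "reduce z"] z by (simp add: full_region_eq reduce_nth)
    then show "a = 0" using c by auto
    then show "b = 0" using c by simp
  next
    show "\<exists>f g. first_integral (full_system p F) (full_region W) f \<and> first_integral (full_system p F) (full_region W) g \<and>
      functionally_independent (full_region W) f g \<and> preserves (full_system p F) (full_region W) f \<and>
      preserves (full_system p F) (full_region W) g \<and> preserves d_phi2 (full_region W) f \<and> preserves d_phi2 (full_region W) g"
      using full_integrals(1-3) full_integrals(4,5)[of "full_system p F"] full_integrals(4,5)[of d_phi2] Y by blast
  qed
qed

text \<open>The angle \<open>\<phi>\<^sub>2\<close> is recovered from a trajectory of the reduced system by a quadrature.\<close>

lemma full_trajectory:
  assumes "z \<in> full_region W"
  shows "\<exists>x. x 0 = z \<and> (\<forall>t. x t \<in> full_region W \<and> (x has_vector_derivative full_system p F (x t)) (at t))"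
proof -
  have "reduce z \<in> W" using assms by (simp add: full_region_eq)
  then obtain y where y: "y 0 = reduce z" "\<And>t. y t \<in> W"
    "\<And>t. (y has_vector_derivative reduced_system p F (y t)) (at t)" using periodic_trajectory by metis
  have dy: "((\<lambda>t. y t $ i) has_real_derivative reduced_system p F (y t) $ i) (at t)" for i t
    unfolding has_real_derivative_iff_has_vector_derivative
    by (rule bounded_linear.has_vector_derivative[OF bounded_linear_vec_nth y(3)])
  have c: "continuous_on UNIV (\<lambda>t. y t $ 3)"
    using DERIV_isCont[OF dy] by (simp add: continuous_at_imp_continuous_on)
  have d2: "((\<lambda>t. z $ 2 + primitive (\<lambda>s. y s $ 3) t) has_real_derivative y t $ 3) (at t)" for t
    using DERIV_add[OF DERIV_const primitive_has_vector_derivative[OF c, of t, folded has_real_derivative_iff_has_vector_derivative]]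
    by simp
  define x :: "real \<Rightarrow> real^4" where "x t = (\<chi> i. if i = 1 then y t $ 1 else if i = 2 then z $ 2 + primitive (\<lambda>s. y s $ 3) t
    else if i = 3 then y t $ 2 else y t $ 3)" for t
  have r: "reduce (x t) = y t" for t by (simp add: vec_eq_iff forall_3 reduce_nth x_def)
  have "x 0 = z"
    using arg_cong[OF y(1), of "\<lambda>v. v $ 1"] arg_cong[OF y(1), of "\<lambda>v. v $ 2"] arg_cong[OF y(1), of "\<lambda>v. v $ 3"]
    by (simp add: vec_eq_iff forall_4 x_def reduce_nth primitive_0)
  moreover have "(x has_vector_derivative full_system p F (x t)) (at t)" for t
  proof (rule has_vector_derivative_vec)
    fix i :: 4
    have X: "full_system p F (x t) = lift_field p F (y t)" by (simp add: full_system_lift r)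
    show "((\<lambda>t. x t $ i) has_real_derivative full_system p F (x t) $ i) (at t)"
      unfolding X using exhaust_4[of i] dy[of 1 t] dy[of 2 t] dy[of 3 t] d2[of t]
      by (auto simp: x_def lift_field_def reduced_system_def)
  qed
  moreover have "x t \<in> full_region W" for t by (simp add: full_region_eq r y(2))
  ultimately show ?thesis by blast
qed

lemma bounded_W: "bounded W"
proof -
  let ?B = "cbox ((r0, P0) - (a, b)) ((r0, P0) + (a, b))"
  note c = differentiable_upto_imp_continuous[OF Pi_smooth[of 0]]
  have "bounded ((\<lambda>q. Pi (fst q) (snd q)) ` ({-pi..pi} \<times> ?B))"
    by (intro compact_imp_bounded compact_continuous_image continuous_on_subset[OF c] compact_Times) auto
  moreover have "W \<subseteq> (\<lambda>q. Pi (fst q) (snd q)) ` ({-pi..pi} \<times> ?B)"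
  proof
    fix z assume "z \<in> W"
    then obtain \<theta> w where w: "w \<in> D" "z = Pi \<theta> (\<eta> \<theta> w)" by (rule W_cases)
    obtain n where n: "\<theta> - 2 * pi * of_int n \<in> {-pi..pi}" by (rule reduce_angle)
    have "sin (\<theta> - 2 * pi * of_int n) = sin \<theta> \<and> cos (\<theta> - 2 * pi * of_int n) = cos \<theta>"
      unfolding sin_cos_eq_iff by (rule exI[of _ "- n"]) simp
    then have "z = Pi (\<theta> - 2 * pi * of_int n) (\<eta> \<theta> w)" unfolding w(2) Pi_def by simp
    then show "z \<in> (\<lambda>q. Pi (fst q) (snd q)) ` ({-pi..pi} \<times> ?B)"
      using n \<eta>_in_box[OF w(1), of \<theta>] box_subset_cbox[of "(r0, P0) - (a, b)" "(r0, P0) + (a, b)"]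
      by (intro image_eqI[of _ _ "(\<theta> - 2 * pi * of_int n, \<eta> \<theta> w)"]) auto
  qed
  ultimately show ?thesis by (rule bounded_subset)
qed

text \<open>The density \<open>det A\<close> is the Jacobian determinant of the passage from velocities to momenta.\<close>

lemma divergence_free:
  "frechet_derivative (\<lambda>z. detA p (z $ 1)) (at z) (full_system p F z)
    + detA p (z $ 1) * trace (matrix (frechet_derivative (full_system p F) (at z))) = 0"
proof -
  define \<phi> v1 v2 where "\<phi> = z $ 1" and "v1 = z $ 3" and "v2 = z $ 4"
  define e where "e = asymmetry p * sin \<phi>"
  define J where "J = frechet_derivative (full_system p F) (at z)"
  have J: "(full_system p F has_derivative J) (at z)"
    unfolding J_def frechet_derivative_works[symmetric] using full_system_derivative differentiable_def by blast
  note nz = A_nz(3)[OF pos, of \<phi>]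
  have DdetA: "(detA p has_real_derivative - 2 * e * (A11 p - A12 p \<phi>)) (at \<phi>)"
    unfolding detA_def[abs_def] e_def
    by (rule derivative_eq_intros DERIV_A12[OF pos] DERIV_A22[OF pos] refl)+ (simp add: algebra_simps)
  have "((\<lambda>z. detA p (z $ 1)) has_derivative (\<lambda>h. h $ 1 * (- 2 * e * (A11 p - A12 p \<phi>)))) (at z)"
    unfolding \<phi>_def by (rule DERIV_compose_FDERIV[where g="\<lambda>z. z $ 1", OF DdetA[unfolded \<phi>_def]])
      (rule bounded_linear_imp_has_derivative[OF bounded_linear_vec_nth])
  then have "frechet_derivative (\<lambda>z. detA p (z $ 1)) (at z) = (\<lambda>h. h $ 1 * (- 2 * e * (A11 p - A12 p \<phi>)))"
    by (rule frechet_derivative_at[symmetric])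
  then have \<rho>': "frechet_derivative (\<lambda>z. detA p (z $ 1)) (at z) (full_system p F z) = v1 * (- 2 * e * (A11 p - A12 p \<phi>))"
    by (simp add: full_system_nth[OF pos] v1_def)
  have line: "((\<lambda>t. full_system p F (z + t *\<^sub>R axis i 1) $ i) has_real_derivative J (axis i 1) $ i) (at 0)" for i
  proof -
    have "((\<lambda>t. z + t *\<^sub>R axis i 1) has_derivative (\<lambda>h. h *\<^sub>R axis i 1)) (at 0)"
      by (auto intro!: derivative_eq_intros)
    from has_derivative_compose[OF this, of "full_system p F" J]
    have "((\<lambda>t. full_system p F (z + t *\<^sub>R axis i 1)) has_derivative (\<lambda>h. J (h *\<^sub>R axis i 1))) (at 0)"
      using J by simp
    from bounded_linear.has_derivative[OF bounded_linear_vec_nth this, of i]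
    show ?thesis by (simp add: has_field_derivative_def linear_cmul[OF has_derivative_linear[OF J]] mult_commute_abs)
  qed
  have J1: "J (axis 1 1) $ 1 = 0"
    using DERIV_unique[OF line[of 1]] by (simp add: full_system_nth[OF pos] axis_def)
  have J2: "J (axis 2 1) $ 2 = 0"
    using DERIV_unique[OF line[of 2]] by (simp add: full_system_nth[OF pos] axis_def)
  have dr: "((\<lambda>t. r1 p \<phi> (v1 + t) v2) has_real_derivative 0) (at 0)"
    "((\<lambda>t. r2 p F \<phi> (v1 + t) v2) has_real_derivative e * (2 * v1 + 2 * v2)) (at 0)"
    "((\<lambda>t. r1 p \<phi> v1 (v2 + t)) has_real_derivative - 2 * e * v2) (at 0)"
    "((\<lambda>t. r2 p F \<phi> v1 (v2 + t)) has_real_derivative 2 * e * v1) (at 0)"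
    unfolding r1_def r2_def e_def asymmetry_def by (auto intro!: derivative_eq_intros simp: algebra_simps)
  have "((\<lambda>t. dv1 p F \<phi> (v1 + t) v2) has_real_derivative
      (A22 p \<phi> * 0 - A12 p \<phi> * (e * (2 * v1 + 2 * v2))) / detA p \<phi>) (at 0)"
    unfolding dv_eq[OF pos] by (intro DERIV_cdivide DERIV_diff DERIV_cmult dr)
  then have J3: "J (axis 3 1) $ 3 = (A22 p \<phi> * 0 - A12 p \<phi> * (e * (2 * v1 + 2 * v2))) / detA p \<phi>"
    by (intro DERIV_unique[OF line[of 3]]) (simp add: full_system_nth[OF pos] axis_def \<phi>_def v1_def v2_def)
  have "((\<lambda>t. dv2 p F \<phi> v1 (v2 + t)) has_real_derivative
      (A11 p * (2 * e * v1) - A12 p \<phi> * (- 2 * e * v2)) / detA p \<phi>) (at 0)"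
    unfolding dv_eq[OF pos] by (intro DERIV_cdivide DERIV_diff DERIV_cmult dr)
  then have J4: "J (axis 4 1) $ 4 = (A11 p * (2 * e * v1) - A12 p \<phi> * (- 2 * e * v2)) / detA p \<phi>"
    by (intro DERIV_unique[OF line[of 4]]) (simp add: full_system_nth[OF pos] axis_def \<phi>_def v1_def v2_def)
  have "trace (matrix J) = J (axis 1 1) $ 1 + J (axis 2 1) $ 2 + J (axis 3 1) $ 3 + J (axis 4 1) $ 4"
    by (simp add: trace_def matrix_def sum_4)
  then have "detA p \<phi> * trace (matrix J)
      = - A12 p \<phi> * (e * (2 * v1 + 2 * v2)) + (A11 p * (2 * e * v1) - A12 p \<phi> * (- 2 * e * v2))"
    unfolding J1 J2 J3 J4 using nz by (simp add: right_diff_distrib)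
  then show ?thesis unfolding \<rho>' J_def[symmetric] \<phi>_def[symmetric] by (simp only: algebra_simps)
qed

lemma full_Jacobi: "Jacobi_integrable (full_system p F) (full_region W)"
proof -
  have o: "open (full_region W)"
    unfolding full_region_eq by (intro open_vimage open_W linear_continuous_on bounded_linear_reduce)
  obtain R where R: "\<And>z. z \<in> W \<Longrightarrow> norm z < R"
    using bounded_W unfolding bounded_pos_less by blast
  let ?V = "reduce -` ball 0 R"
  note DH = differentiable_upto_SucD[OF smooth_lift_field[of "Suc 0"]]
  obtain C where C: "C \<ge> 0" "\<And>w k. w \<in> cball 0 R \<Longrightarrow> norm (frechet_derivative (lift_field p F) (at w) k) \<le> C * norm k"
  proof (rule bounded_derivative_on_compact[of "cball 0 R" "\<lambda>w. frechet_derivative (lift_field p F) (at w)"])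
    show "linear (frechet_derivative (lift_field p F) (at q))" for q
      using DH(1)[OF UNIV_I] by (rule has_derivative_linear)
    show "continuous_on (cball 0 R) (\<lambda>q. frechet_derivative (lift_field p F) (at q) k)" for k
      using differentiable_upto_imp_continuous[OF DH(2)] continuous_on_subset by blast
  qed auto
  obtain M where M: "M \<ge> 0" "\<And>h. norm (reduce h) \<le> norm h * M"
    using bounded_linear.nonneg_bounded[OF bounded_linear_reduce] by blast
  obtain \<Phi> where \<Phi>: "\<And>z. z \<in> full_region W \<Longrightarrow> \<Phi> z 0 = z"
    "\<And>z t. z \<in> full_region W \<Longrightarrow> \<Phi> z t \<in> full_region W"
    "\<And>z t. z \<in> full_region W \<Longrightarrow> (\<Phi> z has_vector_derivative full_system p F (\<Phi> z t)) (at t)"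
    using full_trajectory by metis
  interpret fl: invariant_flow_vec "full_system p F" ?V "full_region W" "\<lambda>t z. \<Phi> z t" "C * M"
  proof unfold_locales
    show "open ?V" by (intro open_vimage open_ball linear_continuous_on bounded_linear_reduce)
    show "convex ?V"
      by (rule convex_linear_vimage[OF bounded_linear.linear[OF bounded_linear_reduce] convex_ball])
    show "open (full_region W)" by (rule o)
    show "full_region W \<subseteq> ?V" using R by (auto simp: full_region_eq)
    show "smooth_on ?V (full_system p F)"
      unfolding smooth_on_def using smooth_full_system differentiable_upto_subset by blast
    show "norm (frechet_derivative (full_system p F) (at z) h) \<le> C * M * norm h" if "z \<in> ?V" for z h
    proof -
      have "norm (frechet_derivative (lift_field p F) (at (reduce z)) (reduce h)) \<le> C * norm (reduce h)"
        by (rule C(2)) (use that in auto)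
      also have "\<dots> \<le> C * (norm h * M)" by (intro mult_left_mono M C)
      finally show ?thesis
        unfolding frechet_derivative_at[OF full_system_derivative, symmetric] by (simp add: mult_ac)
    qed
    show "C * M \<ge> 0" using C M by simp
  qed (use \<Phi> in auto)
  have "smooth_invariant_measure (full_system p F) (full_region W) (\<lambda>z. detA p (z $ 1))"
  proof (rule fl.Liouville)
    show "smooth_on (full_region W) (\<lambda>z. detA p (z $ 1))"
      unfolding smooth_on_def by (intro allI differentiable_upto_A(3)[OF pos o] differentiable_upto_vec_nth o)
    show "detA p (z $ 1) > 0" for z :: "real^4" by (rule A_pos(3)[OF pos])
    show "frechet_derivative (\<lambda>z. detA p (z $ 1)) (at z) (full_system p F z)
        + detA p (z $ 1) * trace (matrix (fl.DX z)) = 0" for z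
      unfolding fl.DX_def[abs_def] by (rule divergence_free)
  qed
  then show ?thesis
    unfolding Jacobi_integrable_def two_independent_first_integrals_def using full_integrals(1-3) by blast
qed

theorem integrable_tube:
  "\<exists>W. open W \<and> W \<noteq> {} \<and>
     filled_by_periodic_trajectories (reduced_system p F) W \<and>
     two_independent_first_integrals (reduced_system p F) W \<and>
     Jacobi_integrable (full_system p F) (full_region W) \<and>
     broadly_integrable (full_system p F) d_phi2 (full_region W)"
  using open_W W_I[OF centre_in_D] reduced_periodic reduced_integrals full_Jacobi full_symmetric
  by (intro exI[of _ W]) auto

end

section \<open>Existence of a tube\<close>

context
  fixes p :: pendulum
  assumes pos: "positive_masses_and_lengths p"
begin

lemma l2_pos: "l2 p > 0"
  using pos by (simp add: positive_masses_and_lengths_def)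

lemma A_eq: "A12 p \<phi> = A11 p + asymmetry p * cos \<phi>"
  "A22 p \<phi> = ((m1 p + m2 p + m3 p) * (l2 p)\<^sup>2 + A11 p) + 2 * asymmetry p * cos \<phi>"
  by (simp_all add: A11_def A12_def A22_def asymmetry_def)

lemma A12_le: "\<bar>A12 p \<phi>\<bar> \<le> A11 p + \<bar>asymmetry p\<bar>"
proof -
  have "\<bar>asymmetry p * cos \<phi>\<bar> \<le> \<bar>asymmetry p\<bar> * 1" unfolding abs_mult by (intro mult_left_mono) auto
  then show ?thesis using A_pos(1)[OF pos] by (simp add: A_eq)
qed

lemma A22_ge: "A22 p \<phi> \<ge> min (A22 p 0) (A22 p pi)"
proof -
  have "\<bar>asymmetry p * cos \<phi>\<bar> \<le> \<bar>asymmetry p\<bar> * 1" unfolding abs_mult by (intro mult_left_mono) auto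
  then show ?thesis by (auto simp: A_eq(2) min_def)
qed

lemma torque_le: "\<bar>sqrt (mass1 p \<phi>) * torque2 p F \<phi>\<bar> \<le> sqrt (A11 p) * (\<bar>F\<bar> * l2 p) * \<bar>sin \<phi>\<bar>"
proof -
  have "mass1 p \<phi> = A11 p - (A12 p \<phi>)\<^sup>2 / A22 p \<phi>"
    using A_nz(2)[OF pos, of \<phi>] by (simp add: mass1_def detA_def field_simps)
  also have "\<dots> \<le> A11 p" using A_pos(2)[OF pos, of \<phi>] by simp
  finally have "sqrt (mass1 p \<phi>) \<le> sqrt (A11 p)" by simp
  moreover have "\<bar>sqrt (mass1 p \<phi>) * torque2 p F \<phi>\<bar> = sqrt (mass1 p \<phi>) * ((\<bar>F\<bar> * l2 p) * \<bar>sin \<phi>\<bar>)"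
    using l2_pos A_pos(4)[OF pos, of \<phi>] by (simp add: torque2_def abs_mult)
  ultimately show ?thesis using l2_pos by (simp add: mult_right_mono mult.assoc)
qed

text \<open>The deviation of the force from the linear one is bounded for bounded \<open>P\<close>. The change of \<open>P\<close> during
  half a turn has a bound that is independent of the amplitude. So \<open>b\<close> is chosen first, then \<open>\<delta>\<close>
  and \<open>a\<close>, and the amplitude \<open>r0\<close> last.\<close>

lemma large_oscillations:
  assumes k: "k1 p > 0"
  obtains \<omega> r0 a b \<delta> \<sigma> where "polar_pendulum p F 0 \<omega> r0 0 a b \<delta> \<sigma>"
proof -
  define \<omega> where "\<omega> = sqrt (k1 p)"
  have \<omega>: "\<omega> > 0" "\<omega>\<^sup>2 = k1 p" using k by (auto simp: \<omega>_def)
  define \<mu> where "\<mu> = min (A22 p 0) (A22 p pi)"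
  have \<mu>: "\<mu> > 0" using A_pos(2)[OF pos] by (simp add: \<mu>_def)
  define \<sigma> where "\<sigma> = sqrt (A11 p) * (\<bar>F\<bar> * l2 p)"
  have \<sigma>: "\<sigma> \<ge> 0" using l2_pos A_pos(1)[OF pos] by (simp add: \<sigma>_def)
  define b where "b = 2 * pi * \<sigma> / \<omega> + 1"
  have b: "b > 0" using \<sigma> \<omega> by (simp add: b_def add_nonneg_pos)
  define \<delta> where "\<delta> = \<bar>F\<bar> * l2 p * (A11 p + \<bar>asymmetry p\<bar>) / \<mu> + b\<^sup>2 * \<bar>asymmetry p\<bar> / \<mu>\<^sup>2"
  have \<delta>: "\<delta> \<ge> 0" using l2_pos A_pos(1)[OF pos] \<mu> by (simp add: \<delta>_def)
  define a where "a = 2 * pi * \<delta> / \<omega> + 1"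
  have bound: "\<bar>force1 p F x P + \<omega>\<^sup>2 * x\<bar> \<le> \<delta>" if P: "\<bar>P\<bar> \<le> b" for x P
  proof -
    have A: "A22 p x \<ge> \<mu>" unfolding \<mu>_def by (rule A22_ge)
    have s: "\<bar>F * l2 p * sin x * A12 p x / A22 p x\<bar> \<le> \<bar>F\<bar> * l2 p * (A11 p + \<bar>asymmetry p\<bar>) / \<mu>"
    proof -
      have "\<bar>F * l2 p * sin x * A12 p x\<bar> = (\<bar>F\<bar> * l2 p) * (\<bar>sin x\<bar> * \<bar>A12 p x\<bar>)"
        using l2_pos by (simp add: abs_mult)
      also have "\<dots> \<le> (\<bar>F\<bar> * l2 p) * (1 * (A11 p + \<bar>asymmetry p\<bar>))"
        using l2_pos by (intro mult_left_mono mult_mono A12_le) auto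
      finally have "\<bar>F * l2 p * sin x * A12 p x\<bar> / \<bar>A22 p x\<bar> \<le> (\<bar>F\<bar> * l2 p * (A11 p + \<bar>asymmetry p\<bar>)) / \<mu>"
        using A \<mu> l2_pos A_pos(1)[OF pos] by (intro frac_le) auto
      then show ?thesis by simp
    qed
    have t: "\<bar>P\<^sup>2 * asymmetry p * sin x / (A22 p x)\<^sup>2\<bar> \<le> b\<^sup>2 * \<bar>asymmetry p\<bar> / \<mu>\<^sup>2"
    proof -
      have "P\<^sup>2 \<le> b\<^sup>2" using P by (metis abs_ge_zero power2_abs power_mono)
      then have "P\<^sup>2 * \<bar>asymmetry p\<bar> * \<bar>sin x\<bar> \<le> b\<^sup>2 * \<bar>asymmetry p\<bar> * 1"
        by (intro mult_mono) auto
      then have "\<bar>P\<^sup>2 * asymmetry p * sin x\<bar> / (A22 p x)\<^sup>2 \<le> (b\<^sup>2 * \<bar>asymmetry p\<bar>) / \<mu>\<^sup>2"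
        using A \<mu> by (intro frac_le) (auto simp: abs_mult intro: power_mono)
      then show ?thesis by simp
    qed
    have "force1 p F x P + \<omega>\<^sup>2 * x = F * l2 p * sin x * A12 p x / A22 p x - P\<^sup>2 * asymmetry p * sin x / (A22 p x)\<^sup>2"
      by (simp add: force1_def \<omega>(2))
    then show ?thesis using s t unfolding \<delta>_def by linarith
  qed
  have tb: "\<bar>sqrt (mass1 p x) * torque2 p F x\<bar> \<le> \<sigma>" for x
  proof -
    have "\<sigma> * \<bar>sin x\<bar> \<le> \<sigma> * 1" using \<sigma> by (intro mult_left_mono) auto
    then show ?thesis using torque_le[of x F] by (simp add: \<sigma>_def)
  qed
  show thesis
  proof (rule that[of \<omega> "a + 2 * \<delta> / \<omega> + 1" a b \<delta> \<sigma>], unfold_locales)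
    show "a < a + 2 * \<delta> / \<omega> + 1" using \<delta> \<omega> by (simp add: add_nonneg_pos)
    show "2 * \<delta> \<le> \<omega> * (a + 2 * \<delta> / \<omega> + 1 - a)" using \<omega> by (simp add: algebra_simps)
    show "2 * pi * \<delta> < \<omega> * a" "2 * pi * \<sigma> < \<omega> * b" using \<omega> by (simp_all add: a_def b_def algebra_simps)
  qed (use pos \<omega> \<delta> \<sigma> bound tb in auto)
qed

text \<open>The force at \<open>(c0 + x, P)\<close> is \<open>cos c0 sin x\<close> times a function \<open>Q\<close> of \<open>x\<close> and \<open>P\<close>, and the
  elliptic condition says \<open>cos c0 Q (0, P0) < 0\<close>. With the amplitude \<open>\<rho>\<close>, all of \<open>x\<close>, \<open>P - P0\<close>
  and the torque are of order \<open>\<rho>\<close>, whereas the deviation of the force from the linear one is of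
  smaller order.\<close>

lemma small_oscillations:
  assumes k: "k1 p = 0" and c0: "c0 = 0 \<or> c0 = pi"
    and elliptic: "cos c0 * (F * l2 p * A12 p c0 / A22 p c0 - P0\<^sup>2 * asymmetry p / (A22 p c0)\<^sup>2) < 0"
  obtains \<omega> r0 a b \<delta> \<sigma> where "polar_pendulum p F c0 \<omega> r0 P0 a b \<delta> \<sigma>"
proof -
  define Q where "Q q = F * l2 p * A12 p (c0 + fst q) / A22 p (c0 + fst q) - (snd q)\<^sup>2 * asymmetry p / (A22 p (c0 + fst q))\<^sup>2" for q :: "real \<times> real"
  define \<omega> where "\<omega> = sqrt (- (cos c0 * Q (0, P0)))"
  have \<omega>: "\<omega> > 0" "\<omega>\<^sup>2 = - (cos c0 * Q (0, P0))" using elliptic by (auto simp: \<omega>_def Q_def)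
  have sin_c0: "sin (c0 + x) = cos c0 * sin x" "\<bar>sin (c0 + x)\<bar> \<le> \<bar>x\<bar>" for x
    using c0 abs_sin_x_le_abs_x[of x] by (auto simp: sin_add)
  have f1: "force1 p F (c0 + x) P = (cos c0 * sin x) * Q (x, P)" for x P
    unfolding force1_def Q_def using k by (simp add: sin_c0 algebra_simps)
  define \<Delta> where "\<Delta> q = (cos c0 * sin (fst q)) *\<^sub>R Q q + \<omega>\<^sup>2 * fst q" for q :: "real \<times> real"
  have "((\<lambda>q. (cos c0 * sin (fst q)) *\<^sub>R Q q) has_derivative (\<lambda>h. (cos c0 * fst h) *\<^sub>R Q (0, P0))) (at (0, P0))"
  proof (rule has_derivative_vanishing_factor)
    show "((\<lambda>q::real \<times> real. cos c0 * sin (fst q)) has_derivative (\<lambda>h. cos c0 * fst h)) (at (0, P0))"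
      by (auto intro!: derivative_eq_intros)
    have "differentiable_upto 0 UNIV Q"
      unfolding Q_def[abs_def]
      by (intro differentiable_upto_diff differentiable_upto_divide differentiable_upto_mult differentiable_upto_power2
          differentiable_upto_const differentiable_upto_A[OF pos] differentiable_upto_add open_UNIV
          differentiable_upto_bounded_linear bounded_linear_fst bounded_linear_snd)
        (use A_nz(2)[OF pos] in auto)
    then show "isCont Q (0, P0)" by (simp add: continuous_on_eq_continuous_at)
  qed simp
  then have "(\<Delta> has_derivative (\<lambda>h. (cos c0 * fst h) *\<^sub>R Q (0, P0) + \<omega>\<^sup>2 * fst h)) (at (0, P0))"
    unfolding \<Delta>_def[abs_def] by (intro has_derivative_add derivative_intros) auto
  then have d\<Delta>: "(\<Delta> has_derivative (\<lambda>h. 0)) (at (0, P0))"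
    by (rule has_derivative_eq_rhs) (simp add: \<omega>(2) fun_eq_iff algebra_simps)
  define s0 where "s0 = sqrt (A11 p) * (\<bar>F\<bar> * l2 p)"
  have s0: "s0 \<ge> 0" using l2_pos A_pos(1)[OF pos] by (simp add: s0_def)
  define \<beta> where "\<beta> = 3 * pi * s0 / \<omega>\<^sup>2 + 1"
  have \<beta>: "\<beta> > 0" using s0 \<omega>(1) by (simp add: \<beta>_def add_nonneg_pos)
  define M where "M = 3 / (2 * \<omega>) + \<beta>"
  have M: "M > 0" using \<omega>(1) \<beta> by (simp add: M_def add_pos_pos)
  \<comment> \<open>\<open>M \<rho>\<close> bounds the distance from \<open>(0, P0)\<close>, so that \<open>\<delta> = e M \<rho> = \<omega> \<rho> / (8 \<pi>)\<close>.\<close>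
  define e where "e = \<omega> / (8 * pi * M)"
  have e: "e > 0" using \<omega>(1) M by (simp add: e_def)
  obtain d where d: "d > 0" "\<And>q. norm (q - (0, P0)) < d \<Longrightarrow> norm (\<Delta> q) \<le> e * norm (q - (0, P0))"
    using d\<Delta> e unfolding has_derivative_at_alt by (auto simp: \<Delta>_def)
  define \<rho> where "\<rho> = d / (2 * M)"
  have \<rho>: "\<rho> > 0" "M * \<rho> < d" using d(1) M by (auto simp: \<rho>_def)
  define \<sigma> where "\<sigma> = s0 * ((\<rho> + \<rho> / 2) / \<omega>)"
  have \<sigma>: "\<sigma> \<ge> 0" using s0 \<rho> \<omega>(1) by (simp add: \<sigma>_def)
  have eM: "e * M = \<omega> / (8 * pi)" using M by (simp add: e_def)
  show thesis
  proof (rule that[of \<omega> \<rho> "\<rho> / 2" "\<beta> * \<rho>" "e * (M * \<rho>)" \<sigma>], unfold_locales)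
    fix x P assume x: "\<bar>x\<bar> \<le> (\<rho> + \<rho> / 2) / \<omega>" and P: "\<bar>P - P0\<bar> \<le> \<beta> * \<rho>"
    have "norm ((x, P) - (0, P0)) \<le> \<bar>x\<bar> + \<bar>P - P0\<bar>"
      using norm_Pair_le[of x "P - P0"] by simp
    also have "\<dots> \<le> (\<rho> + \<rho> / 2) / \<omega> + \<beta> * \<rho>" by (rule add_mono[OF x P])
    also have "\<dots> = M * \<rho>" using \<omega>(1) by (simp add: M_def field_simps)
    finally have n: "norm ((x, P) - (0, P0)) \<le> M * \<rho>" .
    have "norm (\<Delta> (x, P)) \<le> e * norm ((x, P) - (0, P0))" by (rule d(2)) (use n \<rho>(2) in linarith)
    also have "\<dots> \<le> e * (M * \<rho>)" using n e by (intro mult_left_mono) auto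
    finally show "\<bar>force1 p F (c0 + x) P + \<omega>\<^sup>2 * x\<bar> \<le> e * (M * \<rho>)" by (simp add: f1 \<Delta>_def)
  next
    fix x assume x: "\<bar>x\<bar> \<le> (\<rho> + \<rho> / 2) / \<omega>"
    have "s0 * \<bar>sin (c0 + x)\<bar> \<le> s0 * ((\<rho> + \<rho> / 2) / \<omega>)"
      using s0 order_trans[OF sin_c0(2) x] by (intro mult_left_mono)
    then show "\<bar>sqrt (mass1 p (c0 + x)) * torque2 p F (c0 + x)\<bar> \<le> \<sigma>"
      using torque_le[of "c0 + x" F] by (simp add: s0_def \<sigma>_def)
  next
    have eM\<rho>: "e * (M * \<rho>) = \<omega> * \<rho> / (8 * pi)" using eM by (simp add: mult.assoc[symmetric])
    show "2 * (e * (M * \<rho>)) \<le> \<omega> * (\<rho> - \<rho> / 2)"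
    proof -
      have "\<omega> * \<rho> / (8 * pi) \<le> \<omega> * \<rho> / 8" using \<omega>(1) \<rho>(1) pi_ge_two by (intro divide_left_mono) auto
      moreover have "\<omega> * (\<rho> - \<rho> / 2) = \<omega> * \<rho> / 2" by (simp add: field_simps)
      moreover have "0 < \<omega> * \<rho>" using \<omega>(1) \<rho>(1) by simp
      ultimately show ?thesis unfolding eM\<rho> by linarith
    qed
    show "2 * pi * (e * (M * \<rho>)) < \<omega> * (\<rho> / 2)" unfolding eM\<rho> using \<omega>(1) \<rho>(1) by (simp add: field_simps)
    show "2 * pi * \<sigma> < \<omega> * (\<beta> * \<rho>)"
    proof -
      have "\<omega> * (\<beta> * \<rho>) = 2 * pi * \<sigma> + \<omega> * \<rho>"
        using \<omega>(1) by (simp add: \<beta>_def \<sigma>_def power2_eq_square field_simps)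
      then show ?thesis using \<omega>(1) \<rho>(1) by simp
    qed
    show "0 \<le> e * (M * \<rho>)" using e M \<rho>(1) by simp
  qed (use pos c0 k \<omega> \<rho> \<sigma> in auto)
qed

end

theorem proposition13:
  fixes F :: real
  shows "\<exists>\<epsilon>>0. \<forall>p. positive_masses_and_lengths p \<longrightarrow> k1 p > 0 \<or> (k1 p = 0 \<and> F < 0) \<longrightarrow>
    \<bar>m1 p * l1 p - m3 p * l3 p\<bar> < \<epsilon> \<longrightarrow>
    (\<exists>W. open W \<and> W \<noteq> {} \<and>
       filled_by_periodic_trajectories (reduced_system p F) W \<and>
       two_independent_first_integrals (reduced_system p F) W \<and>
       Jacobi_integrable (full_system p F) (full_region W) \<and>
       broadly_integrable (full_system p F) d_phi2 (full_region W))"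
proof (rule exI[of _ 1], intro conjI allI impI)
  fix p assume pos: "positive_masses_and_lengths p" and k: "k1 p > 0 \<or> k1 p = 0 \<and> F < 0"
  have "\<exists>c0 \<omega> r0 P0 a b \<delta> \<sigma>. polar_pendulum p F c0 \<omega> r0 P0 a b \<delta> \<sigma>"
  proof (cases "k1 p > 0")
    case True
    then show ?thesis using large_oscillations[OF pos] by metis
  next
    case False
    then have k0: "k1 p = 0" and F: "F < 0" using k by auto
    show ?thesis
    proof (cases "asymmetry p \<ge> 0")
      case True
      \<comment> \<open>At \<open>0\<close> the follower force is attracting.\<close>
      have "A12 p 0 > 0" using True A_pos(1)[OF pos] by (simp add: A_eq(1)[OF pos])
      then have "F * (l2 p * A12 p 0 / A22 p 0) < 0"
        using F l2_pos[OF pos] A_pos(2)[OF pos] by (intro mult_neg_pos divide_pos_pos mult_pos_pos)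
      then have "cos 0 * (F * l2 p * A12 p 0 / A22 p 0 - 0\<^sup>2 * asymmetry p / (A22 p 0)\<^sup>2) < 0"
        by (simp add: mult.assoc)
      from small_oscillations[OF pos k0 _ this] show ?thesis by metis
    next
      case False
      \<comment> \<open>At \<open>\<pi>\<close> the centrifugal force is attracting, and a large momentum lets it prevail.\<close>
      define u where "u = F * l2 p * A12 p pi / A22 p pi"
      define P0 where "P0 = sqrt ((\<bar>u\<bar> + 1) * (A22 p pi)\<^sup>2 / - asymmetry p)"
      have "P0\<^sup>2 = (\<bar>u\<bar> + 1) * (A22 p pi)\<^sup>2 / - asymmetry p"
        unfolding P0_def using False by (intro real_sqrt_pow2 divide_nonneg_nonneg mult_nonneg_nonneg) auto
      then have "P0\<^sup>2 * asymmetry p / (A22 p pi)\<^sup>2 = - (\<bar>u\<bar> + 1)"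
        using False A_nz(2)[OF pos, of pi] by simp
      moreover have "- 1 * (u - - (\<bar>u\<bar> + 1)) < 0" using abs_ge_minus_self[of u] by simp
      ultimately have "cos pi * (F * l2 p * A12 p pi / A22 p pi - P0\<^sup>2 * asymmetry p / (A22 p pi)\<^sup>2) < 0"
        unfolding u_def[symmetric] cos_pi by (simp only:)
      from small_oscillations[OF pos k0 _ this] show ?thesis by metis
    qed
  qed
  then obtain c0 \<omega> r0 P0 a b \<delta> \<sigma> where "polar_pendulum p F c0 \<omega> r0 P0 a b \<delta> \<sigma>" by blast
  then show "\<exists>W. open W \<and> W \<noteq> {} \<and> filled_by_periodic_trajectories (reduced_system p F) W \<and>
       two_independent_first_integrals (reduced_system p F) W \<and>
       Jacobi_integrable (full_system p F) (full_region W) \<and>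
       broadly_integrable (full_system p F) d_phi2 (full_region W)"
    by (rule polar_pendulum.integrable_tube)
qed simp

end
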